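(* There is a randomized algorithm running in time $O(n^2\log^2 n)$ for the all-pairs shortest paths problem on $n$-vertex graphs of linear neighborhood complexity; that is, on graphs $G$ with $\eta_G(m)\le c\,m$ for all $m$, where $c>0$ is a fixed constant (the implied constant in the running time depends only on $c$).
   Context: Graphs are finite, simple, undirected and unweighted. $N(v)$ denotes the set of neighbors of a vertex $v$. The neighborhood complexity of a graph $G$ is the function $$\eta_G(m)=\max_{C\subseteq V(G),\,|C|=m}\ \bigl|\{N(v)\cap C: v\in V(G)\}\bigr|,\qquad 1\le m\le |V(G)|.$$ The all-pairs shortest paths problem: given $G$, compute, for every vertex $v$, a shortest-path (breadth-first search) tree from $v$, and thus the distances between all pairs of vertices, where the length of a path is its number of edges. Running times are in the standard unit-cost RAM model. For randomized algorithms, the stated guarantees hold with high probability, i.e. with probability tending to $1$ as $n\to\infty$. *)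

theory Defs
  imports
    "HOL-Probability.Probability"
    "HOL-Library.Landau_Symbols"
    "HOL-Library.Extended_Nat"
    "HOL-Library.Log_Nat"
begin

section \<open>Finite simple graphs\<close>

definition simple_graph :: "'a set \<Rightarrow> 'a set set \<Rightarrow> bool" where
  "simple_graph V E \<longleftrightarrow> finite V \<and> E \<subseteq> {{u, v} | u v. u \<in> V \<and> v \<in> V \<and> u \<noteq> v}"

definition nbhd :: "'a set set \<Rightarrow> 'a \<Rightarrow> 'a set" where
  "nbhd E v = {u. {u, v} \<in> E}"

text \<open>Used only for \<open>1 \<le> m \<le> card V\<close>; otherwise the maximum may be over the empty set.\<close>

definition nbhd_complexity :: "'a set \<Rightarrow> 'a set set \<Rightarrow> nat \<Rightarrow> nat" where
  "nbhd_complexity V E m =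
     Max {card {nbhd E v \<inter> C | v. v \<in> V} | C. C \<subseteq> V \<and> card C = m}"

definition linear_nbhd_complexity :: "real \<Rightarrow> 'a set \<Rightarrow> 'a set set \<Rightarrow> bool" where
  "linear_nbhd_complexity c V E \<longleftrightarrow>
     (\<forall>m\<in>{1..card V}. real (nbhd_complexity V E m) \<le> c * real m)"

text \<open>Paths are given by their list of vertices; the number of edges is one less than the length.\<close>

definition is_path :: "'a set \<Rightarrow> 'a set set \<Rightarrow> 'a list \<Rightarrow> bool" where
  "is_path V E xs \<longleftrightarrow> xs \<noteq> [] \<and> distinct xs \<and> set xs \<subseteq> V \<and>
     successively (\<lambda>u v. {u, v} \<in> E) xs"

definition graph_dist :: "'a set \<Rightarrow> 'a set set \<Rightarrow> 'a \<Rightarrow> 'a \<Rightarrow> enat" where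
  "graph_dist V E u v =
     (INF xs\<in>{xs. is_path V E xs \<and> hd xs = u \<and> last xs = v}. enat (length xs - 1))"

definition connected_graph :: "'a set \<Rightarrow> 'a set set \<Rightarrow> bool" where
  "connected_graph V E \<longleftrightarrow> V \<noteq> {} \<and>
     (\<forall>u\<in>V. \<forall>v\<in>V. \<exists>xs. is_path V E xs \<and> hd xs = u \<and> last xs = v)"

definition acyclic_graph :: "'a set \<Rightarrow> 'a set set \<Rightarrow> bool" where
  "acyclic_graph V E \<longleftrightarrow>
     \<not> (\<exists>xs. is_path V E xs \<and> length xs \<ge> 3 \<and> {last xs, hd xs} \<in> E)"

definition is_tree :: "'a set \<Rightarrow> 'a set set \<Rightarrow> bool" where
  "is_tree V E \<longleftrightarrow> simple_graph V E \<and> connected_graph V E \<and> acyclic_graph V E"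

text \<open>
  The graph \<open>(V, E)\<close> may be disconnected, so a shortest-path tree from \<open>s\<close> spans the
  vertices reachable from \<open>s\<close>.
\<close>

definition shortest_path_tree ::
  "'a set \<Rightarrow> 'a set set \<Rightarrow> 'a \<Rightarrow> 'a set \<Rightarrow> 'a set set \<Rightarrow> bool" where
  "shortest_path_tree V E s W F \<longleftrightarrow>
     is_tree W F \<and> F \<subseteq> E \<and> W = {v \<in> V. graph_dist V E s v \<noteq> \<infinity>} \<and>
     (\<forall>v\<in>W. graph_dist W F s v = graph_dist V E s v)"


section \<open>Randomized unit-cost RAM\<close>

text \<open>
  Registers and memory cells hold words of \<open>w\<close> bits, represented as naturals below \<open>2 ^ w\<close>.
  Results are reduced modulo \<open>2 ^ w\<close>; subtraction is truncated at 0. A program is a fixed finite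
  list of instructions and halts when the program counter leaves the list. Each instruction,
  including drawing a uniform random number below a given bound, costs one step.
\<close>

datatype arith_op = Add | Sub | Mul | Div | Mod

fun arith :: "arith_op \<Rightarrow> nat \<Rightarrow> nat \<Rightarrow> nat" where
  "arith Add x y = x + y"
| "arith Sub x y = x - y"
| "arith Mul x y = x * y"
| "arith Div x y = x div y"
| "arith Mod x y = x mod y"

datatype instr =
    Const nat nat               \<comment> \<open>\<open>R[d] := x\<close>\<close>
  | Arith arith_op nat nat nat  \<comment> \<open>\<open>R[d] := R[a] op R[b]\<close>\<close>
  | Load nat nat                \<comment> \<open>\<open>R[d] := M[R[a]]\<close>\<close>
  | Store nat nat               \<comment> \<open>\<open>M[R[a]] := R[b]\<close>\<close>
  | Random nat nat              \<comment> \<open>\<open>R[d] :=\<close> uniform in \<open>{0, \<dots>, R[a] - 1}\<close>\<close>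
  | Jump nat
  | Jump_Less nat nat nat       \<comment> \<open>jump to \<open>l\<close> if \<open>R[a] < R[b]\<close>\<close>

record config =
  pc :: nat
  reg :: "nat \<Rightarrow> nat"
  mem :: "nat \<Rightarrow> nat"

definition set_reg :: "nat \<Rightarrow> nat \<Rightarrow> config \<Rightarrow> config" where
  "set_reg d x \<sigma> = \<sigma>\<lparr>pc := Suc (pc \<sigma>), reg := (reg \<sigma>)(d := x)\<rparr>"

fun exec :: "nat \<Rightarrow> instr \<Rightarrow> config \<Rightarrow> config pmf" where
  "exec w (Const d x) \<sigma> = return_pmf (set_reg d (x mod 2 ^ w) \<sigma>)"
| "exec w (Arith f d a b) \<sigma> =
     return_pmf (set_reg d (arith f (reg \<sigma> a) (reg \<sigma> b) mod 2 ^ w) \<sigma>)"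
| "exec w (Load d a) \<sigma> = return_pmf (set_reg d (mem \<sigma> (reg \<sigma> a)) \<sigma>)"
| "exec w (Store a b) \<sigma> =
     return_pmf (\<sigma>\<lparr>pc := Suc (pc \<sigma>), mem := (mem \<sigma>)(reg \<sigma> a := reg \<sigma> b)\<rparr>)"
| "exec w (Random d a) \<sigma> =
     map_pmf (\<lambda>x. set_reg d x \<sigma>) (if reg \<sigma> a = 0 then return_pmf 0 else pmf_of_set {..<reg \<sigma> a})"
| "exec w (Jump l) \<sigma> = return_pmf (\<sigma>\<lparr>pc := l\<rparr>)"
| "exec w (Jump_Less a b l) \<sigma> =
     return_pmf (\<sigma>\<lparr>pc := (if reg \<sigma> a < reg \<sigma> b then l else Suc (pc \<sigma>))\<rparr>)"

definition halted :: "instr list \<Rightarrow> config \<Rightarrow> bool" where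
  "halted P \<sigma> \<longleftrightarrow> pc \<sigma> \<ge> length P"

definition step :: "nat \<Rightarrow> instr list \<Rightarrow> config \<Rightarrow> config pmf" where
  "step w P \<sigma> = (if halted P \<sigma> then return_pmf \<sigma> else exec w (P ! pc \<sigma>) \<sigma>)"

primrec run :: "nat \<Rightarrow> instr list \<Rightarrow> nat \<Rightarrow> config \<Rightarrow> config pmf" where
  "run w P 0 \<sigma> = return_pmf \<sigma>"
| "run w P (Suc t) \<sigma> = bind_pmf (step w P \<sigma>) (run w P t)"


section \<open>All-pairs shortest paths on the RAM\<close>

text \<open>
  The input graph has vertex set \<open>{..<n}\<close>. Initially register 0 holds \<open>n\<close>, the cells
  \<open>0, \<dots>, n\<^sup>2 - 1\<close> hold the adjacency matrix in row-major order, and everything else is 0.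
\<close>

definition apsp_input :: "nat \<Rightarrow> nat set set \<Rightarrow> config" where
  "apsp_input n E =
     \<lparr>pc = 0,
      reg = (\<lambda>r. if r = 0 then n else 0),
      mem = (\<lambda>a. if a < n * n \<and> {a div n, a mod n} \<in> E then 1 else 0)\<rparr>"

text \<open>
  On halting, the next \<open>n\<^sup>2\<close> cells hold the distance matrix and the \<open>n\<^sup>2\<close> cells after them, for
  each source \<open>s\<close>, the parents of all vertices in a shortest-path tree from \<open>s\<close>. The value \<open>n\<close>
  encodes an infinite distance and a missing parent, respectively.
\<close>

definition out_dist :: "nat \<Rightarrow> config \<Rightarrow> nat \<Rightarrow> nat \<Rightarrow> nat" where
  "out_dist n \<sigma> s v = mem \<sigma> (n * n + s * n + v)"

definition out_parent :: "nat \<Rightarrow> config \<Rightarrow> nat \<Rightarrow> nat \<Rightarrow> nat" where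
  "out_parent n \<sigma> s v = mem \<sigma> (2 * n * n + s * n + v)"

definition out_tree_verts :: "nat \<Rightarrow> config \<Rightarrow> nat \<Rightarrow> nat set" where
  "out_tree_verts n \<sigma> s = insert s {v \<in> {..<n}. out_parent n \<sigma> s v \<noteq> n}"

definition out_tree_edges :: "nat \<Rightarrow> config \<Rightarrow> nat \<Rightarrow> nat set set" where
  "out_tree_edges n \<sigma> s = {{v, out_parent n \<sigma> s v} | v. v < n \<and> out_parent n \<sigma> s v \<noteq> n}"

definition apsp_output :: "nat \<Rightarrow> nat set set \<Rightarrow> config \<Rightarrow> bool" where
  "apsp_output n E \<sigma> \<longleftrightarrow>
     (\<forall>s<n.
        (\<forall>v<n. case graph_dist {..<n} E s v of
                  enat d \<Rightarrow> out_dist n \<sigma> s v = d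
                | \<infinity> \<Rightarrow> out_dist n \<sigma> s v = n) \<and>
        out_parent n \<sigma> s s = n \<and>
        shortest_path_tree {..<n} E s (out_tree_verts n \<sigma> s) (out_tree_edges n \<sigma> s))"

text \<open>
  The word length is a constant multiple \<open>k\<close> of the bit length of \<open>n\<close>.
\<close>

definition apsp_success_prob :: "instr list \<Rightarrow> nat \<Rightarrow> nat \<Rightarrow> nat \<Rightarrow> nat set set \<Rightarrow> real" where
  "apsp_success_prob P k t n E =
     measure_pmf.prob (run (k * floorlog 2 n) P t (apsp_input n E))
       {\<sigma>. halted P \<sigma> \<and> apsp_output n E \<sigma>}"

end

theory Submission
  imports Defs "HOL-Real_Asymp.Real_Asymp"
begin

text \<open>
  Draw \<open>n\<close> random vertices and sort all vertices lexicographically by their adjacencies to them,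
  the last draw being the most significant; this is a radix sort in time \<open>O(n\<^sup>2)\<close>. With high
  probability, two vertices that agree on the last \<open>m\<close> draws have neighborhoods that differ in
  \<open>O(n log n / m)\<close> vertices, and by linear neighborhood complexity the last \<open>m\<close> draws cut the
  order into at most \<open>c m\<close> blocks. Summing over \<open>m = 2\<^sup>j\<close>, the neighborhoods of consecutive vertices
  differ in \<open>O(c n log\<^sup>2 n)\<close> places altogether, so that all neighborhoods together consist of
  \<open>O(c n log\<^sup>2 n)\<close> intervals of the order. A breadth-first search then handles each interval in
  constant time plus the newly visited vertices: visited positions are skipped by means of maximal
  visited intervals, which are merged by relabelling the smaller one, in time \<open>O(n log n)\<close> per source.
\<close>

section \<open>A While language on the RAM\<close>

text \<open>On dense graphs, scanning adjacency rows costs order \<open>n^2\<close> per source. The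
  order is computed once and shared by all sources; each vertex is dequeued at most once per source,
  so a search pays for the total number of intervals instead of edges. Radix sort serves all sample
  sizes at once: for every \<open>m\<close>, the last \<open>m\<close> passes alone make vertices
  that the last \<open>m\<close> draws do not distinguish contiguous, whatever list the earlier
  passes produced. Consecutive vertices separated by the last \<open>2^(j+1)\<close> draws but not
  by the last \<open>2^j\<close> number \<open>O(c 2^j)\<close> and differ in
  \<open>O(n log n / 2^j)\<close> places, so the two powers cancel: each of the
  \<open>O(log n)\<close> levels contributes \<open>O(c n log n)\<close>, whence the two logarithms.
  The constant 4 in \<open>good_draws\<close> leaves a failure probability of \<open>n^-4\<close>
  for each of \<open>n^3\<close> triples of two vertices and a sample size. The output is correct
  for every outcome of the draws; only the running time depends on them. Randomness is therefore
  confined to counting: on a fixed list of \<open>n\<close> draws the run is deterministic, and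
  every list has weight \<open>n^-n\<close>.\<close>

datatype exp = Var nat | Num nat | Bin arith_op exp exp | Get nat exp

datatype com =
    Assign nat exp
  | Put nat exp exp
  | Draw nat
  | Seq com com
  | Ite exp exp com com
  | While exp exp com

text \<open>
  Ghost fields: \<open>tp\<close> lists the random draws that are still to come, \<open>tm\<close> bounds the number of
  machine steps so far.
\<close>

record state =
  rg :: "nat \<Rightarrow> nat"
  ar :: "nat \<Rightarrow> nat \<Rightarrow> nat"
  tp :: "nat list"
  tm :: nat

abbreviation after :: "nat \<Rightarrow> state \<Rightarrow> state" where
  "after t s \<equiv> s\<lparr>tm := tm s + t\<rparr>"

fun ev :: "state \<Rightarrow> exp \<Rightarrow> nat" where
  "ev s (Var r) = rg s r"
| "ev s (Num x) = x"
| "ev s (Bin f e1 e2) = arith f (ev s e1) (ev s e2)"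
| "ev s (Get j e) = ar s j (ev s e)"

text \<open>Expressions are evaluated in exact natural number arithmetic. Safety excludes every wrap
  modulo \<open>W\<close>, which is \<open>2 ^ w\<close> on the machine, so that both evaluations
  agree.\<close>

fun safe :: "nat \<Rightarrow> nat \<Rightarrow> state \<Rightarrow> exp \<Rightarrow> bool" where
  "safe n W s (Var r) \<longleftrightarrow> r < 32"
| "safe n W s (Num x) \<longleftrightarrow> x < W"
| "safe n W s (Bin f e1 e2) \<longleftrightarrow> safe n W s e1 \<and> safe n W s e2 \<and> arith f (ev s e1) (ev s e2) < W"
| "safe n W s (Get j e) \<longleftrightarrow> j < 10 \<and> safe n W s e \<and> ev s e < n * n"

text \<open>Expressions compile to straight-line code, so this is both its length and its running
  time. A variable costs 2 because the machine has no register copy: the register is added to a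
  zero.\<close>

fun ecost :: "exp \<Rightarrow> nat" where
  "ecost (Var r) = 2"
| "ecost (Num x) = 1"
| "ecost (Bin f e1 e2) = ecost e1 + ecost e2 + 1"
| "ecost (Get j e) = ecost e + 4"

text \<open>Derivations exist only for executions that stay safe and terminate. Registers 0 and 1
  cannot be assigned: they hold \<open>n\<close> and \<open>n * n\<close>, on which draws and array
  addresses rely.\<close>

inductive big :: "nat \<Rightarrow> nat \<Rightarrow> com \<Rightarrow> state \<Rightarrow> state \<Rightarrow> bool" for n W where
  big_Assign: "safe n W s e \<Longrightarrow> 2 \<le> r \<Longrightarrow> r < 32 \<Longrightarrow>
    big n W (Assign r e) s (s\<lparr>rg := (rg s)(r := ev s e), tm := tm s + (ecost e + 2)\<rparr>)"
| big_Put: "safe n W s e1 \<Longrightarrow> safe n W s e2 \<Longrightarrow> ev s e1 < n * n \<Longrightarrow> j < 10 \<Longrightarrow>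
    big n W (Put j e1 e2) s
      (s\<lparr>ar := (ar s)(j := (ar s j)(ev s e1 := ev s e2)), tm := tm s + (ecost e1 + ecost e2 + 4)\<rparr>)"
| big_Draw: "tp s = x # xs \<Longrightarrow> x < n \<Longrightarrow> 2 \<le> r \<Longrightarrow> r < 32 \<Longrightarrow>
    big n W (Draw r) s (s\<lparr>rg := (rg s)(r := x), tp := xs, tm := tm s + 1\<rparr>)"
| big_Seq: "big n W c1 s s' \<Longrightarrow> big n W c2 s' s'' \<Longrightarrow> big n W (Seq c1 c2) s s''"
| big_Ite_True: "safe n W s e1 \<Longrightarrow> safe n W s e2 \<Longrightarrow> ev s e1 < ev s e2 \<Longrightarrow>
    big n W c1 (after (ecost e1 + ecost e2 + 2) s) s' \<Longrightarrow> big n W (Ite e1 e2 c1 c2) s s'"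
| big_Ite_False: "safe n W s e1 \<Longrightarrow> safe n W s e2 \<Longrightarrow> \<not> ev s e1 < ev s e2 \<Longrightarrow>
    big n W c2 (after (ecost e1 + ecost e2 + 2) s) s' \<Longrightarrow> big n W (Ite e1 e2 c1 c2) s s'"
| big_While_True: "safe n W s e1 \<Longrightarrow> safe n W s e2 \<Longrightarrow> ev s e1 < ev s e2 \<Longrightarrow>
    big n W b (after (ecost e1 + ecost e2 + 2) s) s' \<Longrightarrow>
    big n W (While e1 e2 b) s' s'' \<Longrightarrow> big n W (While e1 e2 b) s s''"
| big_While_False: "safe n W s e1 \<Longrightarrow> safe n W s e2 \<Longrightarrow> \<not> ev s e1 < ev s e2 \<Longrightarrow>
    big n W (While e1 e2 b) s (after (ecost e1 + ecost e2 + 2) s)"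

text \<open>
  Registers from 32 on serve as the evaluation stack of expressions; register 1 must hold
  \<open>n\<^sup>2\<close>, so that array \<open>j\<close> occupies the cells \<open>j n\<^sup>2, \<dots>, (j + 1) n\<^sup>2 - 1\<close>.
\<close>

fun cexp :: "exp \<Rightarrow> nat \<Rightarrow> instr list" where
  "cexp (Var r) d = [Const d 0, Arith Add d r d]"
| "cexp (Num x) d = [Const d x]"
| "cexp (Bin f e1 e2) d = cexp e1 d @ cexp e2 (Suc d) @ [Arith f d d (Suc d)]"
| "cexp (Get j e) d =
     cexp e d @ [Const (Suc d) j, Arith Mul (Suc d) (Suc d) 1, Arith Add d d (Suc d), Load d d]"

text \<open>Jumps are absolute, so code is generated for the address \<open>i\<close> at which it
  will stand. \<open>Jump_Less\<close> leads to the first branch of \<open>Ite\<close>, hence the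
  second branch is laid out before it. Second operands are evaluated from register 33 on, which
  preserves register 32.\<close>

fun ccom :: "com \<Rightarrow> nat \<Rightarrow> instr list" where
  "ccom (Assign r e) i = cexp e 32 @ [Const r 0, Arith Add r 32 r]"
| "ccom (Put j e1 e2) i =
     cexp e1 32 @ [Const 33 j, Arith Mul 33 33 1, Arith Add 32 32 33] @ cexp e2 33 @ [Store 32 33]"
| "ccom (Draw r) i = [Random r 0]"
| "ccom (Seq c1 c2) i = ccom c1 i @ ccom c2 (i + length (ccom c1 i))"
| "ccom (Ite e1 e2 c1 c2) i =
     (let a = cexp e1 32 @ cexp e2 33;
          q2 = ccom c2 (i + length a + 1);
          i1 = i + length a + 2 + length q2;
          q1 = ccom c1 i1
      in a @ [Jump_Less 32 33 i1] @ q2 @ [Jump (i1 + length q1)] @ q1)"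
| "ccom (While e1 e2 b) i =
     (let a = cexp e1 32 @ cexp e2 33;
          q = ccom b (i + length a + 2)
      in a @ [Jump_Less 32 33 (i + length a + 2)] @ [Jump (i + length a + 3 + length q)] @ q @ [Jump i])"

lemma length_cexp [simp]: "length (cexp e d) = ecost e"
  by (induction e arbitrary: d) auto

text \<open>With the outcomes read from a tape, execution is deterministic. A draw is followed only
  if its bound is currently \<open>n\<close>; this makes all tapes of the same length equally
  likely.\<close>

inductive reach :: "nat \<Rightarrow> nat \<Rightarrow> instr list \<Rightarrow> config \<Rightarrow> nat list \<Rightarrow> nat \<Rightarrow> config \<Rightarrow> nat list \<Rightarrow> bool"
  for n w P where
  reach_refl: "reach n w P \<sigma> xs 0 \<sigma> xs"
| reach_det: "pc \<sigma> < length P \<Longrightarrow> (\<And>d a. P ! pc \<sigma> \<noteq> Random d a) \<Longrightarrow>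
    exec w (P ! pc \<sigma>) \<sigma> = return_pmf \<sigma>1 \<Longrightarrow> reach n w P \<sigma>1 xs t \<sigma>' xs' \<Longrightarrow>
    reach n w P \<sigma> xs (Suc t) \<sigma>' xs'"
| reach_random: "pc \<sigma> < length P \<Longrightarrow> P ! pc \<sigma> = Random d a \<Longrightarrow> reg \<sigma> a = n \<Longrightarrow> x < n \<Longrightarrow>
    reach n w P (set_reg d x \<sigma>) xs t \<sigma>' xs' \<Longrightarrow> reach n w P \<sigma> (x # xs) (Suc t) \<sigma>' xs'"

lemma reach_trans:
  "reach n w P \<sigma> xs t \<sigma>' xs' \<Longrightarrow> reach n w P \<sigma>' xs' t' \<sigma>'' xs'' \<Longrightarrow> reach n w P \<sigma> xs (t + t') \<sigma>'' xs''"
proof (induction rule: reach.induct)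
  case (reach_det \<sigma> \<sigma>1 xs t \<sigma>' xs')
  then show ?case using reach.reach_det[of \<sigma> P w \<sigma>1 n xs "t + t'" \<sigma>'' xs''] by simp
next
  case (reach_random \<sigma> d a x xs t \<sigma>' xs')
  then show ?case using reach.reach_random[of \<sigma> P d a n x w xs "t + t'" \<sigma>'' xs''] by simp
qed simp

lemma reach_step:
  "pc \<sigma> < length P \<Longrightarrow> (\<And>d a. P ! pc \<sigma> \<noteq> Random d a) \<Longrightarrow>
    exec w (P ! pc \<sigma>) \<sigma> = return_pmf \<sigma>1 \<Longrightarrow> reach n w P \<sigma> xs 1 \<sigma>1 xs"
  using reach_det[OF _ _ _ reach_refl] by simp

section \<open>From counting tapes to probabilities\<close>

lemma prob_bind_pmf:
  "measure_pmf.prob (bind_pmf p f) X = measure_pmf.expectation p (\<lambda>x. measure_pmf.prob (f x) X)"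
proof -
  have eq: "measure_pmf.prob q X = pmf (map_pmf (\<lambda>y. y \<in> X) q) True" for q :: "'a pmf"
    by (simp add: pmf_map vimage_def)
  show ?thesis unfolding eq by (simp add: map_bind_pmf pmf_bind)
qed

text \<open>Each tape of \<open>m\<close> draws that leads to \<open>X\<close> contributes \<open>1 / n ^ m\<close> to the probability of \<open>X\<close>.\<close>

lemma prob_run_ge_tapes:
  assumes n: "n > 0" and X: "\<And>\<sigma>. \<sigma> \<in> X \<Longrightarrow> halted P \<sigma>"
  shows "real (card {xs. length xs = m \<and> set xs \<subseteq> {..<n} \<and>
            (\<exists>t'\<le>t. \<exists>\<sigma>'\<in>X. reach n w P \<sigma> xs t' \<sigma>' [])})
          \<le> real n ^ m * measure_pmf.prob (run w P t \<sigma>) X"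
proof (induction t arbitrary: \<sigma> m)
  have fin: "finite {xs. length xs = m \<and> set xs \<subseteq> {..<n} \<and> Q xs}" for m Q
    by (rule finite_subset[OF _ finite_lists_length_eq[of "{..<n}" m]]) auto
  define S where "S = (\<lambda>m t \<sigma>. {xs. length xs = m \<and> set xs \<subseteq> {..<n} \<and>
      (\<exists>t'\<le>t. \<exists>\<sigma>'\<in>X. reach n w P \<sigma> xs t' \<sigma>' [])})"
  have refl_only: "xs = [] \<and> \<sigma> \<in> X" if "halted P \<sigma> \<or> t' = 0" "reach n w P \<sigma> xs t' \<sigma>' []" "\<sigma>' \<in> X"
    for xs t' \<sigma>' \<sigma>
    using that(2) by (cases rule: reach.cases) (use that in \<open>auto simp: halted_def\<close>)
  \<comment> \<open>A halted configuration stays where it is and thus counts like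
    \<open>t = 0\<close>: only the empty tape can lead to \<open>X\<close>, with weight
    \<open>n ^ 0\<close>.\<close>
  have base: "real (card (S m t \<sigma>)) \<le> real n ^ m * measure_pmf.prob (return_pmf \<sigma>) X"
    if "halted P \<sigma> \<or> t = 0" for m t \<sigma>
  proof -
    have sub: "S m t \<sigma> \<subseteq> (if m = 0 \<and> \<sigma> \<in> X then {[]} else {})"
    proof
      fix xs assume "xs \<in> S m t \<sigma>"
      then obtain t' \<sigma>' where t': "t' \<le> t" "\<sigma>' \<in> X" "reach n w P \<sigma> xs t' \<sigma>' []" "length xs = m"
        by (auto simp: S_def)
      have "xs = [] \<and> \<sigma> \<in> X" using refl_only[OF _ t'(3,2)] that t'(1) by auto
      then show "xs \<in> (if m = 0 \<and> \<sigma> \<in> X then {[]} else {})" using t'(4) by simp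
    qed
    show ?thesis
    proof (cases "m = 0 \<and> \<sigma> \<in> X")
      case True
      then have "card (S m t \<sigma>) \<le> card {[] :: nat list}" using sub by (intro card_mono) auto
      then show ?thesis using True by simp
    next
      case False
      then have "S m t \<sigma> = {}" using sub by (simp split: if_splits)
      then show ?thesis by simp
    qed
  qed
  {
    case 0
    then show ?case using base[of \<sigma> 0 m] by (simp add: S_def)
  next
    case (Suc t)
    have IH: "real (card (S m t \<sigma>)) \<le> real n ^ m * measure_pmf.prob (run w P t \<sigma>) X" for m \<sigma>
      using Suc.IH by (simp add: S_def)
    have "real (card (S m (Suc t) \<sigma>)) \<le> real n ^ m * measure_pmf.prob (run w P (Suc t) \<sigma>) X"
    proof (cases "halted P \<sigma>")
      case True
      have "run w P t \<sigma> = return_pmf \<sigma>" for t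
        by (induction t) (use True in \<open>auto simp: step_def bind_return_pmf\<close>)
      then show ?thesis using base[of \<sigma> "Suc t" m] True by (simp del: run.simps)
    next
      case False
      then have pc: "pc \<sigma> < length P" by (simp add: halted_def)
      show ?thesis
      proof (cases "\<exists>d a. P ! pc \<sigma> = Random d a")
        case False
        then obtain \<sigma>1 where s1: "exec w (P ! pc \<sigma>) \<sigma> = return_pmf \<sigma>1"
          by (cases "P ! pc \<sigma>") auto
        have "S m (Suc t) \<sigma> \<subseteq> S m t \<sigma>1"
        proof
          fix xs assume "xs \<in> S m (Suc t) \<sigma>"
          then obtain t' \<sigma>' where t': "t' \<le> Suc t" "\<sigma>' \<in> X" "reach n w P \<sigma> xs t' \<sigma>' []"
            "length xs = m" "set xs \<subseteq> {..<n}" by (auto simp: S_def)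
          from t'(3) show "xs \<in> S m t \<sigma>1"
          proof (cases rule: reach.cases)
            case reach_refl
            then show ?thesis using X[OF t'(2)] pc by (auto simp: halted_def)
          next
            case (reach_det \<sigma>1' t1)
            then have "\<sigma>1' = \<sigma>1" using s1 by simp
            then show ?thesis using reach_det t' by (auto simp: S_def)
          qed (use False in auto)
        qed
        then have "real (card (S m (Suc t) \<sigma>)) \<le> real (card (S m t \<sigma>1))"
          unfolding of_nat_le_iff by (intro card_mono) (auto simp: S_def intro: fin)
        also have "\<dots> \<le> real n ^ m * measure_pmf.prob (run w P t \<sigma>1) X" by (rule IH)
        also have "run w P t \<sigma>1 = run w P (Suc t) \<sigma>"
          using s1 \<open>\<not> halted P \<sigma>\<close> by (simp add: step_def bind_return_pmf)
        finally show ?thesis .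
      next
        case True
        then obtain d a where da: "P ! pc \<sigma> = Random d a" by blast
        show ?thesis
        proof (cases "reg \<sigma> a = n \<and> m > 0")
          case False
          \<comment> \<open>A draw with another bound is not followed and an empty tape cannot serve
            a draw, so there is nothing to count.\<close>
          have "S m (Suc t) \<sigma> = {}"
          proof (rule ccontr)
            assume "S m (Suc t) \<sigma> \<noteq> {}"
            then obtain xs t' \<sigma>' where t': "\<sigma>' \<in> X" "reach n w P \<sigma> xs t' \<sigma>' []" "length xs = m"
              by (auto simp: S_def)
            from t'(2) show False
              by (cases rule: reach.cases) (use X[OF t'(1)] t' pc False da in \<open>auto simp: halted_def\<close>)
          qed
          then show ?thesis by simp
        next
          case True
          then obtain m' where m': "m = Suc m'" by (cases m) auto
          \<comment> \<open>One class of tapes for each first draw \<open>x\<close>. The uniform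
            draw averages over the classes, and this average absorbs one factor \<open>n\<close> of
            \<open>n ^ Suc m'\<close>.\<close>
          have "S m (Suc t) \<sigma> \<subseteq> (\<Union>x<n. (#) x ` S m' t (set_reg d x \<sigma>))"
          proof
            fix xs assume "xs \<in> S m (Suc t) \<sigma>"
            then obtain t' \<sigma>' where t': "t' \<le> Suc t" "\<sigma>' \<in> X" "reach n w P \<sigma> xs t' \<sigma>' []"
              "length xs = m" "set xs \<subseteq> {..<n}" by (auto simp: S_def)
            from t'(3) show "xs \<in> (\<Union>x<n. (#) x ` S m' t (set_reg d x \<sigma>))"
            proof (cases rule: reach.cases)
              case reach_refl
              then show ?thesis using X[OF t'(2)] pc by (auto simp: halted_def)
            next
              case (reach_random d' a' x ys t1)
              then show ?thesis using t' m' da by (auto simp: S_def)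
            qed (use da in auto)
          qed
          then have "card (S m (Suc t) \<sigma>) \<le> card (\<Union>x<n. (#) x ` S m' t (set_reg d x \<sigma>))"
            by (intro card_mono) (auto simp: S_def intro: fin)
          also have "\<dots> \<le> (\<Sum>x<n. card ((#) x ` S m' t (set_reg d x \<sigma>)))"
            by (rule card_UN_le) simp
          also have "\<dots> = (\<Sum>x<n. card (S m' t (set_reg d x \<sigma>)))"
            by (intro sum.cong refl card_image) (auto simp: inj_on_def)
          finally have "real (card (S m (Suc t) \<sigma>)) \<le> (\<Sum>x<n. real (card (S m' t (set_reg d x \<sigma>))))"
            by (metis of_nat_le_iff of_nat_sum)
          also have "\<dots> \<le> (\<Sum>x<n. real n ^ m' * measure_pmf.prob (run w P t (set_reg d x \<sigma>)) X)"
            by (intro sum_mono IH)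
          also have "\<dots> = real n ^ m * measure_pmf.prob (run w P (Suc t) \<sigma>) X"
          proof -
            have "step w P \<sigma> = map_pmf (\<lambda>x. set_reg d x \<sigma>) (pmf_of_set {..<n})"
              using True \<open>\<not> halted P \<sigma>\<close> da n by (simp add: step_def)
            then have "run w P (Suc t) \<sigma> = bind_pmf (pmf_of_set {..<n}) (\<lambda>x. run w P t (set_reg d x \<sigma>))"
              by (simp add: bind_map_pmf)
            then have "measure_pmf.prob (run w P (Suc t) \<sigma>) X
                = measure_pmf.expectation (pmf_of_set {..<n}) (\<lambda>x. measure_pmf.prob (run w P t (set_reg d x \<sigma>)) X)"
              by (simp add: prob_bind_pmf)
            also have "\<dots> = (\<Sum>x<n. measure_pmf.prob (run w P t (set_reg d x \<sigma>)) X) / real n"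
              using n by (subst integral_pmf_of_set) auto
            finally have "real n * measure_pmf.prob (run w P (Suc t) \<sigma>) X
                = (\<Sum>x<n. measure_pmf.prob (run w P t (set_reg d x \<sigma>)) X)"
              using n by (simp add: field_simps)
            then show ?thesis by (simp add: m' sum_distrib_left[symmetric] mult.assoc mult.left_commute del: run.simps)
          qed
          finally show ?thesis .
        qed
      qed
    qed
    then show ?case by (simp add: S_def)
  }
qed

section \<open>Compiled code simulates the While language\<close>

definition code_at :: "instr list \<Rightarrow> nat \<Rightarrow> instr list \<Rightarrow> bool" where
  "code_at P i q \<longleftrightarrow> i + length q \<le> length P \<and> (\<forall>j<length q. P ! (i + j) = q ! j)"

lemma code_at_append [simp]:
  "code_at P i (q1 @ q2) \<longleftrightarrow> code_at P i q1 \<and> code_at P (i + length q1) q2"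
proof
  assume h: "code_at P i (q1 @ q2)"
  have "P ! (i + length q1 + j) = q2 ! j" if "j < length q2" for j
    using h that unfolding code_at_def nth_append
    by (auto dest!: spec[of _ "length q1 + j"] simp: add.assoc)
  moreover have "P ! (i + j) = q1 ! j" if "j < length q1" for j
    using h that unfolding code_at_def nth_append by (auto dest!: spec[of _ j])
  ultimately show "code_at P i q1 \<and> code_at P (i + length q1) q2"
    using h by (auto simp: code_at_def)
next
  assume h: "code_at P i q1 \<and> code_at P (i + length q1) q2"
  have "P ! (i + j) = (q1 @ q2) ! j" if "j < length q1 + length q2" for j
  proof (cases "j < length q1")
    case False
    then obtain j' where "j = length q1 + j'" using le_Suc_ex not_less by blast
    then show ?thesis using h that by (auto simp: code_at_def nth_append add.assoc)
  qed (use h in \<open>auto simp: code_at_def nth_append\<close>)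
  then show "code_at P i (q1 @ q2)" using h by (auto simp: code_at_def)
qed

lemma code_at_Cons [simp]:
  "code_at P i (x # q) \<longleftrightarrow> i < length P \<and> P ! i = x \<and> code_at P (Suc i) q"
proof -
  have "code_at P i (x # q) \<longleftrightarrow> code_at P i [x] \<and> code_at P (Suc i) q"
    using code_at_append[of P i "[x]" q] by simp
  then show ?thesis by (auto simp: code_at_def)
qed

lemma code_at_Nil [simp]: "code_at P i [] \<longleftrightarrow> i \<le> length P"
  by (simp add: code_at_def)

text \<open>What evaluation at stack level \<open>d\<close> preserves. Since the second operand of
  \<open>Bin\<close> is evaluated one level higher, the first one survives in register
  \<open>d\<close>.\<close>

definition reg_upto :: "nat \<Rightarrow> config \<Rightarrow> config \<Rightarrow> bool" where
  "reg_upto d \<sigma> \<sigma>' \<longleftrightarrow> mem \<sigma>' = mem \<sigma> \<and> (\<forall>r<d. reg \<sigma>' r = reg \<sigma> r)"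

text \<open>The bounds by \<open>W\<close> belong to the invariant because a variable is read by an
  addition modulo \<open>2 ^ w\<close>, which must not change its value.\<close>

definition sim :: "nat \<Rightarrow> nat \<Rightarrow> state \<Rightarrow> config \<Rightarrow> bool" where
  "sim n W s \<sigma> \<longleftrightarrow> rg s 0 = n \<and> rg s 1 = n * n \<and>
     (\<forall>r<32. reg \<sigma> r = rg s r \<and> rg s r < W) \<and>
     (\<forall>j<10. \<forall>i<n * n. mem \<sigma> (j * (n * n) + i) = ar s j i \<and> ar s j i < W)"

lemma ev_less:
  assumes "sim n W s \<sigma>" "safe n W s e" shows "ev s e < W"
  using assms by (cases e) (auto simp: sim_def)

lemma sim_reg_upto: "sim n W s \<sigma> \<Longrightarrow> reg_upto d \<sigma> \<sigma>' \<Longrightarrow> 32 \<le> d \<Longrightarrow> sim n W s \<sigma>'"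
  by (simp add: sim_def reg_upto_def)

lemma mult_index_less:
  assumes "j < 10" "i < n * n" "10 * (n * n) < (W :: nat)"
  shows "j * (n * n) + i < W" and "j * (n * n) < W" and "j < W"
proof -
  have "j * (n * n) \<le> 9 * (n * n)" using assms by (intro mult_right_mono) auto
  then show "j * (n * n) + i < W" "j * (n * n) < W" using assms by linarith+
  show "j < W" using assms by linarith
qed

lemma cexp_correct:
  assumes W: "10 * (n * n) < W" "W = 2 ^ w"
  shows "\<lbrakk>safe n W s e; sim n W s \<sigma>; code_at P (pc \<sigma>) (cexp e d); 32 \<le> d\<rbrakk> \<Longrightarrow>
    \<exists>\<sigma>'. reach n w P \<sigma> xs (ecost e) \<sigma>' xs \<and> pc \<sigma>' = pc \<sigma> + ecost e \<and>
      reg \<sigma>' d = ev s e \<and> reg_upto d \<sigma> \<sigma>'"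
proof (induction e arbitrary: \<sigma> d)
  case (Var r)
  define \<sigma>1 where "\<sigma>1 = set_reg d 0 \<sigma>"
  define \<sigma>2 where "\<sigma>2 = set_reg d (reg \<sigma>1 r) \<sigma>1"
  have "reg \<sigma>1 r < W" using Var by (auto simp: \<sigma>1_def set_reg_def sim_def)
  then have "reach n w P \<sigma> xs (1 + 1) \<sigma>2 xs"
    using Var W
    by (intro reach_trans[OF reach_step[of _ _ _ \<sigma>1] reach_step[of _ _ _ \<sigma>2]])
       (auto simp: \<sigma>1_def \<sigma>2_def set_reg_def)
  then show ?case
    by (intro exI[of _ \<sigma>2]) (use Var in \<open>auto simp: \<sigma>1_def \<sigma>2_def set_reg_def reg_upto_def sim_def numeral_2_eq_2\<close>)
next
  case (Num x)
  define \<sigma>1 where "\<sigma>1 = set_reg d x \<sigma>"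
  have "reach n w P \<sigma> xs 1 \<sigma>1 xs"
    using Num W by (intro reach_step) (auto simp: \<sigma>1_def)
  then show ?case
    by (intro exI[of _ \<sigma>1]) (auto simp: \<sigma>1_def set_reg_def reg_upto_def)
next
  case (Bin f e1 e2)
  obtain \<sigma>1 where 1: "reach n w P \<sigma> xs (ecost e1) \<sigma>1 xs" "pc \<sigma>1 = pc \<sigma> + ecost e1"
      "reg \<sigma>1 d = ev s e1" "reg_upto d \<sigma> \<sigma>1"
    using Bin.IH(1)[of \<sigma> d] Bin.prems by auto
  have "sim n W s \<sigma>1" using sim_reg_upto Bin.prems 1 by blast
  then obtain \<sigma>2 where 2: "reach n w P \<sigma>1 xs (ecost e2) \<sigma>2 xs" "pc \<sigma>2 = pc \<sigma>1 + ecost e2"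
      "reg \<sigma>2 (Suc d) = ev s e2" "reg_upto (Suc d) \<sigma>1 \<sigma>2"
    using Bin.IH(2)[of \<sigma>1 "Suc d"] Bin.prems 1 by auto
  define \<sigma>3 where "\<sigma>3 = set_reg d (arith f (ev s e1) (ev s e2)) \<sigma>2"
  have d2: "reg \<sigma>2 d = ev s e1" using 1 2 by (simp add: reg_upto_def)
  have "reach n w P \<sigma>2 xs 1 \<sigma>3 xs"
    using Bin.prems W 1 2 d2 by (intro reach_step) (auto simp: \<sigma>3_def add.assoc)
  from reach_trans[OF reach_trans[OF 1(1) 2(1)] this]
  show ?case
    by (intro exI[of _ \<sigma>3])
       (use 1 2 in \<open>auto simp: \<sigma>3_def set_reg_def reg_upto_def\<close>)
next
  case (Get j e)
  obtain \<sigma>1 where 1: "reach n w P \<sigma> xs (ecost e) \<sigma>1 xs" "pc \<sigma>1 = pc \<sigma> + ecost e"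
      "reg \<sigma>1 d = ev s e" "reg_upto d \<sigma> \<sigma>1"
    using Get.IH[of \<sigma> d] Get.prems by auto
  have s1: "sim n W s \<sigma>1" using sim_reg_upto Get.prems 1 by blast
  define \<sigma>2 where "\<sigma>2 = set_reg (Suc d) j \<sigma>1"
  define \<sigma>3 where "\<sigma>3 = set_reg (Suc d) (j * (n * n)) \<sigma>2"
  define \<sigma>4 where "\<sigma>4 = set_reg d (j * (n * n) + ev s e) \<sigma>3"
  define \<sigma>5 where "\<sigma>5 = set_reg d (mem \<sigma>4 (reg \<sigma>4 d)) \<sigma>4"
  have j: "j < 10" "ev s e < n * n" using Get.prems by auto
  have jW: "j < W" "j * (n * n) < W" "j * (n * n) + ev s e < W"
    using mult_index_less[OF j W(1)] by auto
  have r1: "reg \<sigma>1 1 = n * n" using s1 by (simp add: sim_def)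
  have "reach n w P \<sigma>1 xs 1 \<sigma>2 xs"
    using Get.prems W 1 jW by (intro reach_step) (auto simp: \<sigma>2_def)
  moreover have "reach n w P \<sigma>2 xs 1 \<sigma>3 xs"
    using Get.prems W 1 jW r1 by (intro reach_step) (auto simp: \<sigma>2_def \<sigma>3_def set_reg_def)
  moreover have "reach n w P \<sigma>3 xs 1 \<sigma>4 xs"
    using Get.prems W 1 jW r1
    by (intro reach_step) (auto simp: \<sigma>2_def \<sigma>3_def \<sigma>4_def set_reg_def add.commute)
  moreover have "reach n w P \<sigma>4 xs 1 \<sigma>5 xs"
    using Get.prems W 1 jW r1
    by (intro reach_step) (auto simp: \<sigma>2_def \<sigma>3_def \<sigma>4_def \<sigma>5_def set_reg_def)
  ultimately have "reach n w P \<sigma> xs (ecost e + 1 + 1 + 1 + 1) \<sigma>5 xs"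
    using 1(1) by (blast intro: reach_trans)
  moreover have "reg \<sigma>5 d = ar s j (ev s e)"
    using s1 j by (simp add: \<sigma>5_def \<sigma>4_def \<sigma>3_def \<sigma>2_def set_reg_def sim_def)
  ultimately show ?case
    by (intro exI[of _ \<sigma>5])
       (use 1 in \<open>auto simp: \<sigma>5_def \<sigma>4_def \<sigma>3_def \<sigma>2_def set_reg_def reg_upto_def numeral_eq_Suc\<close>)
qed

lemma cexp_pair_correct:
  assumes W: "10 * (n * n) < W" "W = 2 ^ w"
    and "safe n W s e1" "safe n W s e2" "sim n W s \<sigma>"
    and "code_at P (pc \<sigma>) (cexp e1 32 @ cexp e2 33)"
  shows "\<exists>\<sigma>'. reach n w P \<sigma> xs (ecost e1 + ecost e2) \<sigma>' xs \<and> pc \<sigma>' = pc \<sigma> + ecost e1 + ecost e2 \<and>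
      reg \<sigma>' 32 = ev s e1 \<and> reg \<sigma>' 33 = ev s e2 \<and> sim n W s \<sigma>'"
proof -
  obtain \<sigma>1 where 1: "reach n w P \<sigma> xs (ecost e1) \<sigma>1 xs" "pc \<sigma>1 = pc \<sigma> + ecost e1"
      "reg \<sigma>1 32 = ev s e1" "reg_upto 32 \<sigma> \<sigma>1"
    using cexp_correct[OF W, of s e1 \<sigma> P 32 xs] assms by auto
  have "sim n W s \<sigma>1" using sim_reg_upto assms 1 by blast
  moreover from this obtain \<sigma>2 where 2: "reach n w P \<sigma>1 xs (ecost e2) \<sigma>2 xs" "pc \<sigma>2 = pc \<sigma>1 + ecost e2"
      "reg \<sigma>2 33 = ev s e2" "reg_upto 33 \<sigma>1 \<sigma>2"
    using cexp_correct[OF W, of s e2 \<sigma>1 P 33 xs] assms 1 by auto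
  ultimately have "sim n W s \<sigma>2" using sim_reg_upto[of n W s \<sigma>1 33 \<sigma>2] by simp
  then show ?thesis
    using 1 2 reach_trans[OF 1(1) 2(1)] by (intro exI[of _ \<sigma>2]) (auto simp: reg_upto_def)
qed

lemma sim_tm [simp]: "sim n W (s\<lparr>tm := t\<rparr>) \<sigma> = sim n W s \<sigma>"
  by (simp add: sim_def)

lemma sim_pc: "sim n W s \<sigma> \<Longrightarrow> sim n W s (\<sigma>\<lparr>pc := i\<rparr>)"
  by (simp add: sim_def)

text \<open>The induction is on the derivation, since the derivation for a loop contains another one
  for the same loop. Time is only bounded, not exact: the first branch of \<open>Ite\<close> is
  charged for the \<open>Jump\<close> that only the second one executes.\<close>

lemma ccom_correct:
  assumes W: "10 * (n * n) < W" "n < W" "W = 2 ^ w"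
  shows "\<lbrakk>big n W c s s'; sim n W s \<sigma>; code_at P (pc \<sigma>) (ccom c (pc \<sigma>))\<rbrakk> \<Longrightarrow>
    \<exists>t \<sigma>'. t + tm s \<le> tm s' \<and> reach n w P \<sigma> (tp s) t \<sigma>' (tp s') \<and>
      pc \<sigma>' = pc \<sigma> + length (ccom c (pc \<sigma>)) \<and> sim n W s' \<sigma>'"
proof (induction arbitrary: \<sigma> rule: big.induct)
  case (big_Assign s e r)
  obtain \<sigma>1 where 1: "reach n w P \<sigma> (tp s) (ecost e) \<sigma>1 (tp s)" "pc \<sigma>1 = pc \<sigma> + ecost e"
      "reg \<sigma>1 32 = ev s e" "reg_upto 32 \<sigma> \<sigma>1"
    using cexp_correct[OF W(1,3), of s e \<sigma> P 32 "tp s"] big_Assign by auto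
  have s1: "sim n W s \<sigma>1" using sim_reg_upto big_Assign 1 by blast
  have lt: "ev s e < W" using ev_less big_Assign by blast
  define \<sigma>2 where "\<sigma>2 = set_reg r 0 \<sigma>1"
  define \<sigma>3 where "\<sigma>3 = set_reg r (ev s e) \<sigma>2"
  have "reach n w P \<sigma>1 (tp s) 1 \<sigma>2 (tp s)"
    using big_Assign W 1 by (intro reach_step) (auto simp: \<sigma>2_def)
  moreover have "reach n w P \<sigma>2 (tp s) 1 \<sigma>3 (tp s)"
    using big_Assign W 1 lt by (intro reach_step) (auto simp: \<sigma>2_def \<sigma>3_def set_reg_def)
  ultimately have "reach n w P \<sigma> (tp s) (ecost e + 1 + 1) \<sigma>3 (tp s)"
    using 1(1) by (blast intro: reach_trans)
  moreover have "sim n W (s\<lparr>rg := (rg s)(r := ev s e), tm := tm s + (ecost e + 2)\<rparr>) \<sigma>3"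
    using s1 lt big_Assign by (auto simp: sim_def \<sigma>3_def \<sigma>2_def set_reg_def)
  ultimately show ?case
    by (intro exI[of _ "ecost e + 1 + 1"] exI[of _ \<sigma>3]) (use 1 in \<open>auto simp: \<sigma>3_def \<sigma>2_def set_reg_def numeral_2_eq_2\<close>)
next
  case (big_Put s e1 e2 j)
  obtain \<sigma>1 where 1: "reach n w P \<sigma> (tp s) (ecost e1) \<sigma>1 (tp s)" "pc \<sigma>1 = pc \<sigma> + ecost e1"
      "reg \<sigma>1 32 = ev s e1" "reg_upto 32 \<sigma> \<sigma>1"
    using cexp_correct[OF W(1,3), of s e1 \<sigma> P 32 "tp s"] big_Put by auto
  have s1: "sim n W s \<sigma>1" using sim_reg_upto big_Put 1 by blast
  define \<sigma>2 where "\<sigma>2 = set_reg 33 j \<sigma>1"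
  define \<sigma>3 where "\<sigma>3 = set_reg 33 (j * (n * n)) \<sigma>2"
  define \<sigma>4 where "\<sigma>4 = set_reg 32 (j * (n * n) + ev s e1) \<sigma>3"
  have j: "j < 10" "ev s e1 < n * n" using big_Put by auto
  have jW: "j < W" "j * (n * n) < W" "j * (n * n) + ev s e1 < W"
    using mult_index_less[OF j W(1)] by auto
  have r1: "reg \<sigma>1 (Suc 0) = n * n" using s1 by (simp add: sim_def)
  have "reach n w P \<sigma>1 (tp s) 1 \<sigma>2 (tp s)"
    using big_Put.prems W 1 jW by (intro reach_step) (auto simp: \<sigma>2_def)
  moreover have "reach n w P \<sigma>2 (tp s) 1 \<sigma>3 (tp s)"
    using big_Put.prems W 1 jW r1 by (intro reach_step) (auto simp: \<sigma>2_def \<sigma>3_def set_reg_def)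
  moreover have "reach n w P \<sigma>3 (tp s) 1 \<sigma>4 (tp s)"
    using big_Put.prems W 1 jW r1
    by (intro reach_step) (auto simp: \<sigma>2_def \<sigma>3_def \<sigma>4_def set_reg_def add.commute)
  ultimately have r4: "reach n w P \<sigma> (tp s) (ecost e1 + 1 + 1 + 1) \<sigma>4 (tp s)"
    using 1(1) by (blast intro: reach_trans)
  have s4: "sim n W s \<sigma>4"
    by (rule sim_reg_upto[OF s1, of 32]) (auto simp: \<sigma>4_def \<sigma>3_def \<sigma>2_def reg_upto_def set_reg_def)
  have pc4: "pc \<sigma>4 = pc \<sigma> + ecost e1 + 3" using 1 by (simp add: \<sigma>4_def \<sigma>3_def \<sigma>2_def set_reg_def)
  have c4: "code_at P (pc \<sigma>4) (cexp e2 33)"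
    using big_Put.prems pc4 by (simp add: eval_nat_numeral)
  obtain \<sigma>5 where 5: "reach n w P \<sigma>4 (tp s) (ecost e2) \<sigma>5 (tp s)" "pc \<sigma>5 = pc \<sigma>4 + ecost e2"
      "reg \<sigma>5 33 = ev s e2" "reg_upto 33 \<sigma>4 \<sigma>5"
    using cexp_correct[OF W(1,3), of s e2 \<sigma>4 P 33 "tp s"] big_Put s4 c4 by auto
  have s5: "sim n W s \<sigma>5" using sim_reg_upto[of n W s \<sigma>4 33] s4 5 by simp
  have a5: "reg \<sigma>5 32 = j * (n * n) + ev s e1"
    using 5(4) by (simp add: reg_upto_def \<sigma>4_def set_reg_def)
  define \<sigma>6 where "\<sigma>6 = \<sigma>5\<lparr>pc := Suc (pc \<sigma>5), mem := (mem \<sigma>5)(j * (n * n) + ev s e1 := ev s e2)\<rparr>"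
  have "reach n w P \<sigma>5 (tp s) 1 \<sigma>6 (tp s)"
    using big_Put.prems 5 a5 pc4
    by (intro reach_step) (auto simp: \<sigma>6_def eval_nat_numeral algebra_simps)
  then have r6: "reach n w P \<sigma> (tp s) (ecost e1 + 1 + 1 + 1 + ecost e2 + 1) \<sigma>6 (tp s)"
    using r4 5(1) by (blast intro: reach_trans)
  \<comment> \<open>A store must not hit another array: dividing an address by \<open>n * n\<close>
    recovers the number of its array.\<close>
  have neq: "(j' * (n * n) + i = j * (n * n) + ev s e1) = (j' = j \<and> i = ev s e1)"
    if "i < n * n" for i j'
  proof
    assume h: "j' * (n * n) + i = j * (n * n) + ev s e1"
    then have "(j' * (n * n) + i) div (n * n) = (j * (n * n) + ev s e1) div (n * n)" by simp
    then have "j' = j" using that j by (cases "n = 0") auto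
    then show "j' = j \<and> i = ev s e1" using h by simp
  qed auto
  have "ev s e2 < W" using ev_less big_Put by blast
  then have "sim n W (s\<lparr>ar := (ar s)(j := (ar s j)(ev s e1 := ev s e2)), tm := tm s + (ecost e1 + ecost e2 + 4)\<rparr>) \<sigma>6"
    using s5 neq by (auto simp: sim_def \<sigma>6_def)
  then show ?case
    by (intro exI[of _ "ecost e1 + 1 + 1 + 1 + ecost e2 + 1"] exI[of _ \<sigma>6]) (use r6 5 pc4 in \<open>auto simp: \<sigma>6_def numeral_eq_Suc algebra_simps\<close>)
next
  case (big_Draw s x xs r)
  have "reach n w P \<sigma> (tp s) (Suc 0) (set_reg r x \<sigma>) xs"
    unfolding big_Draw(1)
    by (rule reach_random[OF _ _ _ _ reach_refl, of _ _ r 0])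
       (use big_Draw in \<open>auto simp: sim_def\<close>)
  moreover have "sim n W (s\<lparr>rg := (rg s)(r := x), tp := xs, tm := tm s + 1\<rparr>) (set_reg r x \<sigma>)"
    using big_Draw W by (auto simp: sim_def set_reg_def)
  ultimately show ?case
    by (intro exI[of _ "Suc 0"] exI[of _ "set_reg r x \<sigma>"]) (auto simp: set_reg_def)
next
  case (big_Seq c1 s s' c2 s'')
  then obtain t1 \<sigma>1 where 1: "t1 + tm s \<le> tm s'" "reach n w P \<sigma> (tp s) t1 \<sigma>1 (tp s')"
      "pc \<sigma>1 = pc \<sigma> + length (ccom c1 (pc \<sigma>))" "sim n W s' \<sigma>1"
    by force
  then obtain t2 \<sigma>2 where 2: "t2 + tm s' \<le> tm s''" "reach n w P \<sigma>1 (tp s') t2 \<sigma>2 (tp s'')"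
      "pc \<sigma>2 = pc \<sigma>1 + length (ccom c2 (pc \<sigma>1))" "sim n W s'' \<sigma>2"
    using big_Seq.IH(2)[of \<sigma>1] big_Seq.prems by auto
  then show ?case using 1 reach_trans[OF 1(2) 2(2)]
    by (intro exI[of _ "t1 + t2"] exI[of _ \<sigma>2]) auto
next
  case (big_Ite_True s e1 e2 c1 s' c2)
  let ?a = "cexp e1 32 @ cexp e2 33"
  define q2 where "q2 = ccom c2 (pc \<sigma> + length ?a + 1)"
  define i1 where "i1 = pc \<sigma> + length ?a + 2 + length q2"
  define q1 where "q1 = ccom c1 i1"
  have code: "ccom (Ite e1 e2 c1 c2) (pc \<sigma>) = ?a @ [Jump_Less 32 33 i1] @ q2 @ [Jump (i1 + length q1)] @ q1"
    by (simp add: Let_def q2_def q1_def i1_def)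
  obtain \<sigma>1 where 1: "reach n w P \<sigma> (tp s) (ecost e1 + ecost e2) \<sigma>1 (tp s)"
      "pc \<sigma>1 = pc \<sigma> + ecost e1 + ecost e2"
      "reg \<sigma>1 32 = ev s e1" "reg \<sigma>1 33 = ev s e2" "sim n W s \<sigma>1"
    using cexp_pair_correct[OF W(1,3), of s e1 e2 \<sigma> P "tp s"] big_Ite_True code by auto
  define \<sigma>2 where "\<sigma>2 = \<sigma>1\<lparr>pc := i1\<rparr>"
  have "P ! pc \<sigma>1 = Jump_Less 32 33 i1" "pc \<sigma>1 < length P" and cq: "code_at P i1 q1"
    using big_Ite_True.prems(2) unfolding code by (auto simp: 1 add.assoc i1_def)
  then have r2: "reach n w P \<sigma>1 (tp s) 1 \<sigma>2 (tp s)"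
    using 1 big_Ite_True.hyps by (intro reach_step) (auto simp: \<sigma>2_def)
  obtain t \<sigma>3 where 3: "t + (tm s + (ecost e1 + ecost e2 + 2)) \<le> tm s'"
      "reach n w P \<sigma>2 (tp s) t \<sigma>3 (tp s')" "pc \<sigma>3 = i1 + length q1" "sim n W s' \<sigma>3"
    using big_Ite_True.IH[of \<sigma>2] 1 cq by (auto simp: \<sigma>2_def sim_pc q1_def)
  show ?case
    using 3 reach_trans[OF reach_trans[OF 1(1) r2] 3(2)] unfolding code
    by (intro exI[of _ "ecost e1 + ecost e2 + 1 + t"] exI[of _ \<sigma>3]) (auto simp: i1_def)
next
  case (big_Ite_False s e1 e2 c2 s' c1)
  let ?a = "cexp e1 32 @ cexp e2 33"
  define i2 where "i2 = pc \<sigma> + length ?a + 1"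
  define q2 where "q2 = ccom c2 i2"
  define i1 where "i1 = pc \<sigma> + length ?a + 2 + length q2"
  define q1 where "q1 = ccom c1 i1"
  have code: "ccom (Ite e1 e2 c1 c2) (pc \<sigma>) = ?a @ [Jump_Less 32 33 i1] @ q2 @ [Jump (i1 + length q1)] @ q1"
    by (simp add: Let_def q2_def q1_def i1_def i2_def)
  obtain \<sigma>1 where 1: "reach n w P \<sigma> (tp s) (ecost e1 + ecost e2) \<sigma>1 (tp s)"
      "pc \<sigma>1 = pc \<sigma> + ecost e1 + ecost e2"
      "reg \<sigma>1 32 = ev s e1" "reg \<sigma>1 33 = ev s e2" "sim n W s \<sigma>1"
    using cexp_pair_correct[OF W(1,3), of s e1 e2 \<sigma> P "tp s"] big_Ite_False code by auto
  define \<sigma>2 where "\<sigma>2 = \<sigma>1\<lparr>pc := i2\<rparr>"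
  have "P ! pc \<sigma>1 = Jump_Less 32 33 i1" "pc \<sigma>1 < length P" and cq: "code_at P i2 q2"
    and j: "P ! (i2 + length q2) = Jump (i1 + length q1)" "i2 + length q2 < length P"
    using big_Ite_False.prems(2) unfolding code by (auto simp: 1 add.assoc i1_def i2_def)
  then have r2: "reach n w P \<sigma>1 (tp s) 1 \<sigma>2 (tp s)"
    using 1 big_Ite_False.hyps by (intro reach_step) (auto simp: \<sigma>2_def i2_def)
  obtain t \<sigma>3 where 3: "t + (tm s + (ecost e1 + ecost e2 + 2)) \<le> tm s'"
      "reach n w P \<sigma>2 (tp s) t \<sigma>3 (tp s')" "pc \<sigma>3 = i2 + length q2" "sim n W s' \<sigma>3"
    using big_Ite_False.IH[of \<sigma>2] 1 cq by (auto simp: \<sigma>2_def sim_pc q2_def)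
  have r4: "reach n w P \<sigma>3 (tp s') 1 (\<sigma>3\<lparr>pc := i1 + length q1\<rparr>) (tp s')"
    using 3 j by (intro reach_step) auto
  show ?case
    using 3 reach_trans[OF reach_trans[OF reach_trans[OF 1(1) r2] 3(2)] r4] unfolding code
    by (intro exI[of _ "ecost e1 + ecost e2 + 1 + t + 1"] exI[of _ "\<sigma>3\<lparr>pc := i1 + length q1\<rparr>"])
       (auto simp: i1_def sim_pc)
next
  case (big_While_True s e1 e2 b s' s'')
  let ?a = "cexp e1 32 @ cexp e2 33"
  define i where "i = pc \<sigma> + length ?a + 2"
  define q where "q = ccom b i"
  have code: "ccom (While e1 e2 b) (pc \<sigma>) = ?a @ [Jump_Less 32 33 i] @ [Jump (i + 1 + length q)] @ q @ [Jump (pc \<sigma>)]"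
    by (simp add: Let_def q_def i_def)
  obtain \<sigma>1 where 1: "reach n w P \<sigma> (tp s) (ecost e1 + ecost e2) \<sigma>1 (tp s)"
      "pc \<sigma>1 = pc \<sigma> + ecost e1 + ecost e2"
      "reg \<sigma>1 32 = ev s e1" "reg \<sigma>1 33 = ev s e2" "sim n W s \<sigma>1"
    using cexp_pair_correct[OF W(1,3), of s e1 e2 \<sigma> P "tp s"] big_While_True code by auto
  define \<sigma>2 where "\<sigma>2 = \<sigma>1\<lparr>pc := i\<rparr>"
  have "P ! pc \<sigma>1 = Jump_Less 32 33 i" "pc \<sigma>1 < length P" and cq: "code_at P i q"
    and j: "P ! (i + length q) = Jump (pc \<sigma>)" "i + length q < length P"
    using big_While_True.prems(2) unfolding code by (auto simp: 1 add.assoc i_def)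
  then have r2: "reach n w P \<sigma>1 (tp s) 1 \<sigma>2 (tp s)"
    using 1 big_While_True.hyps by (intro reach_step) (auto simp: \<sigma>2_def)
  obtain t \<sigma>3 where 3: "t + (tm s + (ecost e1 + ecost e2 + 2)) \<le> tm s'"
      "reach n w P \<sigma>2 (tp s) t \<sigma>3 (tp s')" "pc \<sigma>3 = i + length q" "sim n W s' \<sigma>3"
    using big_While_True.IH(1)[of \<sigma>2] 1 cq by (auto simp: \<sigma>2_def sim_pc q_def)
  have r4: "reach n w P \<sigma>3 (tp s') 1 (\<sigma>3\<lparr>pc := pc \<sigma>\<rparr>) (tp s')"
    using 3 j by (intro reach_step) auto
  obtain t' \<sigma>5 where 5: "t' + tm s' \<le> tm s''"
      "reach n w P (\<sigma>3\<lparr>pc := pc \<sigma>\<rparr>) (tp s') t' \<sigma>5 (tp s'')"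
      "pc \<sigma>5 = pc \<sigma> + length (ccom (While e1 e2 b) (pc \<sigma>))" "sim n W s'' \<sigma>5"
    using big_While_True.IH(2)[of "\<sigma>3\<lparr>pc := pc \<sigma>\<rparr>"] 3 big_While_True.prems(2)
    by (auto simp: sim_pc simp del: ccom.simps)
  show ?case
    using 3 5 reach_trans[OF reach_trans[OF reach_trans[OF reach_trans[OF 1(1) r2] 3(2)] r4] 5(2)]
    by (intro exI[of _ "ecost e1 + ecost e2 + 1 + t + 1 + t'"] exI[of _ \<sigma>5]) (auto simp del: ccom.simps)
next
  case (big_While_False s e1 e2 b)
  let ?a = "cexp e1 32 @ cexp e2 33"
  define i where "i = pc \<sigma> + length ?a + 2"
  define q where "q = ccom b i"
  have code: "ccom (While e1 e2 b) (pc \<sigma>) = ?a @ [Jump_Less 32 33 i] @ [Jump (i + 1 + length q)] @ q @ [Jump (pc \<sigma>)]"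
    by (simp add: Let_def q_def i_def)
  obtain \<sigma>1 where 1: "reach n w P \<sigma> (tp s) (ecost e1 + ecost e2) \<sigma>1 (tp s)"
      "pc \<sigma>1 = pc \<sigma> + ecost e1 + ecost e2"
      "reg \<sigma>1 32 = ev s e1" "reg \<sigma>1 33 = ev s e2" "sim n W s \<sigma>1"
    using cexp_pair_correct[OF W(1,3), of s e1 e2 \<sigma> P "tp s"] big_While_False code by auto
  have j: "P ! pc \<sigma>1 = Jump_Less 32 33 i" "pc \<sigma>1 < length P"
    "P ! (Suc (pc \<sigma>1)) = Jump (i + 1 + length q)" "Suc (pc \<sigma>1) < length P"
    using big_While_False.prems(2) unfolding code by (auto simp: 1 add.assoc i_def)
  have r2: "reach n w P \<sigma>1 (tp s) 1 (\<sigma>1\<lparr>pc := Suc (pc \<sigma>1)\<rparr>) (tp s)"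
    using 1 j big_While_False.hyps by (intro reach_step) auto
  have r3: "reach n w P (\<sigma>1\<lparr>pc := Suc (pc \<sigma>1)\<rparr>) (tp s) 1 (\<sigma>1\<lparr>pc := i + 1 + length q\<rparr>) (tp s)"
    using 1 j by (intro reach_step) auto
  show ?case
    using 1 reach_trans[OF reach_trans[OF 1(1) r2] r3] unfolding code
    by (intro exI[of _ "ecost e1 + ecost e2 + 1 + 1"] exI[of _ "\<sigma>1\<lparr>pc := i + 1 + length q\<rparr>"])
       (auto simp: i_def sim_pc)
qed

section \<open>An order in which neighborhoods have few boundaries\<close>

text \<open>One pass of radix sort, on the bit that tells adjacency to \<open>r\<close>. The
  partition is stable, so that the earlier passes break ties.\<close>

definition split_by :: "nat set set \<Rightarrow> nat list \<Rightarrow> nat \<Rightarrow> nat list" where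
  "split_by E xs r = filter (\<lambda>x. {r, x} \<notin> E) xs @ filter (\<lambda>x. {r, x} \<in> E) xs"

text \<open>For nonempty \<open>xs\<close>, the row of \<open>u\<close> read along \<open>xs\<close>
  has one more constant run than boundaries; this is what a search pays for
  \<open>u\<close>.\<close>

definition boundaries :: "nat set set \<Rightarrow> nat list \<Rightarrow> nat \<Rightarrow> nat set" where
  "boundaries E xs u = {i. Suc i < length xs \<and> ({u, xs ! i} \<in> E) \<noteq> ({u, xs ! Suc i} \<in> E)}"

definition nbhd_diff :: "nat \<Rightarrow> nat set set \<Rightarrow> nat \<Rightarrow> nat \<Rightarrow> nat set" where
  "nbhd_diff n E x y = {u. u < n \<and> ({u, x} \<in> E) \<noteq> ({u, y} \<in> E)}"

text \<open>The last draw is the most significant.\<close>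

fun key :: "nat set set \<Rightarrow> nat list \<Rightarrow> nat \<Rightarrow> nat" where
  "key E [] x = 0"
| "key E (r # rs) x = of_bool ({r, x} \<in> E) + 2 * key E rs x"

lemma key_eq_iff: "key E rs x = key E rs y \<longleftrightarrow> (\<forall>r\<in>set rs. ({r, x} \<in> E) = ({r, y} \<in> E))"
proof (induction rs)
  case (Cons r rs)
  have "of_bool a + 2 * k = of_bool b + 2 * l \<longleftrightarrow> a = b \<and> k = l" for a b and k l :: nat
    by (cases a; cases b; simp; presburger)
  then show ?case using Cons by simp
qed simp

lemma key_less: "key E rs x < 2 ^ length rs"
  by (induction rs) (auto simp: of_bool_def)

lemma key_append: "key E (rs @ rs') x = key E rs x + 2 ^ length rs * key E rs' x"
  by (induction rs) (auto simp: algebra_simps)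

text \<open>A further pass adds the new top bit \<open>2 ^ length rs\<close> to the keys of the
  second part only. Both parts stay sorted by stability, and keys of the first part are below the
  new bit. As \<open>xs\<close> is arbitrary, this applies to every suffix of the draws, with the
  result of the earlier passes as \<open>xs\<close>.\<close>

lemma sorted_key_foldl_split_by: "sorted (map (key E rs) (foldl (split_by E) xs rs))"
proof (induction rs rule: rev_induct)
  case Nil
  show ?case by (simp add: sorted_iff_nth_mono_less)
next
  case (snoc r rs)
  let ?ys = "foldl (split_by E) xs rs"
  have sorted_f: "sorted (map (key E rs) (filter Q ?ys))" for Q
    using snoc by (simp add: sorted_wrt_map sorted_wrt_filter)
  have 0: "map (key E (rs @ [r])) (filter (\<lambda>x. {r, x} \<notin> E) ?ys) = map (key E rs) (filter (\<lambda>x. {r, x} \<notin> E) ?ys)"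
    by (simp add: key_append)
  have 1: "map (key E (rs @ [r])) (filter (\<lambda>x. {r, x} \<in> E) ?ys)
      = map (\<lambda>k. k + 2 ^ length rs) (map (key E rs) (filter (\<lambda>x. {r, x} \<in> E) ?ys))"
    by (simp add: key_append)
  have 2: "sorted (map (\<lambda>k. k + 2 ^ length rs) (map (key E rs) (filter (\<lambda>x. {r, x} \<in> E) ?ys)))"
    using sorted_f[of "\<lambda>x. {r, x} \<in> E"] by (simp add: sorted_wrt_map)
  have 3: "a \<le> b + 2 ^ length rs" if "a = key E rs x" for a b x
    using key_less[of E rs x] that by simp
  have "foldl (split_by E) xs (rs @ [r]) = filter (\<lambda>x. {r, x} \<notin> E) ?ys @ filter (\<lambda>x. {r, x} \<in> E) ?ys"
    by (simp add: split_by_def[of E ?ys])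
  then show ?case
    unfolding map_append 0 1 sorted_append using sorted_f 2 3
    by (simp only: map_append 0 1 sorted_append) auto
qed

lemma mset_foldl_split_by: "mset (foldl (split_by E) xs rs) = mset xs"
  by (induction rs arbitrary: xs) (auto simp: split_by_def)

text \<open>The value right after a change exceeds all values before it, so different changes lead
  to different values.\<close>

lemma card_changes_sorted:
  fixes ys :: "nat list"
  assumes "sorted ys"
  shows "card {i. Suc i < length ys \<and> ys ! i \<noteq> ys ! Suc i} \<le> card (set ys)"
proof (rule card_inj_on_le[of "\<lambda>i. ys ! Suc i"])
  have lt: "ys ! Suc i < ys ! Suc j" if "i < j" "Suc j < length ys" "ys ! j \<noteq> ys ! Suc j" for i j
    using sorted_nth_mono[OF assms, of "Suc i" j] sorted_nth_mono[OF assms, of j "Suc j"] that by simp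
  show "inj_on (\<lambda>i. ys ! Suc i) {i. Suc i < length ys \<and> ys ! i \<noteq> ys ! Suc i}"
    by (rule linorder_inj_onI) (use lt in force)+
qed auto

text \<open>A key is determined by the trace of the neighborhood on \<open>set ds\<close>, and
  linear neighborhood complexity bounds the number of traces. The draws may repeat: the bound is
  applied to \<open>card (set ds)\<close>, which is at most \<open>length ds\<close>.\<close>

lemma card_key_le:
  assumes lin: "linear_nbhd_complexity c {..<n} E" and ds: "set ds \<subseteq> {..<n}" "ds \<noteq> []" and c: "c > 0"
  shows "real (card (key E ds ` {..<n})) \<le> c * real (length ds)"
proof -
  let ?m = "card (set ds)"
  let ?T = "\<lambda>C. {nbhd E v \<inter> C | v. v \<in> {..<n}}"
  have m: "?m \<in> {1..card {..<n}}"
    using ds card_mono[of "{..<n}" "set ds"] by (auto simp: Suc_le_eq card_gt_0_iff)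
  have "key E ds ` {..<n} \<subseteq> (\<lambda>S. key E ds (SOME v. v < n \<and> nbhd E v \<inter> set ds = S)) ` ?T (set ds)"
  proof (rule image_subsetI)
    fix v assume v: "v \<in> {..<n}"
    define w where "w = (SOME w. w < n \<and> nbhd E w \<inter> set ds = nbhd E v \<inter> set ds)"
    have "w < n \<and> nbhd E w \<inter> set ds = nbhd E v \<inter> set ds"
      unfolding w_def by (rule someI[of _ v]) (use v in auto)
    then have "key E ds v = key E ds w" by (auto simp: key_eq_iff nbhd_def)
    then show "key E ds v \<in> (\<lambda>S. key E ds (SOME v. v < n \<and> nbhd E v \<inter> set ds = S)) ` ?T (set ds)"
      using v unfolding w_def by blast
  qed
  then have "card (key E ds ` {..<n}) \<le> card (?T (set ds))"
    by (rule surj_card_le[rotated]) simp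
  also have "\<dots> \<le> nbhd_complexity {..<n} E ?m"
    unfolding nbhd_complexity_def using ds by (intro Max_ge) auto
  finally have "real (card (key E ds ` {..<n})) \<le> real (nbhd_complexity {..<n} E ?m)" by simp
  also have "\<dots> \<le> c * real ?m" using lin m by (simp add: linear_nbhd_complexity_def)
  also have "\<dots> \<le> c * real (length ds)" using c by (simp add: card_length)
  finally show ?thesis .
qed

section \<open>The probability of good draws\<close>

text \<open>
  The suffix of length \<open>m\<close> is a random sample of size \<open>m\<close>; vertices that it does not distinguish
  should have almost the same neighborhoods.
\<close>

definition good_draws :: "nat \<Rightarrow> nat set set \<Rightarrow> nat list \<Rightarrow> bool" where
  "good_draws n E rs \<longleftrightarrow> length rs = n \<and> set rs \<subseteq> {..<n} \<and>
     (\<forall>x<n. \<forall>y<n. \<forall>m\<in>{1..n}. set (drop (n - m) rs) \<inter> nbhd_diff n E x y = {} \<longrightarrow>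
        real (card (nbhd_diff n E x y)) * real m \<le> 4 * real n * ln (real n))"

text \<open>The first \<open>n - m\<close> draws are free, the last \<open>m\<close> must each fall
  outside \<open>D\<close>.\<close>

lemma card_lists_suffix_avoids:
  assumes "m \<le> n" "D \<subseteq> {..<n}"
  shows "card {rs. length rs = n \<and> set rs \<subseteq> {..<n} \<and> set (drop (n - m) rs) \<inter> D = {}}
    \<le> n ^ (n - m) * (n - card D) ^ m"
proof -
  let ?A = "{ys. set ys \<subseteq> {..<n} \<and> length ys = n - m}" and ?B = "{zs. set zs \<subseteq> {..<n} - D \<and> length zs = m}"
  have "card {rs. length rs = n \<and> set rs \<subseteq> {..<n} \<and> set (drop (n - m) rs) \<inter> D = {}} \<le> card (?A \<times> ?B)"
  proof (rule card_inj_on_le[of "\<lambda>rs. (take (n - m) rs, drop (n - m) rs)"])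
    show "inj_on (\<lambda>rs. (take (n - m) rs, drop (n - m) rs))
        {rs. length rs = n \<and> set rs \<subseteq> {..<n} \<and> set (drop (n - m) rs) \<inter> D = {}}"
      by (rule inj_onI) (metis append_take_drop_id prod.inject)
    show "finite (?A \<times> ?B)" by (intro finite_cartesian_product finite_lists_length_eq) auto
  qed (use assms in \<open>auto dest: in_set_takeD in_set_dropD\<close>)
  also have "\<dots> = n ^ (n - m) * (n - card D) ^ m"
    using assms finite_subset[OF assms(2)] by (simp add: card_cartesian_product card_lists_length_eq card_Diff_subset)
  finally show ?thesis .
qed

text \<open>A union bound. If the neighborhoods of \<open>x\<close> and \<open>y\<close> differ in
  \<open>d\<close> vertices and \<open>d * m > 4 * n * ln n\<close>, then \<open>m\<close> draws
  miss the difference with probability at most \<open>(1 - d / n) ^ m\<close>, which is at most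
  \<open>exp (- d * m / n)\<close> and hence at most \<open>1 / n ^ 4\<close>. There are
  \<open>n ^ 3\<close> choices of \<open>x\<close>, \<open>y\<close> and \<open>m\<close>.\<close>

lemma card_good_draws:
  assumes n: "n > 0"
  shows "real (card {rs. good_draws n E rs}) \<ge> real n ^ n * (1 - 1 / real n)"
proof -
  define L where "L = {rs. set rs \<subseteq> {..<n} \<and> length rs = n}"
  define bad where "bad = (\<lambda>x y m. if real (card (nbhd_diff n E x y)) * real m \<le> 4 * real n * ln (real n) then {}
      else {rs \<in> L. set (drop (n - m) rs) \<inter> nbhd_diff n E x y = {}})"
  have finL: "finite L" unfolding L_def by (intro finite_lists_length_eq) auto
  have cL: "card L = n ^ n" unfolding L_def by (subst card_lists_length_eq) auto
  have cbad: "real (card (bad x y m)) \<le> real n ^ n / real n ^ 4" if m: "m \<in> {1..n}" for x y m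
  proof (cases "real (card (nbhd_diff n E x y)) * real m \<le> 4 * real n * ln (real n)")
    case False
    let ?d = "card (nbhd_diff n E x y)"
    have sub: "nbhd_diff n E x y \<subseteq> {..<n}" by (auto simp: nbhd_diff_def)
    have dn: "?d \<le> n" using card_mono[OF _ sub] by simp
    have "card (bad x y m) \<le> n ^ (n - m) * (n - ?d) ^ m"
      using card_lists_suffix_avoids[OF _ sub, of m] m False by (simp add: bad_def L_def conj_ac)
    then have "real (card (bad x y m)) \<le> real (n ^ (n - m) * (n - ?d) ^ m)"
      by (simp only: of_nat_le_iff)
    also have "\<dots> = real n ^ (n - m) * real (n - ?d) ^ m" by simp
    also have "real (n - ?d) ^ m \<le> (real n * exp (- (real ?d / real n))) ^ m"
    proof (intro power_mono)
      have "real (n - ?d) = real n * (1 + - (real ?d / real n))"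
        using dn n by (simp add: field_simps of_nat_diff)
      also have "\<dots> \<le> real n * exp (- (real ?d / real n))"
        by (intro mult_left_mono exp_ge_add_one_self) auto
      finally show "real (n - ?d) \<le> real n * exp (- (real ?d / real n))" .
    qed auto
    also have "\<dots> = real n ^ m * exp (- (real ?d * real m / real n))"
      by (simp add: power_mult_distrib exp_of_nat_mult[symmetric] mult.commute)
    also have "exp (- (real ?d * real m / real n)) \<le> exp (- (4 * ln (real n)))"
      using False n by (simp add: field_simps)
    also have "exp (- (4 * ln (real n))) = 1 / real n ^ 4"
      using n exp_of_nat_mult[of 4 "ln (real n)"] by (simp add: exp_minus field_simps)
    finally have "real (card (bad x y m)) \<le> real n ^ (n - m) * (real n ^ m * (1 / real n ^ 4))"
      by (simp add: mult_left_mono)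
    also have "\<dots> = real n ^ n / real n ^ 4"
      using m by (simp add: power_add[symmetric])
    finally show ?thesis .
  qed (simp add: bad_def)
  let ?I = "{..<n} \<times> {..<n} \<times> {1..n}"
  have sub: "L - {rs. good_draws n E rs} \<subseteq> (\<Union>(x, y, m)\<in>?I. bad x y m)"
  proof
    fix rs assume rs: "rs \<in> L - {rs. good_draws n E rs}"
    then obtain x y m where "x < n" "y < n" "m \<in> {1..n}" "set (drop (n - m) rs) \<inter> nbhd_diff n E x y = {}"
      "\<not> real (card (nbhd_diff n E x y)) * real m \<le> 4 * real n * ln (real n)"
      unfolding good_draws_def L_def by blast
    then have "(x, y, m) \<in> ?I" "rs \<in> bad x y m" using rs by (auto simp: bad_def)
    then show "rs \<in> (\<Union>(x, y, m)\<in>?I. bad x y m)" by blast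
  qed
  have "card (L - {rs. good_draws n E rs}) \<le> card (\<Union>(x, y, m)\<in>?I. bad x y m)"
    by (rule card_mono[OF _ sub]) (auto intro!: finite_subset[OF _ finL] simp: bad_def)
  also have "\<dots> \<le> (\<Sum>(x, y, m)\<in>?I. card (bad x y m))"
    by (rule order_trans[OF card_UN_le]) (auto simp: case_prod_unfold)
  finally have "real (card (L - {rs. good_draws n E rs})) \<le> (\<Sum>(x, y, m)\<in>?I. real (card (bad x y m)))"
    by (simp add: case_prod_unfold flip: of_nat_sum)
  also have "\<dots> \<le> (\<Sum>(x, y, m)\<in>?I. real n ^ n / real n ^ 4)"
    by (intro sum_mono) (auto intro!: cbad)
  also have "\<dots> = real n ^ n * (1 / real n)"
    using n by (simp add: case_prod_unfold field_simps eval_nat_numeral)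
  finally have "real (card (L - {rs. good_draws n E rs})) \<le> real n ^ n * (1 / real n)" .
  moreover have gL: "{rs. good_draws n E rs} \<subseteq> L" by (auto simp: good_draws_def L_def)
  then have "card (L - {rs. good_draws n E rs}) = n ^ n - card {rs. good_draws n E rs}"
    by (simp add: card_Diff_subset finite_subset[OF gL finL] cL)
  moreover have "card {rs. good_draws n E rs} \<le> n ^ n"
    using card_mono[OF finL gL] cL by simp
  ultimately show ?thesis by (simp add: of_nat_diff algebra_simps)
qed

text \<open>Double counting turns the boundaries of all rows into differences of consecutive
  neighborhoods. With \<open>L = 4 * n * ln n\<close>, the summand \<open>c * n\<close> covers the
  positions separated by the last draw alone, each of at most \<open>2 * ln n\<close> levels adds
  \<open>2 * c * L\<close>, and \<open>2 * L\<close> covers the positions that the largest sample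
  still does not separate.\<close>

lemma sum_boundaries_le:
  assumes lin: "linear_nbhd_complexity c {..<n} E" and c: "c > 0" and n: "n \<ge> 2"
    and good: "good_draws n E rs"
  shows "(\<Sum>u<n. real (card (boundaries E (foldl (split_by E) [0..<n] rs) u)))
    \<le> c * real n + 16 * c * real n * (ln (real n))\<^sup>2 + 8 * real n * ln (real n)"
proof -
  define xs where "xs = foldl (split_by E) [0..<n] rs"
  have mset: "mset xs = mset [0..<n]" by (simp add: xs_def mset_foldl_split_by)
  have len: "length xs = n" using mset_eq_length[OF mset] by simp
  have set_xs: "set xs = {..<n}" using mset_eq_setD[OF mset] by (auto simp: atLeast0LessThan)
  have nth_less: "xs ! i < n" if "i < n" for i using nth_mem[of i xs] that len set_xs by auto
  have rs: "length rs = n" "set rs \<subseteq> {..<n}" using good by (auto simp: good_draws_def)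
  define L where "L = 4 * real n * ln (real n)"
  have L0: "L \<ge> 0" using n by (simp add: L_def)
  define I where "I = {i. Suc i < n}"
  have finI: "finite I" by (rule finite_subset[of _ "{..<n}"]) (auto simp: I_def)
  have "I \<subseteq> {..<n}" by (auto simp: I_def)
  then have cI: "card I \<le> n" using card_mono[of "{..<n}" I] by simp
  define d where "d = (\<lambda>i. real (card (nbhd_diff n E (xs ! i) (xs ! Suc i))))"
  define B where "B = (\<lambda>m. {i\<in>I. key E (drop (n - m) rs) (xs ! i) \<noteq> key E (drop (n - m) rs) (xs ! Suc i)})"
  have cB: "real (card (B m)) \<le> c * real m" if m: "m \<in> {1..n}" for m
  proof -
    let ?ds = "drop (n - m) rs"
    \<comment> \<open>The passes before the last \<open>m\<close> only supply an input list for
      these.\<close>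
    have "xs = foldl (split_by E) (foldl (split_by E) [0..<n] (take (n - m) rs)) ?ds"
      by (simp add: xs_def flip: foldl_append)
    then have "sorted (map (key E ?ds) xs)" using sorted_key_foldl_split_by by metis
    moreover have "B m = {i. Suc i < length (map (key E ?ds) xs) \<and>
        map (key E ?ds) xs ! i \<noteq> map (key E ?ds) xs ! Suc i}"
      unfolding B_def I_def by (rule set_eqI) (use len in \<open>auto simp: nth_map\<close>)
    ultimately have "card (B m) \<le> card (key E ?ds ` {..<n})"
      using card_changes_sorted[of "map (key E ?ds) xs"] by (simp only: set_map set_xs)
    also have "real \<dots> \<le> c * real (length ?ds)"
      using m rs set_drop_subset[of "n - m" rs] by (intro card_key_le lin c) auto
    finally show ?thesis using m rs by simp
  qed
  \<comment> \<open>If the last \<open>m\<close> draws do not separate two consecutive vertices, the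
    sample misses the difference of their neighborhoods, which is then small because the draws are
    good.\<close>
  have d_le: "d i \<le> L / real m" if "i \<in> I" "i \<notin> B m" "m \<in> {1..n}" for i m
  proof -
    have "set (drop (n - m) rs) \<inter> nbhd_diff n E (xs ! i) (xs ! Suc i) = {}"
      using that by (auto simp: B_def key_eq_iff nbhd_diff_def)
    then have "d i * real m \<le> L"
      using good that nth_less[of i] nth_less[of "Suc i"] by (auto simp: good_draws_def d_def L_def I_def)
    then show ?thesis using that by (simp add: field_simps)
  qed
  have d_le_n: "d i \<le> real n" for i
    using card_mono[of "{..<n}" "nbhd_diff n E (xs ! i) (xs ! Suc i)"]
    by (auto simp: d_def nbhd_diff_def)
  \<comment> \<open>Passing from \<open>2 ^ j\<close> to \<open>2 ^ Suc j\<close> draws adds at most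
    \<open>c * 2 ^ Suc j\<close> positions, each with a difference of at most
    \<open>L / 2 ^ j\<close>: the powers cancel. At \<open>j = 0\<close> every difference is bounded
    trivially by \<open>n\<close>.\<close>
  have level: "(\<Sum>i\<in>B (2 ^ j). d i) \<le> c * real n + real j * (2 * c * L)" if "2 ^ j \<le> n" for j
    using that
  proof (induction j)
    case 0
    have "(\<Sum>i\<in>B 1. d i) \<le> real (card (B 1)) * real n"
      by (rule sum_bounded_above) (rule d_le_n)
    also have "\<dots> \<le> c * real n" using cB[of 1] n by (intro mult_right_mono) auto
    finally show ?case by simp
  next
    case (Suc j)
    have fB: "finite (B m)" for m using finI by (simp add: B_def)
    have "(\<Sum>i\<in>B (2 ^ Suc j). d i) \<le> (\<Sum>i\<in>B (2 ^ j) \<union> (B (2 ^ Suc j) - B (2 ^ j)). d i)"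
      by (rule sum_mono2) (auto simp: fB d_def)
    also have "\<dots> = (\<Sum>i\<in>B (2 ^ j). d i) + (\<Sum>i\<in>B (2 ^ Suc j) - B (2 ^ j). d i)"
      by (rule sum.union_disjoint) (auto simp: fB)
    also have "(\<Sum>i\<in>B (2 ^ Suc j) - B (2 ^ j). d i) \<le> real (card (B (2 ^ Suc j) - B (2 ^ j))) * (L / real (2 ^ j))"
      using Suc.prems by (intro sum_bounded_above d_le) (auto simp: B_def)
    also have "\<dots> \<le> real (card (B (2 ^ Suc j))) * (L / real (2 ^ j))"
      using L0 by (intro mult_right_mono) (auto intro!: card_mono fB)
    also have "\<dots> \<le> (c * real (2 ^ Suc j)) * (L / real (2 ^ j))"
      using L0 cB[of "2 ^ Suc j"] Suc.prems by (intro mult_right_mono) auto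
    also have "\<dots> = 2 * c * L" by simp
    also have "(\<Sum>i\<in>B (2 ^ j). d i) \<le> c * real n + real j * (2 * c * L)"
      using Suc by simp
    finally show ?case by (simp add: distrib_right)
  qed
  obtain J where J: "2 ^ J \<le> n" "n < 2 ^ Suc J"
    using ex_power_ivl1[of 2 n] n by auto
  have "real J * ln 2 \<le> ln (real n)"
  proof -
    have "ln (2 ^ J :: real) \<le> ln (real n)"
    proof (rule ln_mono)
      have "real (2 ^ J) \<le> real n" using J(1) by (simp only: of_nat_le_iff)
      then show "(2 ^ J :: real) \<le> real n" by simp
    qed (use n in simp_all)
    then show ?thesis by (simp add: ln_realpow)
  qed
  \<comment> \<open>This crude bound gives \<open>J \<le> 2 * ln n\<close>. The constant 16 of the
    claim is this factor 2, times the 2 of each level, times the 4 in \<open>L\<close>.\<close>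
  moreover have "ln (2::real) \<ge> 1 / 2"
    using ln2_ge_two_thirds by simp
  ultimately have J2: "real J \<le> 2 * ln (real n)"
    using mult_left_mono[of "1 / 2" "ln 2" "real J"] by simp
  have "(\<Sum>i\<in>I. d i) = (\<Sum>i\<in>B (2 ^ J). d i) + (\<Sum>i\<in>I - B (2 ^ J). d i)"
    using finI by (subst sum.subset_diff[of "B (2 ^ J)" I]) (auto simp: B_def)
  \<comment> \<open>At most \<open>n\<close> positions remain, and \<open>n < 2 * 2 ^ J\<close>, so
    that together they contribute at most \<open>2 * L\<close>.\<close>
  also have "(\<Sum>i\<in>I - B (2 ^ J). d i) \<le> real (card (I - B (2 ^ J))) * (L / real (2 ^ J))"
    using J by (intro sum_bounded_above d_le) auto
  also have "\<dots> \<le> real n * (L / real (2 ^ J))"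
    using L0 cI card_mono[OF finI, of "I - B (2 ^ J)"] by (intro mult_right_mono) auto
  also have "\<dots> \<le> 2 * L"
  proof -
    have "real n \<le> real (2 ^ Suc J)" using J(2) by (simp only: of_nat_le_iff)
    then have "real n \<le> 2 * 2 ^ J" by simp
    then have "real n * L \<le> 2 * 2 ^ J * L" using L0 by (rule mult_right_mono)
    then show ?thesis by (simp add: field_simps)
  qed
  also have "(\<Sum>i\<in>B (2 ^ J). d i) \<le> c * real n + real J * (2 * c * L)" by (rule level[OF J(1)])
  also have "\<dots> \<le> c * real n + (2 * ln (real n)) * (2 * c * L)"
    using J2 L0 c by (intro add_left_mono mult_right_mono) auto
  finally have sum_d: "(\<Sum>i\<in>I. d i) \<le> c * real n + (2 * ln (real n)) * (2 * c * L) + 2 * L" by simp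
  have "(\<Sum>u<n. real (card (boundaries E xs u))) =
      (\<Sum>u<n. \<Sum>i\<in>I. of_bool (({u, xs ! i} \<in> E) \<noteq> ({u, xs ! Suc i} \<in> E)))"
  proof (intro sum.cong refl)
    fix u
    have "boundaries E xs u = I \<inter> {i. ({u, xs ! i} \<in> E) \<noteq> ({u, xs ! Suc i} \<in> E)}"
      by (auto simp: boundaries_def len I_def)
    then show "real (card (boundaries E xs u)) = (\<Sum>i\<in>I. of_bool (({u, xs ! i} \<in> E) \<noteq> ({u, xs ! Suc i} \<in> E)))"
      by (simp add: finI sum_of_bool_eq Int_def)
  qed
  also have "\<dots> = (\<Sum>i\<in>I. \<Sum>u<n. of_bool (({u, xs ! i} \<in> E) \<noteq> ({u, xs ! Suc i} \<in> E)))"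
    by (rule sum.swap)
  also have "\<dots> = (\<Sum>i\<in>I. d i)"
    by (intro sum.cong) (auto simp: d_def nbhd_diff_def Int_def)
  finally show ?thesis using sum_d unfolding xs_def by (simp add: L_def power2_eq_square algebra_simps)
qed

section \<open>Certificates for breadth-first search\<close>

text \<open>\<open>W\<close> is the set of vertices reached from \<open>s\<close>; \<open>d\<close> and \<open>p\<close> give their depths and parents.\<close>

definition bfs_cert ::
  "'a set \<Rightarrow> 'a set set \<Rightarrow> 'a \<Rightarrow> 'a set \<Rightarrow> ('a \<Rightarrow> nat) \<Rightarrow> ('a \<Rightarrow> 'a) \<Rightarrow> bool" where
  "bfs_cert V E s W d p \<longleftrightarrow> s \<in> W \<and> W \<subseteq> V \<and> d s = 0 \<and>
     (\<forall>v\<in>W - {s}. p v \<in> W \<and> {p v, v} \<in> E \<and> d v = Suc (d (p v))) \<and>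
     (\<forall>u\<in>W. \<forall>v\<in>V. {u, v} \<in> E \<longrightarrow> v \<in> W \<and> d v \<le> Suc (d u))"

text \<open>Paths have distinct vertices. If \<open>v\<close> already occurs, the path is cut at
  \<open>v\<close> instead of being extended.\<close>

lemma is_path_snoc:
  assumes "is_path V E xs" "{last xs, v} \<in> E" "v \<in> V"
  obtains ys where "is_path V E ys" "hd ys = hd xs" "last ys = v" "length ys \<le> Suc (length xs)"
proof (cases "v \<in> set xs")
  case True
  then obtain a b where ab: "xs = a @ v # b" by (auto simp: in_set_conv_decomp)
  show thesis
    by (rule that[of "a @ [v]"])
       (use assms ab in \<open>auto simp: is_path_def successively_append_iff hd_append split: if_splits\<close>)
next
  case False
  show thesis
    by (rule that[of "xs @ [v]"])
       (use assms False in \<open>auto simp: is_path_def successively_append_iff\<close>)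
qed

lemma is_path_rev:
  assumes "is_path V E xs" shows "is_path V E (rev xs)"
  using assms by (auto simp: is_path_def insert_commute)

lemma is_path_singleton [simp]: "is_path V E [v] \<longleftrightarrow> v \<in> V"
  by (simp add: is_path_def)

lemma graph_dist_le: "is_path V E xs \<Longrightarrow> graph_dist V E (hd xs) (last xs) \<le> enat (length xs - 1)"
  unfolding graph_dist_def by (rule INF_lower) auto

text \<open>By the closure clause of the certificate, an edge from \<open>W\<close> stays in
  \<open>W\<close> and raises the depth by at most one. This is the lower bound on distances, and it
  shows that nothing outside \<open>W\<close> is reachable.\<close>

lemma bfs_cert_path_le:
  assumes "bfs_cert V E s W d p" "successively (\<lambda>u v. {u, v} \<in> E) xs" "set xs \<subseteq> V" "xs \<noteq> []" "hd xs = s"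
  shows "last xs \<in> W \<and> d (last xs) \<le> length xs - 1"
  using assms(2-5)
proof (induction xs rule: rev_induct)
  case (snoc v xs)
  show ?case
  proof (cases "xs = []")
    case True
    then show ?thesis using snoc assms(1) by (simp add: bfs_cert_def)
  next
    case False
    then have "last xs \<in> W" "d (last xs) \<le> length xs - 1" "{last xs, v} \<in> E" "v \<in> V"
      using snoc by (auto simp: successively_append_iff)
    then have "v \<in> W" "d v \<le> Suc (d (last xs))" using assms(1) by (auto simp: bfs_cert_def)
    moreover have "Suc (length xs - 1) = length xs" using False by simp
    ultimately show ?thesis using \<open>d (last xs) \<le> length xs - 1\<close> by simp
  qed
qed simp

text \<open>Following parents lowers the depth by exactly one per step and can only end in
  \<open>s\<close>. This is the upper bound on distances.\<close>

lemma bfs_cert_path: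
  assumes "bfs_cert V E s W d p" "v \<in> W"
  obtains xs where "is_path V E xs" "hd xs = s" "last xs = v" "length xs \<le> Suc (d v)"
  using assms(2)
proof (induction "d v" arbitrary: v thesis rule: less_induct)
  case less
  show ?case
  proof (cases "v = s")
    case True
    then show ?thesis using less.prems(1)[of "[s]"] less.prems(2) assms(1) by (auto simp: bfs_cert_def)
  next
    case False
    then have p: "p v \<in> W" "{p v, v} \<in> E" "d v = Suc (d (p v))" "v \<in> V"
      using assms(1) less.prems(2) by (auto simp: bfs_cert_def)
    obtain xs where xs: "is_path V E xs" "hd xs = s" "last xs = p v" "length xs \<le> Suc (d (p v))"
      using less.hyps[of "p v"] p by auto
    obtain ys where "is_path V E ys" "hd ys = s" "last ys = v" "length ys \<le> Suc (length xs)"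
      using is_path_snoc[OF xs(1), of v] xs p by auto
    then show ?thesis using less.prems(1) xs p by auto
  qed
qed

lemma graph_dist_bfs_cert:
  assumes cert: "bfs_cert V E s W d p"
  shows "graph_dist V E s v = (if v \<in> W then enat (d v) else \<infinity>)"
proof (cases "v \<in> W")
  case True
  obtain xs where xs: "is_path V E xs" "hd xs = s" "last xs = v" "length xs \<le> Suc (d v)"
    using bfs_cert_path[OF cert True] .
  have "graph_dist V E s v \<le> enat (length xs - 1)" using graph_dist_le[OF xs(1)] xs by simp
  also have "\<dots> \<le> enat (d v)" using xs by auto
  finally have "graph_dist V E s v \<le> enat (d v)" .
  moreover have "enat (d v) \<le> graph_dist V E s v"
    unfolding graph_dist_def
    by (rule INF_greatest) (use bfs_cert_path_le[OF cert] in \<open>auto simp: is_path_def\<close>)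
  ultimately show ?thesis using True by simp
next
  case False
  then have none: "{xs. is_path V E xs \<and> hd xs = s \<and> last xs = v} = {}"
    using bfs_cert_path_le[OF cert] by (auto simp: is_path_def)
  show ?thesis using False unfolding graph_dist_def none by (simp add: top_enat_def)
qed

text \<open>The tree formed by the parents has the same certificate as the graph, which makes its
  distances from \<open>s\<close> the same.\<close>

lemma bfs_cert_tree:
  assumes cert: "bfs_cert V E s W d p"
  shows "bfs_cert W {{v, p v} | v. v \<in> W - {s}} s W d p"
  using cert unfolding bfs_cert_def by (auto simp: doubleton_eq_iff insert_commute)

section \<open>The parent edges form a shortest-path tree\<close>

lemma nth_next_cyclic:
  assumes "successively R xs" "R (last xs) (hd xs)" "i < length xs"
  shows "R (xs ! i) (xs ! (Suc i mod length xs))"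
proof (cases "Suc i < length xs")
  case True
  then show ?thesis using assms by (simp add: successively_conv_nth)
next
  case False
  then have "Suc i = length xs" using assms by simp
  then show ?thesis using assms by (cases xs rule: rev_cases) (auto simp: hd_conv_nth nth_append)
qed

text \<open>A vertex of maximal depth on a cycle would have its parent as both of its neighbors
  there, although these are distinct.\<close>

lemma acyclic_bfs_tree:
  assumes cert: "bfs_cert V E s W d p"
  shows "acyclic_graph W {{v, p v} | v. v \<in> W - {s}}"
  unfolding acyclic_graph_def
proof
  let ?F = "{{v, p v} | v. v \<in> W - {s}}"
  assume "\<exists>xs. is_path W ?F xs \<and> length xs \<ge> 3 \<and> {last xs, hd xs} \<in> ?F"
  then obtain xs where xs: "is_path W ?F xs" "length xs \<ge> 3" "{last xs, hd xs} \<in> ?F" by blast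
  define k where "k = length xs"
  have succ: "{xs ! i, xs ! (Suc i mod k)} \<in> ?F" if "i < k" for i
    using nth_next_cyclic[of "\<lambda>u v. {u, v} \<in> ?F" xs i] xs that by (auto simp: is_path_def k_def)
  have "xs \<noteq> []" using xs by auto
  then obtain i where i: "i < k" and max: "\<And>j. j < k \<Longrightarrow> d (xs ! j) \<le> d (xs ! i)"
  proof -
    have "finite ((\<lambda>j. d (xs ! j)) ` {..<k})" "(\<lambda>j. d (xs ! j)) ` {..<k} \<noteq> {}"
      using \<open>xs \<noteq> []\<close> by (auto simp: k_def)
    from Max_in[OF this] Max_ge[OF this(1)] show ?thesis
      by (smt (verit, best) image_iff lessThan_iff that)
  qed
  text \<open>An edge from a vertex of maximal depth on the cycle must lead to its parent.\<close>
  have parent: "xs ! j = p (xs ! i)" if jk: "j < k" and e: "{xs ! i, xs ! j} \<in> ?F" for j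
  proof -
    obtain v where v: "v \<in> W - {s}" "{xs ! i, xs ! j} = {v, p v}" using e by auto
    have "d v = Suc (d (p v))" using cert v by (auto simp: bfs_cert_def)
    then show ?thesis using v max[OF jk] by (auto simp: doubleton_eq_iff)
  qed
  define j1 where "j1 = Suc i mod k"
  \<comment> \<open>The cyclic predecessor of \<open>i\<close>; \<open>k - 1\<close> is added
    because \<open>i - 1\<close> would truncate at 0.\<close>
  define j2 where "j2 = (i + (k - 1)) mod k"
  have k3: "k \<ge> 3" using xs by (simp add: k_def)
  have j: "j1 < k" "j2 < k" using k3 by (auto simp: j1_def j2_def)
  have "Suc j2 mod k = i"
    using i k3 by (simp add: j2_def mod_Suc_eq)
  \<comment> \<open>This is where the cycle must have length at least 3.\<close>
  have j12: "j1 \<noteq> j2"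
    using i k3 unfolding j1_def j2_def by (cases "Suc i < k"; cases "i = 0") (auto simp: mod_if)
  have "{xs ! i, xs ! j1} \<in> ?F" unfolding j1_def using succ[OF i] .
  moreover have "{xs ! j2, xs ! (Suc j2 mod k)} \<in> ?F" using succ[OF j(2)] .
  then have "{xs ! i, xs ! j2} \<in> ?F" unfolding \<open>Suc j2 mod k = i\<close> by (simp only: insert_commute)
  ultimately have "xs ! j1 = xs ! j2" using parent[OF j(1)] parent[OF j(2)] by simp
  then show False
    using j12 j xs nth_eq_iff_index_eq[of xs j1 j2] by (auto simp: is_path_def k_def)
qed

lemma shortest_path_tree_bfs_cert:
  assumes cert: "bfs_cert V E s W d p" and "finite V"
  shows "shortest_path_tree V E s W {{v, p v} | v. v \<in> W - {s}}"
proof -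
  let ?F = "{{v, p v} | v. v \<in> W - {s}}"
  have W: "W \<subseteq> V" "s \<in> W" using cert by (auto simp: bfs_cert_def)
  have cert': "bfs_cert W ?F s W d p" by (rule bfs_cert_tree[OF cert])
  have conn: "connected_graph W ?F"
    unfolding connected_graph_def
  proof (intro conjI ballI)
    fix u v assume u: "u \<in> W" and v: "v \<in> W"
    obtain xs where xs: "is_path W ?F xs" "hd xs = s" "last xs = u"
      using bfs_cert_path[OF cert' u] by blast
    obtain ys where ys: "is_path W ?F ys" "hd ys = s" "last ys = v"
      using bfs_cert_path[OF cert' v] by blast
    \<comment> \<open>From \<open>u\<close> back to \<open>s\<close>, then along \<open>ys\<close>.
      The vertices of \<open>ys\<close> are appended one at a time, so that
      \<open>is_path_snoc\<close> removes repetitions.\<close>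
    have "\<exists>zs. is_path W ?F zs \<and> hd zs = u \<and> last zs = last ys"
      if "ys \<noteq> []" "hd ys = s" "set ys \<subseteq> W" "successively (\<lambda>u v. {u, v} \<in> ?F) ys" for ys
      using that
    proof (induction ys rule: rev_induct)
      case (snoc y ys)
      show ?case
      proof (cases "ys = []")
        case True
        then show ?thesis using snoc.prems is_path_rev[OF xs(1)] xs
          by (intro exI[of _ "rev xs"]) (auto simp: hd_rev last_rev)
      next
        case False
        then obtain zs where zs: "is_path W ?F zs" "hd zs = u" "last zs = last ys"
          using snoc by (auto simp: successively_append_iff)
        have "{last zs, y} \<in> ?F" "y \<in> W" using snoc.prems False zs by (auto simp: successively_append_iff)
        from is_path_snoc[OF zs(1) this] show ?thesis using zs(2) by auto
      qed
    qed simp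
    then show "\<exists>zs. is_path W ?F zs \<and> hd zs = u \<and> last zs = v"
      using ys by (auto simp: is_path_def)
  qed (use W in auto)
  have pW: "p v \<in> W" and pE: "{v, p v} \<in> E" and pd: "d v = Suc (d (p v))" if "v \<in> W - {s}" for v
    using cert that by (auto simp: bfs_cert_def insert_commute)
  have "v \<noteq> p v" if "v \<in> W - {s}" for v
    using pd[OF that] by (metis n_not_Suc_n)
  with pW have simple: "simple_graph W ?F"
    using finite_subset[OF W(1) \<open>finite V\<close>] unfolding simple_graph_def by blast
  have sub: "?F \<subseteq> E" using pE by blast
  show ?thesis
    unfolding shortest_path_tree_def is_tree_def
    unfolding graph_dist_bfs_cert[OF cert] graph_dist_bfs_cert[OF cert']
    using simple conn acyclic_bfs_tree[OF cert] sub W by (auto split: if_splits)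
qed

section \<open>Skipping visited positions\<close>

text \<open>
  Intervals of \<open>{0, \<dots>, n}\<close> whose right ends are exactly the unvisited positions in \<open>U\<close> and \<open>n\<close>:
  \<open>lab p\<close> names the interval of \<open>p\<close>, whose ends are stored under that name.
\<close>

definition skip_intervals :: "nat \<Rightarrow> nat set \<Rightarrow> (nat \<Rightarrow> nat) \<Rightarrow> (nat \<Rightarrow> nat) \<Rightarrow> (nat \<Rightarrow> nat) \<Rightarrow> bool" where
  "skip_intervals n U lab lft rgt \<longleftrightarrow> (\<forall>p\<le>n. lab p \<le> n \<and> lft (lab p) \<le> p \<and> p \<le> rgt (lab p) \<and> rgt (lab p) \<le> n \<and>
     (rgt (lab p) \<in> U \<or> rgt (lab p) = n) \<and>
     (\<forall>q. lft (lab p) \<le> q \<and> q \<le> rgt (lab p) \<longrightarrow> lab q = lab p) \<and>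
     (\<forall>q. p \<le> q \<and> q < rgt (lab p) \<longrightarrow> q \<notin> U))"

text \<open>Every position contributes the bit length of the size of its interval. A relabelling at
  least doubles that size and so gains at least one unit; the final value thus bounds the number of
  relabellings.\<close>

definition skip_potential :: "nat \<Rightarrow> (nat \<Rightarrow> nat) \<Rightarrow> (nat \<Rightarrow> nat) \<Rightarrow> (nat \<Rightarrow> nat) \<Rightarrow> nat" where
  "skip_potential n lab lft rgt = (\<Sum>p\<le>n. floorlog 2 (Suc (rgt (lab p)) - lft (lab p)))"

lemma skip_intervals_id:
  assumes "\<And>p. p \<le> n \<Longrightarrow> lab p = p \<and> lft p = p \<and> rgt p = p"
  shows "skip_intervals n {..<n} lab lft rgt"
  using assms by (auto simp: skip_intervals_def)

lemma skip_intervalsD: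
  assumes "skip_intervals n U lab lft rgt" "p \<le> n"
  shows "lab p \<le> n" "lft (lab p) \<le> p" "p \<le> rgt (lab p)" "rgt (lab p) \<le> n"
    "rgt (lab p) \<in> U \<or> rgt (lab p) = n"
    "\<And>q. lft (lab p) \<le> q \<Longrightarrow> q \<le> rgt (lab p) \<Longrightarrow> lab q = lab p"
    "\<And>q. p \<le> q \<Longrightarrow> q < rgt (lab p) \<Longrightarrow> q \<notin> U"
  using assms unfolding skip_intervals_def by blast+

lemma skip_potential_le:
  assumes "skip_intervals n U lab lft rgt"
  shows "skip_potential n lab lft rgt \<le> (n + 1) * floorlog 2 (n + 1)"
proof -
  have "skip_potential n lab lft rgt \<le> (\<Sum>p\<le>n. floorlog 2 (n + 1))"
    unfolding skip_potential_def
  proof (intro sum_mono floorlog_mono)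
    fix p assume "p \<in> {..n}"
    then have "rgt (lab p) \<le> n" using skip_intervalsD(4)[OF assms] by simp
    then show "Suc (rgt (lab p)) - lft (lab p) \<le> n + 1" by simp
  qed
  then show ?thesis by simp
qed

lemma floorlog_double: "x > 0 \<Longrightarrow> 2 * x \<le> y \<Longrightarrow> floorlog 2 x + 1 \<le> floorlog 2 y"
  using floorlog_mono[of "2 * x" y 2] compute_floorlog[of 2 "2 * x"] by simp

text \<open>The smaller of the two intervals meeting at \<open>x\<close> is relabelled, so its members at least double their interval.\<close>

lemma skip_intervals_remove:
  fixes n x :: nat and lab lft rgt :: "nat \<Rightarrow> nat"
  assumes inv: "skip_intervals n U lab lft rgt" and U: "U \<subseteq> {..<n}" and x: "x \<in> U"
    and a: "a = lab x" and b: "b = lab (Suc x)" and l: "l = lft a" and r: "r = rgt b"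
    and ft: "(f, t, w) = (if r - x < Suc x - l then (Suc x, Suc r, a) else (l, Suc x, b))"
    and lab': "lab' = (\<lambda>p. if f \<le> p \<and> p < t then w else lab p)"
    and lft': "lft' = lft(w := l)" and rgt': "rgt' = rgt(w := r)"
  shows "skip_intervals n (U - {x}) lab' lft' rgt'"
    and "skip_potential n lab lft rgt + (t - f) \<le> skip_potential n lab' lft' rgt'"
    and "f \<le> t" "t \<le> Suc n" "w \<le> n" "l \<le> x" "x < r" "r \<le> n" "a \<le> n" "b \<le> n"
proof -
  have xn: "x < n" using U x by auto
  have A: "a \<le> n" "l \<le> x" "rgt a = x" "\<And>q. l \<le> q \<Longrightarrow> q \<le> x \<Longrightarrow> lab q = a"
  proof -
    have le: "x \<le> n" using xn by simp
    note D = skip_intervalsD[OF inv le]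
    \<comment> \<open>Since \<open>x\<close> is unvisited, it must itself be the right end of its
      interval.\<close>
    show eq: "rgt a = x" using D(3) D(7)[of x] x unfolding a by (metis le_neq_implies_less order_refl)
    show "a \<le> n" "l \<le> x" using D(1,2) unfolding a l by simp_all
    show "lab q = a" if "l \<le> q" "q \<le> x" for q using D(6)[of q] eq that unfolding a l by simp
  qed
  \<comment> \<open>Because of the sentinel \<open>n\<close>, there is always an interval to the
    right of \<open>x\<close>.\<close>
  have "Suc x \<le> n" using xn by simp
  note D = skip_intervalsD[OF inv this]
  have B: "b \<le> n" "x < r" "r \<le> n" "r \<in> U \<or> r = n" "lft b \<le> Suc x" "\<And>q. lft b \<le> q \<Longrightarrow> q \<le> r \<Longrightarrow> lab q = b"
    "\<And>q. x < q \<Longrightarrow> q < r \<Longrightarrow> q \<notin> U"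
    using D unfolding b r Suc_le_eq by blast+
  have ab: "a \<noteq> b" using A(3) B(2) r by auto
  have lb: "lft b = Suc x"
  proof (rule ccontr)
    assume "lft b \<noteq> Suc x"
    then have "lab x = b" using B(2,5) B(6)[of x] by simp
    then show False using ab a by simp
  qed
  have lab_b: "lab q = b" if "x < q" "q \<le> r" for q using B(6)[of q] lb that by simp
  have cases: "f = Suc x \<and> t = Suc r \<and> w = a \<and> r - x < Suc x - l \<or> f = l \<and> t = Suc x \<and> w = b \<and> Suc x - l \<le> r - x"
    using ft by (auto split: if_splits)
  have outside: "lab p \<noteq> a \<and> lab p \<noteq> b" if "p \<le> n" "\<not> (l \<le> p \<and> p \<le> r)" for p
  proof -
    have "lft (lab p) \<le> p" "p \<le> rgt (lab p)" using skip_intervalsD(2,3)[OF inv that(1)] by simp_all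
    then show ?thesis using that A(2,3) B(2) lb r l by auto
  qed
  have in1: "lab' p = w \<and> lft' (lab' p) = l \<and> rgt' (lab' p) = r" if "l \<le> p" "p \<le> r" for p
    using that cases A(4)[of p] lab_b[of p] by (cases "p \<le> x") (auto simp: lab' lft' rgt')
  have out1: "lab' p = lab p \<and> lft' (lab' p) = lft (lab p) \<and> rgt' (lab' p) = rgt (lab p)"
    if "p \<le> n" "\<not> (l \<le> p \<and> p \<le> r)" for p
    using that cases outside[OF that] A(2) B(2) by (auto simp: lab' lft' rgt')
  show "skip_intervals n (U - {x}) lab' lft' rgt'"
    unfolding skip_intervals_def
  proof (intro allI impI)
    fix p assume p: "p \<le> n"
    show "lab' p \<le> n \<and> lft' (lab' p) \<le> p \<and> p \<le> rgt' (lab' p) \<and> rgt' (lab' p) \<le> n \<and>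
     (rgt' (lab' p) \<in> U - {x} \<or> rgt' (lab' p) = n) \<and>
     (\<forall>q. lft' (lab' p) \<le> q \<and> q \<le> rgt' (lab' p) \<longrightarrow> lab' q = lab' p) \<and>
     (\<forall>q. p \<le> q \<and> q < rgt' (lab' p) \<longrightarrow> q \<notin> U - {x})"
    proof (cases "l \<le> p \<and> p \<le> r")
      case True
      have gap: "q \<notin> U - {x}" if "p \<le> q" "q < r" for q
      proof (cases "q < x")
        case True
        then have "lab p = a" using A(4)[of p] \<open>l \<le> p \<and> p \<le> r\<close> that by simp
        then have "q \<notin> U" using skip_intervalsD(7)[OF inv p, of q] that True A(3) by simp
        then show ?thesis by simp
      next
        case False
        then show ?thesis using B(7)[of q] that by (cases "q = x") auto
      qed
      have "w \<le> n" using cases A B by auto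
      then show ?thesis using in1[of p] True in1 B gap by auto
    next
      case False
      note o = out1[OF p False] outside[OF p False]
      note pp = skip_intervalsD[OF inv p]
      have "rgt (lab p) \<noteq> x" using pp(6)[of x] pp(2,3) o(2) a by auto
      moreover have "lab' q = lab p" if "lft (lab p) \<le> q" "q \<le> rgt (lab p)" for q
      proof -
        have q: "lab q = lab p" "q \<le> n" using pp(4) pp(6)[OF that] that by simp_all
        have "\<not> (l \<le> q \<and> q \<le> r)" using q(1) o(2) A(4)[of q] lab_b[of q] by (metis not_le)
        then show ?thesis using out1[of q] q by simp
      qed
      ultimately show ?thesis using o pp(1-5,7) by auto
    qed
  qed
  show bounds: "f \<le> t" "t \<le> Suc n" "w \<le> n" "l \<le> x" "x < r" "r \<le> n" "a \<le> n" "b \<le> n"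
    using cases A B xn by auto
  \<comment> \<open>Relabelled positions gain at least one unit, all others lose nothing.\<close>
  have le: "floorlog 2 (Suc (rgt (lab p)) - lft (lab p)) + of_bool (f \<le> p \<and> p < t)
      \<le> floorlog 2 (Suc (rgt' (lab' p)) - lft' (lab' p))" if p: "p \<le> n" for p
  proof (cases "l \<le> p \<and> p \<le> r")
    case False
    then have "\<not> (f \<le> p \<and> p < t)" using cases A(2) B(2) by auto
    moreover have "lft' (lab' p) = lft (lab p)" "rgt' (lab' p) = rgt (lab p)"
      using out1[OF p False] by blast+
    ultimately show ?thesis by simp
  next
    case True
    then have "lft' (lab' p) = l" "rgt' (lab' p) = r" using in1 by blast+
    then have new: "Suc (rgt' (lab' p)) - lft' (lab' p) = Suc r - l" by simp
    show ?thesis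
    proof (cases "p \<le> x")
      case True
      then have old: "Suc (rgt (lab p)) - lft (lab p) = Suc x - l" using A(3) A(4)[of p] \<open>l \<le> p \<and> p \<le> r\<close> l by simp
      show ?thesis
      proof (cases "f \<le> p \<and> p < t")
        case True
        then have "2 * (Suc x - l) \<le> Suc r - l" using cases \<open>p \<le> x\<close> A(2) B(2) by auto
        then show ?thesis using floorlog_double[of "Suc x - l" "Suc r - l"] True A(2) new old by simp
      next
        case False
        then show ?thesis unfolding new old using B(2) by (auto intro!: floorlog_mono)
      qed
    next
      case False
      then have old: "Suc (rgt (lab p)) - lft (lab p) = r - x" using lab_b[of p] \<open>l \<le> p \<and> p \<le> r\<close> lb r by simp
      show ?thesis
      proof (cases "f \<le> p \<and> p < t")
        case True
        then have "2 * (r - x) \<le> Suc r - l" using cases \<open>\<not> p \<le> x\<close> A(2) B(2) by auto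
        then show ?thesis using floorlog_double[of "r - x" "Suc r - l"] True B(2) new old by simp
      next
        case False
        then show ?thesis unfolding new old using A(2) by (auto intro!: floorlog_mono)
      qed
    qed
  qed
  have "(\<Sum>p\<le>n. of_bool (f \<le> p \<and> p < t) :: nat) = card {f..<t}"
  proof -
    have "{..n} \<inter> {p. f \<le> p \<and> p < t} = {f..<t}" using bounds(2) by auto
    then show ?thesis by (simp add: sum_of_bool_eq)
  qed
  then show "skip_potential n lab lft rgt + (t - f) \<le> skip_potential n lab' lft' rgt'"
    using sum_mono[OF le, of "{..n}" id] by (simp add: skip_potential_def sum.distrib)
qed

section \<open>The queue of a breadth-first search\<close>

text \<open>The first \<open>h\<close> vertices of the queue \<open>q\<close> have been processed.\<close>

definition bfs_queue :: "nat \<Rightarrow> nat set set \<Rightarrow> nat \<Rightarrow> nat \<Rightarrow> nat list \<Rightarrow> (nat \<Rightarrow> nat) \<Rightarrow> (nat \<Rightarrow> nat) \<Rightarrow> bool" where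
  "bfs_queue n E s h q d par \<longleftrightarrow> distinct q \<and> set q \<subseteq> {..<n} \<and> s \<in> set q \<and> h \<le> length q \<and> d s = 0 \<and> par s = n \<and>
     (\<forall>v\<in>set q - {s}. par v \<in> set q \<and> {par v, v} \<in> E \<and> d v = Suc (d (par v))) \<and>
     (\<forall>v<n. v \<notin> set q \<longrightarrow> d v = n \<and> par v = n) \<and>
     (\<forall>i<h. \<forall>v<n. {q ! i, v} \<in> E \<longrightarrow> v \<in> set q \<and> d v \<le> Suc (d (q ! i))) \<and>
     (\<forall>i<length q. d (q ! i) \<le> i) \<and>
     (\<forall>i j. i \<le> j \<longrightarrow> j < length q \<longrightarrow> d (q ! i) \<le> d (q ! j)) \<and>
     (h < length q \<longrightarrow> (\<forall>i<length q. d (q ! i) \<le> Suc (d (q ! h))))"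

lemma bfs_queue_basic:
  assumes "bfs_queue n E s h q d par"
  shows "distinct q" "set q \<subseteq> {..<n}" "s \<in> set q" "h \<le> length q" "d s = 0" "par s = n"
  using assms unfolding bfs_queue_def by blast+

text \<open>Carries a search over to another state that agrees on its output row.\<close>

lemma bfs_queue_cong:
  assumes inv: "bfs_queue n E s h q d par" and eq: "\<And>y. y < n \<Longrightarrow> d' y = d y \<and> par' y = par y"
  shows "bfs_queue n E s h q d' par'"
proof -
  have sub: "set q \<subseteq> {..<n}" "s \<in> set q" "h \<le> length q" using bfs_queue_basic[OF inv] by auto
  have dq: "d' y = d y" "par' y = par y" if "y \<in> set q" for y using eq sub that by auto
  have di: "d' (q ! i) = d (q ! i)" if "i < length q" for i using dq that by simp
  have "\<forall>v\<in>set q - {s}. par v \<in> set q \<and> {par v, v} \<in> E \<and> d v = Suc (d (par v))"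
    using inv unfolding bfs_queue_def by blast
  then have 1: "\<forall>v\<in>set q - {s}. par' v \<in> set q \<and> {par' v, v} \<in> E \<and> d' v = Suc (d' (par' v))"
    by (metis DiffD1 dq)
  have "\<forall>i<h. \<forall>v<n. {q ! i, v} \<in> E \<longrightarrow> v \<in> set q \<and> d v \<le> Suc (d (q ! i))"
    using inv unfolding bfs_queue_def by blast
  then have 2: "\<forall>i<h. \<forall>v<n. {q ! i, v} \<in> E \<longrightarrow> v \<in> set q \<and> d' v \<le> Suc (d' (q ! i))"
    using di dq(1) sub(3) by (metis order_less_le_trans)
  show ?thesis
    using inv 1 2 unfolding bfs_queue_def by (simp add: eq dq di)
qed

lemma bfs_queue_length:
  assumes "bfs_queue n E s h q d par" shows "length q \<le> n"
  using bfs_queue_basic[OF assms] card_mono[of "{..<n}" "set q"] by (simp add: distinct_card)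

lemma bfs_queue_length_less:
  assumes "bfs_queue n E s h q d par" "v < n" "v \<notin> set q" shows "length q < n"
proof -
  have "set q \<subset> {..<n}" using assms(2,3) bfs_queue_basic[OF assms(1)] by auto
  from psubset_card_mono[OF _ this] show ?thesis
    using bfs_queue_basic[OF assms(1)] by (simp add: distinct_card)
qed

lemma bfs_queue_init:
  assumes "s < n" "d s = 0" "par s = n" "\<And>v. v < n \<Longrightarrow> v \<noteq> s \<Longrightarrow> d v = n \<and> par v = n"
  shows "bfs_queue n E s 0 [s] d par"
  using assms by (simp add: bfs_queue_def)

text \<open>The new vertex gets the largest depth that the last clause of the invariant admits, so
  depths along the queue remain nondecreasing.\<close>

lemma bfs_queue_visit:
  assumes inv: "bfs_queue n E s h q d par" and h: "h < length q" and v: "v < n" "v \<notin> set q" "{q ! h, v} \<in> E"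
  shows "bfs_queue n E s h (q @ [v]) (d(v := Suc (d (q ! h)))) (par(v := q ! h))"
proof -
  let ?d = "d(v := Suc (d (q ! h)))" and ?p = "par(v := q ! h)"
  have vs: "v \<noteq> s" using inv v by (auto simp: bfs_queue_def)
  have nv: "q ! i \<noteq> v" if "i < length q" for i using that v nth_mem by blast
  have qh: "q ! h \<in> set q" using h by simp
  have dh: "d (q ! h) \<le> h" "\<And>i. i < length q \<Longrightarrow> d (q ! i) \<le> Suc (d (q ! h))"
    using inv h by (auto simp: bfs_queue_def)
  have par_in: "par u \<in> set q" "par u \<noteq> v" if "u \<in> set q" "u \<noteq> s" for u
    using inv that v by (auto simp: bfs_queue_def)
  show ?thesis
    unfolding bfs_queue_def
  proof (intro conjI)
    show "\<forall>u\<in>set (q @ [v]) - {s}. ?p u \<in> set (q @ [v]) \<and> {?p u, u} \<in> E \<and>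
      ?d u = Suc (?d (?p u))"
      using inv v qh par_in nv[OF h] by (auto simp: bfs_queue_def)
    show "\<forall>i<h. \<forall>u<n. {(q @ [v]) ! i, u} \<in> E \<longrightarrow>
      u \<in> set (q @ [v]) \<and> ?d u \<le> Suc (?d ((q @ [v]) ! i))"
    proof (intro allI impI)
      fix i u assume i: "i < h" and u: "u < n" "{(q @ [v]) ! i, u} \<in> E"
      then have "u \<in> set q" "d u \<le> Suc (d (q ! i))" using inv h by (auto simp: bfs_queue_def nth_append)
      then show "u \<in> set (q @ [v]) \<and> ?d u \<le> Suc (?d ((q @ [v]) ! i))"
        using v i h nv[of i] by (auto simp: nth_append)
    qed
    show "\<forall>i<length (q @ [v]). ?d ((q @ [v]) ! i) \<le> i"
      using inv h dh nv by (auto simp: bfs_queue_def nth_append less_Suc_eq)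
    show "\<forall>i j. i \<le> j \<longrightarrow> j < length (q @ [v]) \<longrightarrow>
      ?d ((q @ [v]) ! i) \<le> ?d ((q @ [v]) ! j)"
      using inv dh nv by (auto simp: bfs_queue_def nth_append less_Suc_eq)
    show "h < length (q @ [v]) \<longrightarrow> (\<forall>i<length (q @ [v]).
      ?d ((q @ [v]) ! i) \<le> Suc (?d ((q @ [v]) ! h)))"
      using h dh nv by (auto simp: nth_append less_Suc_eq)
  qed (use inv v h vs in \<open>auto simp: bfs_queue_def\<close>)
qed

text \<open>Once all neighbors of \<open>q ! h\<close> are in the queue, the last clause of the
  invariant bounds their depths, which gives the closure clause for \<open>q ! h\<close>. That
  \<open>q ! Suc h\<close> is at least as deep renews the last clause.\<close>

lemma bfs_queue_advance:
  assumes inv: "bfs_queue n E s h q d par" and h: "h < length q"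
    and all: "\<And>v. v < n \<Longrightarrow> {q ! h, v} \<in> E \<Longrightarrow> v \<in> set q"
  shows "bfs_queue n E s (Suc h) q d par"
proof -
  have le: "d v \<le> Suc (d (q ! h))" if "v \<in> set q" for v
    using inv h that by (auto simp: bfs_queue_def in_set_conv_nth)
  have "d (q ! i) \<le> Suc (d (q ! Suc h))" if "Suc h < length q" "i < length q" for i
  proof -
    have "d (q ! i) \<le> Suc (d (q ! h))" using le[of "q ! i"] that by simp
    also have "d (q ! h) \<le> d (q ! Suc h)" using inv that by (simp add: bfs_queue_def)
    finally show ?thesis by simp
  qed
  then show ?thesis
    using inv h all le by (auto simp: bfs_queue_def less_Suc_eq)
qed

lemma bfs_queue_cert:
  assumes inv: "bfs_queue n E s (length q) q d par"
  shows "bfs_cert {..<n} E s (set q) d par"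
proof -
  have "v \<in> set q \<and> d v \<le> Suc (d u)" if "u \<in> set q" "v < n" "{u, v} \<in> E" for u v
    using inv that by (auto simp: bfs_queue_def in_set_conv_nth[of u])
  then show ?thesis using inv by (auto simp: bfs_queue_def bfs_cert_def)
qed

section \<open>Weakest preconditions\<close>

text \<open>As \<open>big\<close> requires safety and is inductive, this is total correctness,
  including the absence of overflow and of accesses out of bounds.\<close>

definition wp :: "nat \<Rightarrow> nat \<Rightarrow> com \<Rightarrow> (state \<Rightarrow> bool) \<Rightarrow> state \<Rightarrow> bool" where
  "wp n W c Q s \<longleftrightarrow> (\<exists>s'. big n W c s s' \<and> Q s')"

inductive_cases big_AssignE: "big n W (Assign r e) s s'"
inductive_cases big_PutE: "big n W (Put j e1 e2) s s'"
inductive_cases big_SeqE: "big n W (Seq c1 c2) s s'"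
inductive_cases big_IteE: "big n W (Ite e1 e2 c1 c2) s s'"

lemma wp_Assign: "wp n W (Assign r e) Q s \<longleftrightarrow> safe n W s e \<and> 2 \<le> r \<and> r < 32 \<and>
    Q (s\<lparr>rg := (rg s)(r := ev s e), tm := tm s + (ecost e + 2)\<rparr>)"
  by (auto simp: wp_def intro: big_Assign elim!: big_AssignE)

lemma wp_Put: "wp n W (Put j e1 e2) Q s \<longleftrightarrow> safe n W s e1 \<and> safe n W s e2 \<and> ev s e1 < n * n \<and> j < 10 \<and>
    Q (s\<lparr>ar := (ar s)(j := (ar s j)(ev s e1 := ev s e2)), tm := tm s + (ecost e1 + ecost e2 + 4)\<rparr>)"
  by (auto simp: wp_def intro: big_Put elim!: big_PutE)

lemma wp_Draw: "tp s = x # xs \<Longrightarrow> x < n \<Longrightarrow> 2 \<le> r \<Longrightarrow> r < 32 \<Longrightarrow>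
    Q (s\<lparr>rg := (rg s)(r := x), tp := xs, tm := tm s + 1\<rparr>) \<Longrightarrow> wp n W (Draw r) Q s"
  by (auto simp: wp_def intro: big_Draw)

lemma wp_Seq: "wp n W (Seq c1 c2) Q s \<longleftrightarrow> wp n W c1 (wp n W c2 Q) s"
  by (auto simp: wp_def intro: big_Seq elim!: big_SeqE)

lemma big_Ite_iff: "big n W (Ite e1 e2 c1 c2) s s' \<longleftrightarrow> safe n W s e1 \<and> safe n W s e2 \<and>
    (if ev s e1 < ev s e2 then big n W c1 (after (ecost e1 + ecost e2 + 2) s) s'
     else big n W c2 (after (ecost e1 + ecost e2 + 2) s) s')"
proof
  assume "big n W (Ite e1 e2 c1 c2) s s'"
  then show "safe n W s e1 \<and> safe n W s e2 \<and>
    (if ev s e1 < ev s e2 then big n W c1 (after (ecost e1 + ecost e2 + 2) s) s'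
     else big n W c2 (after (ecost e1 + ecost e2 + 2) s) s')"
    by (rule big_IteE) simp_all
qed (auto simp only: split: if_splits intro: big_Ite_True big_Ite_False)

lemma wp_Ite: "wp n W (Ite e1 e2 c1 c2) Q s \<longleftrightarrow> safe n W s e1 \<and> safe n W s e2 \<and>
    (if ev s e1 < ev s e2 then wp n W c1 Q (after (ecost e1 + ecost e2 + 2) s)
     else wp n W c2 Q (after (ecost e1 + ecost e2 + 2) s))"
  unfolding wp_def big_Ite_iff by auto

lemmas wp_simps = wp_Assign wp_Put wp_Seq wp_Ite

abbreviation while_step where
  "while_step n W I \<mu> e1 e2 b Q s \<equiv> safe n W s e1 \<and> safe n W s e2 \<and>
     (if ev s e1 < ev s e2
      then wp n W b (\<lambda>s'. I s' \<and> (\<mu> s' :: nat) < \<mu> s) (after (ecost e1 + ecost e2 + 2) s)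
      else Q (after (ecost e1 + ecost e2 + 2) s))"

text \<open>The measure \<open>\<mu>\<close> only ensures termination. Running times are handled by
  invariants that bound the ghost field \<open>tm\<close>, which allows amortized bounds.\<close>

lemma wp_While:
  fixes \<mu> :: "state \<Rightarrow> nat"
  assumes "I s"
    and step: "\<And>s. I s \<Longrightarrow> while_step n W I \<mu> e1 e2 b Q s"
  shows "wp n W (While e1 e2 b) Q s"
  using assms(1)
proof (induction "\<mu> s" arbitrary: s rule: less_induct)
  case less
  show ?case
  proof (cases "ev s e1 < ev s e2")
    case True
    then obtain s' where s': "big n W b (after (ecost e1 + ecost e2 + 2) s) s'" "I s'" "\<mu> s' < \<mu> s"
      using step[OF less.prems] by (auto simp: wp_def)
    obtain s'' where "big n W (While e1 e2 b) s' s''" "Q s''"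
      using less.hyps[OF s'(3,2)] by (auto simp: wp_def)
    then show ?thesis
      unfolding wp_def using big_While_True[OF _ _ True s'(1)] step[OF less.prems] by blast
  next
    case False
    then show ?thesis
      unfolding wp_def using big_While_False[OF _ _ False] step[OF less.prems] by auto
  qed
qed

text \<open>The field \<open>tm\<close> is left free, as every command changes it.\<close>

definition frame :: "nat set \<Rightarrow> nat set \<Rightarrow> state \<Rightarrow> state \<Rightarrow> bool" where
  "frame R K s s' \<longleftrightarrow> (\<forall>r. r \<notin> R \<longrightarrow> rg s' r = rg s r) \<and> (\<forall>k. k \<notin> K \<longrightarrow> ar s' k = ar s k) \<and> tp s' = tp s"

lemma frame_refl [simp]: "frame R K s s"
  by (simp add: frame_def)

lemma frame_trans: "frame R K s s' \<Longrightarrow> frame R' K' s' s'' \<Longrightarrow> R \<subseteq> R'' \<Longrightarrow> R' \<subseteq> R'' \<Longrightarrow> K \<subseteq> K'' \<Longrightarrow> K' \<subseteq> K'' \<Longrightarrow>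
    frame R'' K'' s s''"
  unfolding frame_def by (metis subsetD)

lemma frameD: "frame R K s s' \<Longrightarrow> r \<notin> R \<Longrightarrow> rg s' r = rg s r"
  "frame R K s s' \<Longrightarrow> k \<notin> K \<Longrightarrow> ar s' k = ar s k" "frame R K s s' \<Longrightarrow> tp s' = tp s"
  by (auto simp: frame_def)

lemma frame_update [simp]:
  "frame R K s (s'\<lparr>rg := f, ar := a, tm := t\<rparr>) = frame R K s (s'\<lparr>rg := f, ar := a\<rparr>)"
  "frame R K s (s'\<lparr>rg := f, tm := t\<rparr>) = frame R K s (s'\<lparr>rg := f\<rparr>)"
  "frame R K s (s'\<lparr>ar := a, tm := t\<rparr>) = frame R K s (s'\<lparr>ar := a\<rparr>)"
  "frame R K s (s'\<lparr>tm := t\<rparr>) = frame R K s s'"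
  "r \<in> R \<Longrightarrow> frame R K s (s'\<lparr>rg := f(r := x), ar := a\<rparr>) = frame R K s (s'\<lparr>rg := f, ar := a\<rparr>)"
  "r \<in> R \<Longrightarrow> frame R K s (s'\<lparr>rg := f(r := x)\<rparr>) = frame R K s (s'\<lparr>rg := f\<rparr>)"
  "k \<in> K \<Longrightarrow> frame R K s (s'\<lparr>rg := f, ar := a(k := b)\<rparr>) = frame R K s (s'\<lparr>rg := f, ar := a\<rparr>)"
  "k \<in> K \<Longrightarrow> frame R K s (s'\<lparr>ar := a(k := b)\<rparr>) = frame R K s (s'\<lparr>ar := a\<rparr>)"
  "frame R K s (s'\<lparr>rg := rg s', ar := a\<rparr>) = frame R K s (s'\<lparr>ar := a\<rparr>)"
  "frame R K s (s'\<lparr>rg := f, ar := ar s'\<rparr>) = frame R K s (s'\<lparr>rg := f\<rparr>)"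
  by (auto simp: frame_def)

section \<open>The program\<close>

text \<open>
  Arrays: 0 adjacency, 1 distances, 2 parents, 3 the order, 4 scratch, 5 ends of runs,
  6, 7, 8 labels and ends of the intervals of visited positions, 9 the queue.
  Registers of the search: 9 current vertex, 10 and 11 ends of a run, 7 position to visit,
  13 position of the source, 14 offset of its row, 15 and 17 ends of the queue, 16 depth.
\<close>

definition incr :: "nat \<Rightarrow> com" where
  "incr r = Assign r (Bin Add (Var r) (Num 1))"

text \<open>The language has no empty command; register 31 is a dummy reserved for this.\<close>

definition skip :: com where
  "skip = Assign 31 (Num 0)"

abbreviation seq (infixr ";;" 60) where "c1 ;; c2 \<equiv> Seq c1 c2"

definition init_order :: com where
  "init_order = Assign 4 (Num 0) ;; While (Var 4) (Var 0) (Put 3 (Var 4) (Var 4) ;; incr 4)"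

text \<open>Ones move to the scratch array; zeros are compacted in place.\<close>

definition split_loop :: com where
  "split_loop = While (Var 4) (Var 0)
     (Assign 7 (Get 3 (Var 4)) ;;
      Ite (Num 0) (Get 0 (Bin Add (Var 8) (Var 7)))
        (Put 4 (Var 6) (Var 7) ;; incr 6)
        (Put 3 (Var 5) (Var 7) ;; incr 5) ;;
      incr 4)"

definition copy_loop :: com where
  "copy_loop = While (Var 4) (Var 6) (Put 3 (Var 5) (Get 4 (Var 4)) ;; incr 5 ;; incr 4)"

definition split_round :: com where
  "split_round = Draw 3 ;; Assign 8 (Bin Mul (Var 3) (Var 0)) ;;
     Assign 4 (Num 0) ;; Assign 5 (Num 0) ;; Assign 6 (Num 0) ;; split_loop ;;
     Assign 4 (Num 0) ;; copy_loop ;; incr 2"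

definition sort_phase :: com where
  "sort_phase = init_order ;; Assign 2 (Num 0) ;; While (Var 2) (Var 0) split_round"

text \<open>Works from right to left: registers 11 and 12 hold the end of the run and the adjacency
  bit of the position to the right. The only test is \<open><\<close>, so inequality of two bits
  takes two tests.\<close>

definition run_step :: com where
  "run_step = Assign 10 (Bin Sub (Var 10) (Num 1)) ;;
     Assign 7 (Get 0 (Bin Add (Var 8) (Get 3 (Var 10)))) ;;
     Ite (Var 7) (Var 12) (Assign 11 (Bin Add (Var 10) (Num 1)))
       (Ite (Var 12) (Var 7) (Assign 11 (Bin Add (Var 10) (Num 1))) skip) ;;
     Assign 12 (Var 7) ;;
     Put 5 (Bin Add (Var 8) (Var 10)) (Var 11)"

definition run_row :: com where
  "run_row = Assign 8 (Bin Mul (Var 9) (Var 0)) ;; Assign 10 (Var 0) ;; Assign 11 (Var 0) ;;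
     Assign 12 (Num 0) ;; While (Num 0) (Var 10) run_step ;; incr 9"

definition run_phase :: com where
  "run_phase = Assign 9 (Num 0) ;; While (Var 9) (Var 0) run_row"

definition fill :: com where
  "fill = While (Var 23) (Var 24) (Put 6 (Var 23) (Var 25) ;; incr 23)"

definition relabel :: com where
  "relabel = fill ;; Put 7 (Var 25) (Var 21) ;; Put 8 (Var 25) (Var 22)"

text \<open>The two sides of the comparison are the sizes of the interval to the right of
  \<open>x\<close> and of the interval that ends in \<open>x\<close>, where \<open>x\<close> is the
  position in register 7. The label of the larger one survives in register 25.\<close>

definition visit :: com where
  "visit = Assign 18 (Get 3 (Var 7)) ;;
     Put 1 (Bin Add (Var 14) (Var 18)) (Var 16) ;;
     Put 2 (Bin Add (Var 14) (Var 18)) (Var 9) ;;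
     Put 9 (Var 15) (Var 18) ;; incr 15 ;;
     Assign 19 (Get 6 (Var 7)) ;; Assign 20 (Get 6 (Bin Add (Var 7) (Num 1))) ;;
     Assign 21 (Get 7 (Var 19)) ;; Assign 22 (Get 8 (Var 20)) ;;
     Ite (Bin Sub (Var 22) (Var 7)) (Bin Sub (Bin Add (Var 7) (Num 1)) (Var 21))
       (Assign 23 (Bin Add (Var 7) (Num 1)) ;; Assign 24 (Bin Add (Var 22) (Num 1)) ;; Assign 25 (Var 19))
       (Assign 23 (Var 21) ;; Assign 24 (Bin Add (Var 7) (Num 1)) ;; Assign 25 (Var 20)) ;;
     relabel"

definition init_row :: com where
  "init_row = Assign 4 (Num 0) ;; While (Var 4) (Var 0)
     (Put 1 (Bin Add (Var 14) (Var 4)) (Var 0) ;; Put 2 (Bin Add (Var 14) (Var 4)) (Var 0) ;; incr 4)"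

text \<open>Position \<open>n\<close> is included: it is the sentinel at which the search for an
  unvisited position stops.\<close>

definition init_intervals :: com where
  "init_intervals = Assign 4 (Num 0) ;; While (Var 4) (Bin Add (Var 0) (Num 1))
     (Put 6 (Var 4) (Var 4) ;; Put 7 (Var 4) (Var 4) ;; Put 8 (Var 4) (Var 4) ;; incr 4)"

text \<open>The lookup always starts at the beginning of the run, in register 10: the right end of
  its interval is the first unvisited position from there on.\<close>

definition visit_loop :: com where
  "visit_loop = While (Var 7) (Var 11) (visit ;; Assign 7 (Get 8 (Get 6 (Var 10))))"

definition scan_run :: com where
  "scan_run = Assign 11 (Get 5 (Bin Add (Var 8) (Var 10))) ;;
     Ite (Num 0) (Get 0 (Bin Add (Var 8) (Get 3 (Var 10))))
       (Assign 7 (Get 8 (Get 6 (Var 10))) ;; visit_loop) skip ;;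
     Assign 10 (Var 11)"

definition process_vertex :: com where
  "process_vertex = Assign 9 (Get 9 (Var 17)) ;; Assign 8 (Bin Mul (Var 9) (Var 0)) ;;
     Assign 16 (Bin Add (Get 1 (Bin Add (Var 14) (Var 9))) (Num 1)) ;;
     Assign 10 (Num 0) ;; While (Var 10) (Var 0) scan_run ;; incr 17"

text \<open>Register 13 is a position in the order, so no inverse of the order has to be computed to
  find the position of the source. The source is entered like any other vertex, with depth 0 and
  \<open>n\<close> as its missing parent.\<close>

definition bfs_from :: com where
  "bfs_from = Assign 14 (Bin Mul (Get 3 (Var 13)) (Var 0)) ;; init_row ;; init_intervals ;;
     Assign 15 (Num 0) ;; Assign 16 (Num 0) ;; Assign 9 (Var 0) ;; Assign 7 (Var 13) ;; visit ;;
     Assign 17 (Num 0) ;; While (Var 17) (Var 15) process_vertex ;; incr 13"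

definition apsp :: com where
  "apsp = sort_phase ;; run_phase ;; Assign 13 (Num 0) ;; While (Var 13) (Var 0) bfs_from"

section \<open>Correctness of the sorting phase\<close>

lemma mat_index_less: "u < n \<Longrightarrow> v < n \<Longrightarrow> u * n + v < n * (n :: nat)"
  using mult_le_mono1[of "Suc u" n n] by simp

lemma mat_index_eq: "v < n \<Longrightarrow> v' < n \<Longrightarrow> u * n + v = u' * n + v' \<longleftrightarrow> u = u' \<and> v = (v' :: nat)"
proof
  assume v: "v < n" "v' < n" and eq: "u * n + v = u' * n + v'"
  have "u = (u * n + v) div n" "u' = (u' * n + v') div n" using v by auto
  then show "u = u' \<and> v = v'" using eq by auto
qed auto

definition adj_array :: "nat \<Rightarrow> nat set set \<Rightarrow> (nat \<Rightarrow> nat) \<Rightarrow> bool" where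
  "adj_array n E A \<longleftrightarrow> (\<forall>u<n. \<forall>v<n. A (u * n + v) = of_bool ({u, v} \<in> E))"

definition order_array :: "nat \<Rightarrow> nat list \<Rightarrow> (nat \<Rightarrow> nat) \<Rightarrow> bool" where
  "order_array n xs A \<longleftrightarrow> map A [0..<n] = xs"

text \<open>\<open>n \<ge> 4\<close> gives \<open>4 * n \<le> n * n\<close>. Hence the sentinel
  index \<open>n\<close> fits into an array of \<open>n * n\<close> cells, and numbers up to
  \<open>2 * n\<close> fit into a word. The ten arrays together have \<open>10 * (n * n)\<close>
  cells.\<close>

locale wide_words =
  fixes n W :: nat
  assumes n4: "n \<ge> 4" and W: "10 * (n * n) < W"
begin

lemma small_less_W: "x \<le> 2 * n \<Longrightarrow> x < W"
proof -
  have "4 * n \<le> n * n" using n4 by (intro mult_right_mono) auto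
  then show "x \<le> 2 * n \<Longrightarrow> x < W" using W by linarith
qed

lemma square_less_W: "x \<le> n * n \<Longrightarrow> x < W"
  using W by linarith

lemma Suc_less_square: "x \<le> n \<Longrightarrow> x < n * n"
proof -
  have "4 * n \<le> n * n" using n4 by (intro mult_right_mono) auto
  then show "x \<le> n \<Longrightarrow> x < n * n" using n4 by linarith
qed

lemmas small = small_less_W square_less_W Suc_less_square

text \<open>In this and the following time bounds, the constants sum up the charges of one iteration
  and of the surrounding commands, usually rounded up.\<close>

lemma wp_init_order:
  assumes s: "rg s 0 = n"
    and Q: "\<And>s'. frame {4} {3} s s' \<Longrightarrow> map (ar s' 3) [0..<n] = [0..<n] \<Longrightarrow> tm s' \<le> tm s + 9 + 20 * n \<Longrightarrow> Q s'"
  shows "wp n W init_order Q s"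
  unfolding init_order_def wp_Seq wp_Assign
proof (simp add: small, rule wp_While[where I = "\<lambda>s'. frame {4} {3} s s' \<and> rg s' 4 \<le> n \<and>
    (\<forall>p<rg s' 4. ar s' 3 p = p) \<and> tm s' \<le> tm s + 3 + 20 * rg s' 4" and \<mu> = "\<lambda>s'. n - rg s' 4"])
  let ?I = "\<lambda>s'. frame {4} {3} s s' \<and> rg s' 4 \<le> n \<and> (\<forall>p<rg s' 4. ar s' 3 p = p) \<and>
    tm s' \<le> tm s + 3 + 20 * rg s' 4"
  fix s' assume I: "?I s'"
  then have 0: "rg s' 0 = n" using frameD(1)[of "{4}" "{3}" s s' 0] s by simp
  have exit: "Q (after 6 s')" if "\<not> rg s' 4 < n"
    by (rule Q) (use I that in \<open>auto intro!: nth_equalityI\<close>)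
  show "while_step n W ?I (\<lambda>s'. n - rg s' 4) (Var 4) (Var 0) (Put 3 (Var 4) (Var 4) ;; incr 4) Q s'"
    using I exit by (auto simp: wp_simps incr_def small 0)
qed auto

lemma wp_split_loop:
  assumes s: "rg s 0 = n" "rg s 4 = 0" "rg s 5 = 0" "rg s 6 = 0" "rg s 8 = r * n" "r < n"
    and adj: "adj_array n E (ar s 0)" and ord: "order_array n zs (ar s 3)" and zs: "set zs \<subseteq> {..<n}"
    and Q: "\<And>s'. frame {4, 5, 6, 7} {3, 4} s s' \<Longrightarrow> tm s' \<le> tm s + 10 + 50 * n \<Longrightarrow>
      rg s' 5 = length (filter (\<lambda>x. {r, x} \<notin> E) zs) \<Longrightarrow> rg s' 6 = length (filter (\<lambda>x. {r, x} \<in> E) zs) \<Longrightarrow>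
      map (ar s' 3) [0..<rg s' 5] = filter (\<lambda>x. {r, x} \<notin> E) zs \<Longrightarrow>
      map (ar s' 4) [0..<rg s' 6] = filter (\<lambda>x. {r, x} \<in> E) zs \<Longrightarrow> Q s'"
  shows "wp n W split_loop Q s"
proof -
  let ?N = "filter (\<lambda>x. {r, x} \<notin> E)" and ?Y = "filter (\<lambda>x. {r, x} \<in> E)"
  have len: "length zs = n" using ord by (auto simp: order_array_def)
  \<comment> \<open>Compaction in place is sound because the write index in register 5 never passes
    the read index in register 4; the last conjunct says that the unread part is intact.\<close>
  define I where "I = (\<lambda>s'. frame {4, 5, 6, 7} {3, 4} s s' \<and> rg s' 4 \<le> n \<and> tm s' \<le> tm s + 50 * rg s' 4 \<and>
      rg s' 5 = length (?N (take (rg s' 4) zs)) \<and> rg s' 6 = length (?Y (take (rg s' 4) zs)) \<and>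
      map (ar s' 3) [0..<rg s' 5] = ?N (take (rg s' 4) zs) \<and>
      map (ar s' 4) [0..<rg s' 6] = ?Y (take (rg s' 4) zs) \<and>
      map (ar s' 3) [rg s' 4..<n] = drop (rg s' 4) zs)"
  show ?thesis
    unfolding split_loop_def
  proof (rule wp_While[where I = I and \<mu> = "\<lambda>s'. n - rg s' 4"])
    show "I s" unfolding I_def using s ord by (auto simp: order_array_def)
  next
    fix s' assume I: "I s'"
    define i where "i = rg s' 4"
    note I' = I[unfolded I_def, folded i_def]
    have fr: "frame {4, 5, 6, 7} {3, 4} s s'" using I' by blast
    have r: "rg s' 0 = n" "rg s' 8 = r * n" "ar s' 0 = ar s 0" using frameD[OF fr] s by auto
    have lN: "length (?N (take i zs)) \<le> i" and lY: "length (?Y (take i zs)) \<le> i"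
      using length_filter_le[of _ "take i zs"] I' len by (auto intro: le_trans)
    show "while_step n W I (\<lambda>s'. n - rg s' 4) (Var 4) (Var 0) (Assign 7 (Get 3 (Var 4)) ;;
          Ite (Num 0) (Get 0 (Bin Add (Var 8) (Var 7)))
            (Put 4 (Var 6) (Var 7) ;; incr 6) (Put 3 (Var 5) (Var 7) ;; incr 5) ;;
          incr 4) Q s'"
    proof (cases "i < n")
      case False
      then have "i = n" using I' by simp
      have "Q (after 6 s')"
        by (rule Q) (use I' \<open>i = n\<close> len in auto)
      then show ?thesis using False r by (simp add: i_def)
    next
      case True
      have fi: "ar s' 3 i = zs ! i" "map (ar s' 3) [Suc i..<n] = drop (Suc i) zs"
        using I' True len by (auto simp: upt_conv_Cons Cons_nth_drop_Suc[symmetric])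
      have zi: "zs ! i < n" using zs True len nth_mem[of i zs] by blast
      have tk: "take (Suc i) zs = take i zs @ [zs ! i]" using True len by (simp add: take_Suc_conv_app_nth)
      have A: "ar s 0 (r * n + zs ! i) = of_bool ({r, zs ! i} \<in> E)" using adj zi \<open>r < n\<close> by (simp add: adj_array_def)
      have i: "rg s' 4 = i" by (simp add: i_def)
      show ?thesis
        using I' True lN lY zi mat_index_less[OF \<open>r < n\<close> zi]
        by (auto simp: wp_simps incr_def small r i fi A tk I_def map_fun_upd)
    qed
  qed
qed

lemma wp_copy_loop:
  assumes s: "rg s 4 = 0" "rg s 5 = length ys" "rg s 6 = length zs" "length ys + length zs = n"
    and ys: "map (ar s 3) [0..<length ys] = ys" and zs: "map (ar s 4) [0..<length zs] = zs"
    and Q: "\<And>s'. frame {4, 5} {3} s s' \<Longrightarrow> tm s' \<le> tm s + 10 + 30 * n \<Longrightarrow> order_array n (ys @ zs) (ar s' 3) \<Longrightarrow> Q s'"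
  shows "wp n W copy_loop Q s"
proof -
  define I where "I = (\<lambda>s'. frame {4, 5} {3} s s' \<and> rg s' 4 \<le> length zs \<and> tm s' \<le> tm s + 30 * rg s' 4 \<and>
      rg s' 5 = length ys + rg s' 4 \<and> map (ar s' 3) [0..<length ys + rg s' 4] = ys @ take (rg s' 4) zs)"
  show ?thesis
    unfolding copy_loop_def
  proof (rule wp_While[where I = I and \<mu> = "\<lambda>s'. length zs - rg s' 4"])
    show "I s" unfolding I_def using s ys by auto
  next
    fix s' assume I: "I s'"
    define i where "i = rg s' 4"
    note I' = I[unfolded I_def, folded i_def]
    have fr: "frame {4, 5} {3} s s'" using I' by blast
    have r: "rg s' 6 = length zs" "ar s' 4 = ar s 4" using frameD[OF fr] s by auto
    show "while_step n W I (\<lambda>s'. length zs - rg s' 4) (Var 4) (Var 6) (Put 3 (Var 5) (Get 4 (Var 4)) ;; incr 5 ;; incr 4) Q s'"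
    proof (cases "i < length zs")
      case False
      then have "i = length zs" using I' by simp
      have "Q (after 6 s')"
        by (rule Q) (use I' \<open>i = length zs\<close> s in \<open>auto simp: order_array_def\<close>)
      then show ?thesis using False r by (simp add: i_def)
    next
      case True
      have gi: "ar s 4 i = zs ! i" using zs True by (metis (mono_tags, lifting) add_0 diff_zero length_upt map_nth nth_map nth_upt)
      have tk: "take (Suc i) zs = take i zs @ [zs ! i]" using True by (simp add: take_Suc_conv_app_nth)
      have i: "rg s' 4 = i" by (simp add: i_def)
      show ?thesis
        using I' True s by (auto simp: wp_simps incr_def small r i gi tk I_def map_fun_upd)
    qed
  qed
qed

lemma wp_split_round:
  assumes s: "rg s 0 = n" "tp s = r # rs" "r < n"
    and adj: "adj_array n E (ar s 0)" and ord: "order_array n zs (ar s 3)" and zs: "set zs \<subseteq> {..<n}"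
    and Q: "\<And>s'. frame {2, 3, 4, 5, 6, 7, 8} {3, 4} (s\<lparr>tp := rs\<rparr>) s' \<Longrightarrow> rg s' 2 = Suc (rg s 2) \<Longrightarrow>
      tm s' \<le> tm s + 60 + 80 * n \<Longrightarrow> order_array n (split_by E zs r) (ar s' 3) \<Longrightarrow> Q s'"
    and t: "rg s 2 < n"
  shows "wp n W split_round Q s"
proof -
  let ?N = "filter (\<lambda>x. {r, x} \<notin> E)" and ?Y = "filter (\<lambda>x. {r, x} \<in> E)"
  have len: "length zs = n" using ord by (auto simp: order_array_def)
  have lNY: "length (?N zs) + length (?Y zs) = n"
    using sum_length_filter_compl[of "\<lambda>x. {r, x} \<in> E" zs] len by simp
  have rn: "r * n < n * n" using s n4 by simp
  have "wp n W (split_loop ;; Assign 4 (Num 0) ;; copy_loop ;; incr 2) Q s'"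
    if fr: "frame {2, 3, 4, 5, 6, 7, 8} {3, 4} (s\<lparr>tp := rs\<rparr>) s'" and s': "rg s' 2 = rg s 2" "rg s' 4 = 0" "rg s' 5 = 0" "rg s' 6 = 0"
      "rg s' 8 = r * n" "ar s' 3 = ar s 3" "tm s' \<le> tm s + 30" for s'
    unfolding wp_Seq
  proof (rule wp_split_loop[OF _ s'(2-5) \<open>r < n\<close> _ _ zs])
    show "rg s' 0 = n" "adj_array n E (ar s' 0)" "order_array n zs (ar s' 3)"
      using frameD[OF fr] s s' adj ord by auto
    fix s2 assume fr2: "frame {4, 5, 6, 7} {3, 4} s' s2" and t2: "tm s2 \<le> tm s' + 10 + 50 * n"
      and s2: "rg s2 5 = length (?N zs)" "rg s2 6 = length (?Y zs)"
        "map (ar s2 3) [0..<rg s2 5] = ?N zs" "map (ar s2 4) [0..<rg s2 6] = ?Y zs"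
    have "wp n W copy_loop (wp n W (incr 2) Q) (s2\<lparr>rg := (rg s2)(4 := 0), tm := tm s2 + 3\<rparr>)"
    proof (rule wp_copy_loop[where ys = "?N zs" and zs = "?Y zs"])
      fix s3 assume fr3: "frame {4, 5} {3} (s2\<lparr>rg := (rg s2)(4 := 0), tm := tm s2 + 3\<rparr>) s3"
        and s3: "tm s3 \<le> tm (s2\<lparr>rg := (rg s2)(4 := 0), tm := tm s2 + 3\<rparr>) + 10 + 30 * n"
          "order_array n (?N zs @ ?Y zs) (ar s3 3)"
      have r2: "rg s3 2 = rg s 2" using frameD[OF fr3] frameD[OF fr2] s' by simp
      have fr': "frame {2, 3, 4, 5, 6, 7, 8} {3, 4} (s\<lparr>tp := rs\<rparr>) s3"
        using fr fr2 fr3 by (auto simp: frame_def)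
      show "wp n W (incr 2) Q s3"
        unfolding incr_def wp_Assign using t r2
        by (simp add: small, intro Q) (use fr' s3 t2 s' in \<open>auto simp: split_by_def\<close>)
    qed (use s2 lNY in auto)
    then show "wp n W (Assign 4 (Num 0)) (wp n W copy_loop (wp n W (incr 2) Q)) s2"
      by (simp add: wp_Assign small numeral_3_eq_3)
  qed
  note rest = this
  show ?thesis
    unfolding split_round_def
    apply (subst wp_Seq, rule wp_Draw[where x = r and xs = rs])
    using s rn apply simp_all
    apply (simp add: wp_Seq[of _ _ "Assign _ _"] wp_Assign small)
    by (rule rest) auto
qed

lemma wp_sort_phase:
  assumes s: "rg s 0 = n" and rs: "tp s = rs" "length rs = n" "set rs \<subseteq> {..<n}"
    and adj: "adj_array n E (ar s 0)"
    and Q: "\<And>s'. frame {2, 3, 4, 5, 6, 7, 8} {3, 4} (s\<lparr>tp := []\<rparr>) s' \<Longrightarrow>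
      tm s' \<le> tm s + 30 + 200 * n * n \<Longrightarrow> order_array n (foldl (split_by E) [0..<n] rs) (ar s' 3) \<Longrightarrow> Q s'"
  shows "wp n W sort_phase Q s"
  unfolding sort_phase_def wp_Seq
proof (rule wp_init_order[OF s])
  fix s1 assume fr1: "frame {4} {3} s s1" and s1: "map (ar s1 3) [0..<n] = [0..<n]" "tm s1 \<le> tm s + 9 + 20 * n"
  define I where "I = (\<lambda>s'. rg s' 2 \<le> n \<and> frame {2, 3, 4, 5, 6, 7, 8} {3, 4} (s\<lparr>tp := drop (rg s' 2) rs\<rparr>) s' \<and>
      tm s' \<le> tm s + 12 + 20 * n + rg s' 2 * (70 + 80 * n) \<and>
      order_array n (foldl (split_by E) [0..<n] (take (rg s' 2) rs)) (ar s' 3))"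
  have "wp n W (While (Var 2) (Var 0) split_round) Q (s1\<lparr>rg := (rg s1)(2 := 0), tm := tm s1 + 3\<rparr>)"
  proof (rule wp_While[where I = I and \<mu> = "\<lambda>s'. n - rg s' 2"])
    have "frame {2, 3, 4, 5, 6, 7, 8} {3, 4} s s1" by (rule frame_trans[OF fr1 frame_refl]) auto
    moreover have "s\<lparr>tp := rs\<rparr> = s" using rs by simp
    ultimately show "I (s1\<lparr>rg := (rg s1)(2 := 0), tm := tm s1 + 3\<rparr>)"
      using s1 by (auto simp: I_def order_array_def)
  next
    fix s' assume I: "I s'"
    define i where "i = rg s' 2"
    note I' = I[unfolded I_def, folded i_def]
    have fr: "frame {2, 3, 4, 5, 6, 7, 8} {3, 4} (s\<lparr>tp := drop i rs\<rparr>) s'" using I' by blast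
    have r: "rg s' 0 = n" "ar s' 0 = ar s 0" using frameD[OF fr] s by auto
    show "while_step n W I (\<lambda>s'. n - rg s' 2) (Var 2) (Var 0) split_round Q s'"
    proof (cases "i < n")
      case False
      then have "i = n" using I' by simp
      have "4 * n \<le> n * n" using n4 by (intro mult_right_mono) auto
      moreover have "200 * n * n = 200 * (n * n)" "n * (70 + 80 * n) = 70 * n + 80 * (n * n)"
        by (simp_all add: algebra_simps)
      ultimately have "12 + 20 * n + n * (70 + 80 * n) + 6 \<le> 30 + 200 * n * n" by linarith
      moreover have "tm s' \<le> tm s + 12 + 20 * n + n * (70 + 80 * n)" using I' \<open>i = n\<close> by simp
      ultimately have "tm s' + 6 \<le> tm s + 30 + 200 * n * n" by linarith
      then have "Q (after 6 s')"
        by (intro Q) (use I' \<open>i = n\<close> rs in auto)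
      then show ?thesis using False r by (simp add: i_def)
    next
      case True
      have tk: "take (Suc i) rs = take i rs @ [rs ! i]" using True rs by (simp add: take_Suc_conv_app_nth)
      have "wp n W split_round (\<lambda>s''. I s'' \<and> n - rg s'' 2 < n - rg s' 2) (after 6 s')"
      proof (rule wp_split_round[where r = "rs ! i" and rs = "drop (Suc i) rs"])
        show "tp (after 6 s') = rs ! i # drop (Suc i) rs"
          using frameD(3)[OF fr] True rs by (simp add: Cons_nth_drop_Suc)
        show "rs ! i < n" using True rs(2,3) nth_mem[of i rs] by blast
        show "adj_array n E (ar (after 6 s') 0)" using adj r by simp
        show "order_array n (foldl (split_by E) [0..<n] (take i rs)) (ar (after 6 s') 3)" using I' by simp
        show "set (foldl (split_by E) [0..<n] (take i rs)) \<subseteq> {..<n}"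
          using mset_eq_setD[OF mset_foldl_split_by[of E "[0..<n]" "take i rs"]] by auto
        fix s2 assume fr2: "frame {2, 3, 4, 5, 6, 7, 8} {3, 4} (s'\<lparr>tm := tm s' + 6, tp := drop (Suc i) rs\<rparr>) s2"
          and s2: "rg s2 2 = Suc (rg (after 6 s') 2)" "tm s2 \<le> tm (after 6 s') + 60 + 80 * n"
            "order_array n (split_by E (foldl (split_by E) [0..<n] (take i rs)) (rs ! i)) (ar s2 3)"
        have "frame {2, 3, 4, 5, 6, 7, 8} {3, 4} (s\<lparr>tp := drop (Suc i) rs\<rparr>) s2"
          using fr fr2 by (auto simp: frame_def)
        then show "I s2 \<and> n - rg s2 2 < n - rg s' 2"
          using s2 I' True by (auto simp: I_def tk i_def[symmetric])
      qed (use r True in \<open>auto simp: i_def\<close>)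
      then show ?thesis using True r by (simp add: i_def)
    qed
  qed
  then show "wp n W (Assign 2 (Num 0)) (wp n W (While (Var 2) (Var 0) split_round) Q) s1"
    by (simp add: wp_Assign small numeral_3_eq_3)
qed

end

section \<open>Correctness of the search\<close>

text \<open>The last clause makes the run maximal and assigns a boundary to every run except the one
  that reaches \<open>n\<close>.\<close>

definition run_end :: "nat \<Rightarrow> nat set set \<Rightarrow> nat list \<Rightarrow> nat \<Rightarrow> nat \<Rightarrow> nat \<Rightarrow> bool" where
  "run_end n E xs u p e \<longleftrightarrow> p < e \<and> e \<le> n \<and>
     (\<forall>q. p \<le> q \<and> q < e \<longrightarrow> ({u, xs ! q} \<in> E) = ({u, xs ! p} \<in> E)) \<and>
     (e < n \<longrightarrow> e - 1 \<in> boundaries E xs u)"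

definition run_array :: "nat \<Rightarrow> nat set set \<Rightarrow> nat list \<Rightarrow> (nat \<Rightarrow> nat) \<Rightarrow> bool" where
  "run_array n E xs A \<longleftrightarrow> (\<forall>u<n. \<forall>p<n. run_end n E xs u p (A (u * n + p)))"

lemma run_endD:
  assumes "run_end n E xs u p e"
  shows "p < e" "e \<le> n" "\<And>q. p \<le> q \<Longrightarrow> q < e \<Longrightarrow> ({u, xs ! q} \<in> E) = ({u, xs ! p} \<in> E)"
    "e < n \<Longrightarrow> e - 1 \<in> boundaries E xs u"
  using assms unfolding run_end_def by blast+

lemma run_end_same:
  assumes "run_end n E xs u (Suc p) e" "({u, xs ! p} \<in> E) = ({u, xs ! Suc p} \<in> E)"
  shows "run_end n E xs u p e"
  unfolding run_end_def
proof (intro conjI allI impI)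
  fix q assume q: "p \<le> q \<and> q < e"
  show "({u, xs ! q} \<in> E) = ({u, xs ! p} \<in> E)"
  proof (cases "q = p")
    case False
    then have "({u, xs ! q} \<in> E) = ({u, xs ! Suc p} \<in> E)"
      by (intro run_endD(3)[OF assms(1)]) (use q in auto)
    then show ?thesis using assms(2) by blast
  qed simp
qed (use run_endD(1,2,4)[OF assms(1)] in simp_all)

lemma run_end_change:
  assumes "length xs = n" "p < n" "Suc p < n \<Longrightarrow> ({u, xs ! p} \<in> E) \<noteq> ({u, xs ! Suc p} \<in> E)"
  shows "run_end n E xs u p (Suc p)"
  using assms by (auto simp: run_end_def boundaries_def less_Suc_eq)

context wide_words
begin

lemma order_array_nth: "order_array n xs A \<Longrightarrow> p < n \<Longrightarrow> A p = xs ! p"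
  by (auto simp: order_array_def)

lemma wp_run_row:
  assumes s: "rg s 0 = n" "rg s 9 = u" "u < n"
    and adj: "adj_array n E (ar s 0)" and ord: "order_array n xs (ar s 3)" and xs: "set xs \<subseteq> {..<n}"
    and Q: "\<And>s'. frame {7, 8, 9, 10, 11, 12, 31} {5} s s' \<Longrightarrow> rg s' 9 = Suc u \<Longrightarrow> tm s' \<le> tm s + 50 + 80 * n \<Longrightarrow>
      (\<And>v p. v < u \<Longrightarrow> p < n \<Longrightarrow> ar s' 5 (v * n + p) = ar s 5 (v * n + p)) \<Longrightarrow>
      (\<And>p. p < n \<Longrightarrow> run_end n E xs u p (ar s' 5 (u * n + p))) \<Longrightarrow> Q s'"
  shows "wp n W run_row Q s"
proof -
  have len: "length xs = n" using ord by (auto simp: order_array_def)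
  define I where "I = (\<lambda>s'. frame {7, 8, 9, 10, 11, 12, 31} {5} s s' \<and> rg s' 9 = u \<and> rg s' 8 = u * n \<and> rg s' 10 \<le> n \<and>
      tm s' \<le> tm s + 30 + 80 * (n - rg s' 10) \<and>
      (\<forall>v p. v < u \<longrightarrow> p < n \<longrightarrow> ar s' 5 (v * n + p) = ar s 5 (v * n + p)) \<and>
      (\<forall>p. rg s' 10 \<le> p \<longrightarrow> p < n \<longrightarrow> run_end n E xs u p (ar s' 5 (u * n + p))) \<and>
      (if rg s' 10 < n
       then rg s' 11 = ar s' 5 (u * n + rg s' 10) \<and> rg s' 12 = of_bool ({u, xs ! rg s' 10} \<in> E)
       else rg s' 11 = n))"
  have un: "u * n < n * n" using s n4 by simp
  have "wp n W (While (Num 0) (Var 10) run_step) (wp n W (incr 9) Q) s1"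
    if "I s1" for s1
  proof (rule wp_While[where I = I and \<mu> = "\<lambda>s'. rg s' 10"])
    fix s' assume I: "I s'"
    define p where "p = rg s' 10"
    note I' = I[unfolded I_def, folded p_def]
    have fr: "frame {7, 8, 9, 10, 11, 12, 31} {5} s s'" using I' by blast
    have r: "rg s' 0 = n" "ar s' 0 = ar s 0" "ar s' 3 = ar s 3" using frameD[OF fr] s by auto
    have p: "rg s' 10 = p" by (simp add: p_def)
    have r89: "rg s' 8 = u * n" "rg s' 9 = u" using I' by blast+
    show "while_step n W I (\<lambda>s'. rg s' 10) (Num 0) (Var 10) run_step (wp n W (incr 9) Q) s'"
    proof (cases "p = 0")
      case True
      have "Q (s'\<lparr>rg := (rg s')(9 := Suc u), tm := tm s' + 11\<rparr>)"
        by (rule Q) (use I' True in auto)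
      then show ?thesis using True p I' s by (simp add: wp_Assign incr_def small eval_nat_numeral)
    next
      case False
      then obtain p' where pp: "p = Suc p'" using not0_implies_Suc by blast
      have p'n: "p' < n" using I' pp by simp
      have o: "ar s 3 p' = xs ! p'" using order_array_nth[OF ord p'n] .
      have xn: "xs ! p' < n" using xs p'n len nth_mem[of p' xs] by blast
      have A: "ar s 0 (u * n + xs ! p') = of_bool ({u, xs ! p'} \<in> E)" using adj xn s by (simp add: adj_array_def)
      define e where "e = (if of_bool ({u, xs ! p'} \<in> E) = rg s' 12 then rg s' 11 else p)"
      have e: "run_end n E xs u p' e"
      proof (cases "p < n")
        case True
        then show ?thesis using I' run_end_same[of n E xs u p' "rg s' 11"] run_end_change[OF len p'n, of u E]
          by (auto simp: e_def pp split: if_splits)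
      next
        case False
        \<comment> \<open>At the last position, register 12 still has its initial value 0, which
          describes no vertex. Both outcomes of the comparison yield the end
          \<open>n\<close>.\<close>
        then have "p = n" using I' by simp
        then have "e = Suc p'" using I' pp by (auto simp: e_def)
        then show ?thesis using run_end_change[OF len p'n, of u E] \<open>p = n\<close> pp by simp
      qed
      have step: "I s2"
        if "frame {7, 8, 9, 10, 11, 12, 31} {5} s s2" "rg s2 9 = u" "rg s2 8 = u * n" "rg s2 10 = p'"
          "rg s2 11 = e" "rg s2 12 = of_bool ({u, xs ! p'} \<in> E)" "ar s2 5 = (ar s' 5)(u * n + p' := e)"
          "tm s2 \<le> tm s' + 80" for s2
      proof -
        have "n - p' = Suc (n - p)" using p'n pp by simp
        then have time: "80 * (n - p') = 80 * (n - p) + 80" by simp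
        show ?thesis
          unfolding I_def using that I' e p'n s time
          by (auto simp: p pp mat_index_eq le_Suc_eq Suc_le_eq fun_upd_apply)
      qed
      show ?thesis
        using fr mat_index_less[OF s(3) xn] mat_index_less[OF s(3) p'n] p'n xn
        by (simp add: run_step_def skip_def wp_simps small r r89 p pp o A step)
          (auto simp: e_def p pp r89 intro!: step split: if_splits)
    qed
  qed (rule that)
  note loop = this
  show ?thesis
    unfolding run_row_def using un s
    by (simp add: wp_Seq wp_Assign small, intro loop) (auto simp: I_def)
qed

lemma wp_run_phase:
  assumes s: "rg s 0 = n"
    and adj: "adj_array n E (ar s 0)" and ord: "order_array n xs (ar s 3)" and xs: "set xs \<subseteq> {..<n}"
    and Q: "\<And>s'. frame {7, 8, 9, 10, 11, 12, 31} {5} s s' \<Longrightarrow> tm s' \<le> tm s + 20 + 200 * (n * n) \<Longrightarrow>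
      run_array n E xs (ar s' 5) \<Longrightarrow> Q s'"
  shows "wp n W run_phase Q s"
proof -
  define I where "I = (\<lambda>s'. rg s' 9 \<le> n \<and> frame {7, 8, 9, 10, 11, 12, 31} {5} s s' \<and>
      tm s' \<le> tm s + 10 + rg s' 9 * (60 + 80 * n) \<and>
      (\<forall>u p. u < rg s' 9 \<longrightarrow> p < n \<longrightarrow> run_end n E xs u p (ar s' 5 (u * n + p))))"
  have "wp n W (While (Var 9) (Var 0) run_row) Q s1" if "I s1" for s1
  proof (rule wp_While[where I = I and \<mu> = "\<lambda>s'. n - rg s' 9"])
    fix s' assume I: "I s'"
    define i where "i = rg s' 9"
    note I' = I[unfolded I_def, folded i_def]
    have fr: "frame {7, 8, 9, 10, 11, 12, 31} {5} s s'" using I' by blast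
    have r: "rg s' 0 = n" "ar s' 0 = ar s 0" "ar s' 3 = ar s 3" using frameD[OF fr] s by auto
    show "while_step n W I (\<lambda>s'. n - rg s' 9) (Var 9) (Var 0) run_row Q s'"
    proof (cases "i < n")
      case False
      then have "i = n" using I' by simp
      have "4 * n \<le> n * n" using n4 by (intro mult_right_mono) auto
      moreover have "n * (60 + 80 * n) = 60 * n + 80 * (n * n)" by (simp add: algebra_simps)
      ultimately have "n * (60 + 80 * n) \<le> 200 * (n * n)" by linarith
      moreover have "tm s' \<le> tm s + 10 + n * (60 + 80 * n)" using I' \<open>i = n\<close> by simp
      ultimately have "tm s' + 6 \<le> tm s + 20 + 200 * (n * n)" by linarith
      then have "Q (after 6 s')"
        by (intro Q) (use I' \<open>i = n\<close> in \<open>auto simp: run_array_def\<close>)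
      then show ?thesis using False r by (simp add: i_def)
    next
      case True
      have "wp n W run_row (\<lambda>s''. I s'' \<and> n - rg s'' 9 < n - rg s' 9) (after 6 s')"
      proof (rule wp_run_row[of _ i E xs])
        fix s2 assume s2: "frame {7, 8, 9, 10, 11, 12, 31} {5} (after 6 s') s2" "rg s2 9 = Suc i"
          "tm s2 \<le> tm (after 6 s') + 50 + 80 * n"
          "\<And>v p. v < i \<Longrightarrow> p < n \<Longrightarrow> ar s2 5 (v * n + p) = ar (after 6 s') 5 (v * n + p)"
          "\<And>p. p < n \<Longrightarrow> run_end n E xs i p (ar s2 5 (i * n + p))"
        have "frame {7, 8, 9, 10, 11, 12, 31} {5} s s2"
          using fr s2(1) by (auto simp: frame_def)
        moreover have "run_end n E xs u p (ar s2 5 (u * n + p))" if "u < Suc i" "p < n" for u p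
          using that s2(4)[of u p] s2(5)[of p] I' by (cases "u = i") auto
        ultimately show "I s2 \<and> n - rg s2 9 < n - rg s' 9"
          using s2(2,3) I' True by (simp add: I_def i_def[symmetric])
      qed (use r True adj ord xs in \<open>auto simp: i_def\<close>)
      then show ?thesis using True r by (simp add: i_def)
    qed
  qed (rule that)
  then show ?thesis
    unfolding run_phase_def by (simp add: wp_Seq wp_Assign small I_def)
qed

section \<open>Initializing and maintaining the intervals of visited positions\<close>

lemma wp_fill:
  assumes s: "rg s 23 = f" "rg s 24 = t" "rg s 25 = w" "f \<le> t" "t \<le> Suc n"
    and Q: "\<And>s'. frame {23} {6} s s' \<Longrightarrow> tm s' \<le> tm s + 10 + 20 * (t - f) \<Longrightarrow>
      ar s' 6 = (\<lambda>p. if f \<le> p \<and> p < t then w else ar s 6 p) \<Longrightarrow> Q s'"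
  shows "wp n W fill Q s"
proof -
  define I where "I = (\<lambda>s'. frame {23} {6} s s' \<and> f \<le> rg s' 23 \<and> rg s' 23 \<le> t \<and>
      tm s' \<le> tm s + 20 * (rg s' 23 - f) \<and>
      ar s' 6 = (\<lambda>p. if f \<le> p \<and> p < rg s' 23 then w else ar s 6 p))"
  show ?thesis
    unfolding fill_def
  proof (rule wp_While[where I = I and \<mu> = "\<lambda>s'. t - rg s' 23"])
    show "I s" unfolding I_def using s by auto
  next
    fix s' assume I: "I s'"
    define i where "i = rg s' 23"
    note I' = I[unfolded I_def, folded i_def]
    have fr: "frame {23} {6} s s'" using I' by blast
    have r: "rg s' 24 = t" "rg s' 25 = w" using frameD[OF fr] s by auto
    have i: "rg s' 23 = i" by (simp add: i_def)
    show "while_step n W I (\<lambda>s'. t - rg s' 23) (Var 23) (Var 24) (Put 6 (Var 23) (Var 25) ;; incr 23) Q s'"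
    proof (cases "i < t")
      case False
      then have "i = t" using I' by simp
      have "Q (after 6 s')"
        by (rule Q) (use I' \<open>i = t\<close> in auto)
      then show ?thesis using False r by (simp add: i_def)
    next
      case True
      have "Suc i \<le> 2 * n" using True s n4 by simp
      moreover have "i \<le> n" using True s by simp
      moreover have "f \<le> i" using I' by simp
      then have "Suc i - f = Suc (i - f)" by simp
      ultimately show ?thesis
        using I' True by (auto simp: wp_simps incr_def small r i I_def fun_eq_iff)
    qed
  qed
qed

lemma wp_init_row:
  assumes s: "rg s 0 = n" "rg s 14 = v * n" "v < n"
    and Q: "\<And>s'. frame {4} {1, 2} s s' \<Longrightarrow> tm s' \<le> tm s + 10 + 50 * n \<Longrightarrow>
      (\<And>p. p < n \<Longrightarrow> ar s' 1 (v * n + p) = n \<and> ar s' 2 (v * n + p) = n) \<Longrightarrow>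
      (\<And>u p. u \<noteq> v \<Longrightarrow> p < n \<Longrightarrow> ar s' 1 (u * n + p) = ar s 1 (u * n + p) \<and> ar s' 2 (u * n + p) = ar s 2 (u * n + p)) \<Longrightarrow> Q s'"
  shows "wp n W init_row Q s"
proof -
  define I where "I = (\<lambda>s'. frame {4} {1, 2} s s' \<and> rg s' 4 \<le> n \<and> tm s' \<le> tm s + 3 + 50 * rg s' 4 \<and>
      (\<forall>p<rg s' 4. ar s' 1 (v * n + p) = n \<and> ar s' 2 (v * n + p) = n) \<and>
      (\<forall>u p. u \<noteq> v \<longrightarrow> p < n \<longrightarrow> ar s' 1 (u * n + p) = ar s 1 (u * n + p) \<and> ar s' 2 (u * n + p) = ar s 2 (u * n + p)))"
  let ?b = "Put 1 (Bin Add (Var 14) (Var 4)) (Var 0) ;; Put 2 (Bin Add (Var 14) (Var 4)) (Var 0) ;; incr 4"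
  have "wp n W (While (Var 4) (Var 0) ?b) Q s1" if "I s1" for s1
  proof (rule wp_While[where I = I and \<mu> = "\<lambda>s'. n - rg s' 4"])
    fix s' assume I: "I s'"
    define i where "i = rg s' 4"
    note I' = I[unfolded I_def, folded i_def]
    have fr: "frame {4} {1, 2} s s'" using I' by blast
    have r: "rg s' 0 = n" "rg s' 14 = v * n" using frameD[OF fr] s by auto
    have i: "rg s' 4 = i" by (simp add: i_def)
    show "while_step n W I (\<lambda>s'. n - rg s' 4) (Var 4) (Var 0) ?b Q s'"
    proof (cases "i < n")
      case False
      then have "i = n" using I' by simp
      have "Q (after 6 s')"
        by (rule Q) (use I' \<open>i = n\<close> in auto)
      then show ?thesis using False r by (simp add: i_def)
    next
      case True
      then show ?thesis
        using I' mat_index_less[OF s(3) True]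
        by (auto simp: wp_simps incr_def small r i I_def mat_index_eq less_Suc_eq)
    qed
  qed (rule that)
  then show ?thesis
    unfolding init_row_def by (simp add: wp_Seq wp_Assign small I_def)
qed

lemma wp_init_intervals:
  assumes s: "rg s 0 = n"
    and Q: "\<And>s'. frame {4} {6, 7, 8} s s' \<Longrightarrow> tm s' \<le> tm s + 100 + 50 * n \<Longrightarrow>
      skip_intervals n {..<n} (ar s' 6) (ar s' 7) (ar s' 8) \<Longrightarrow> Q s'"
  shows "wp n W init_intervals Q s"
proof -
  define I where "I = (\<lambda>s'. frame {4} {6, 7, 8} s s' \<and> rg s' 4 \<le> Suc n \<and> tm s' \<le> tm s + 3 + 50 * rg s' 4 \<and>
      (\<forall>p<rg s' 4. ar s' 6 p = p \<and> ar s' 7 p = p \<and> ar s' 8 p = p))"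
  let ?b = "Put 6 (Var 4) (Var 4) ;; Put 7 (Var 4) (Var 4) ;; Put 8 (Var 4) (Var 4) ;; incr 4"
  have "wp n W (While (Var 4) (Bin Add (Var 0) (Num 1)) ?b) Q s1" if "I s1" for s1
  proof (rule wp_While[where I = I and \<mu> = "\<lambda>s'. Suc n - rg s' 4"])
    fix s' assume I: "I s'"
    define i where "i = rg s' 4"
    note I' = I[unfolded I_def, folded i_def]
    have fr: "frame {4} {6, 7, 8} s s'" using I' by blast
    have r: "rg s' 0 = n" using frameD[OF fr] s by auto
    have i: "rg s' 4 = i" by (simp add: i_def)
    have W1: "Suc n < W" using n4 by (intro small_less_W) simp
    show "while_step n W I (\<lambda>s'. Suc n - rg s' 4) (Var 4) (Bin Add (Var 0) (Num 1)) ?b Q s'"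
    proof (cases "i < Suc n")
      case False
      then have "i = Suc n" using I' by simp
      have "skip_intervals n {..<n} (ar s' 6) (ar s' 7) (ar s' 8)"
        by (rule skip_intervals_id) (use I' \<open>i = Suc n\<close> in auto)
      then have "Q (after 8 s')"
        by (intro Q) (use I' \<open>i = Suc n\<close> in auto)
      then show ?thesis using False r W1 by (simp add: i_def small eval_nat_numeral)
    next
      case True
      have "Suc i < W" using True n4 by (intro small_less_W) simp
      then show ?thesis
        using I' True W1 by (auto simp: wp_simps incr_def small r i I_def less_Suc_eq)
    qed
  qed (rule that)
  then show ?thesis
    unfolding init_intervals_def by (simp add: wp_Seq wp_Assign small I_def)
qed

text \<open>Relabelling costs at most 20 per position, and each relabelled position raises the
  potential by at least one. Weighted by 200, the potential pays for it, so that only a constant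
  remains.\<close>

lemma wp_visit:
  assumes s: "rg s 0 = n" "rg s 7 = x" "rg s 9 = u" "rg s 14 = v * n" "v < n" "rg s 15 = k" "k < n" "rg s 16 = d"
    and ord: "order_array n xs (ar s 3)" and xs: "set xs \<subseteq> {..<n}"
    and inv: "skip_intervals n U (ar s 6) (ar s 7) (ar s 8)" and U: "U \<subseteq> {..<n}" and x: "x \<in> U"
    and Q: "\<And>s'. frame {15, 18, 19, 20, 21, 22, 23, 24, 25} {1, 2, 6, 7, 8, 9} s s' \<Longrightarrow> rg s' 15 = Suc k \<Longrightarrow>
      ar s' 1 = (ar s 1)(v * n + xs ! x := d) \<Longrightarrow> ar s' 2 = (ar s 2)(v * n + xs ! x := u) \<Longrightarrow>
      ar s' 9 = (ar s 9)(k := xs ! x) \<Longrightarrow>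
      skip_intervals n (U - {x}) (ar s' 6) (ar s' 7) (ar s' 8) \<Longrightarrow>
      tm s' + 200 * skip_potential n (ar s 6) (ar s 7) (ar s 8)
        \<le> tm s + 150 + 200 * skip_potential n (ar s' 6) (ar s' 7) (ar s' 8) \<Longrightarrow> Q s'"
  shows "wp n W visit Q s"
proof -
  have len: "length xs = n" using ord by (auto simp: order_array_def)
  have xn: "x < n" using U x by auto
  have y: "xs ! x < n" using xs xn len nth_mem[of x xs] by blast
  have o: "ar s 3 x = xs ! x" using order_array_nth[OF ord xn] .
  define a where "a = ar s 6 x"
  define b where "b = ar s 6 (Suc x)"
  define l where "l = ar s 7 a"
  define r where "r = ar s 8 b"
  obtain f t w where ft: "(f, t, w) = (if r - x < Suc x - l then (Suc x, Suc r, a) else (l, Suc x, b))"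
    by (metis prod_cases3)
  note R = skip_intervals_remove[OF inv U x a_def b_def l_def r_def ft refl refl refl]
  have rest: "wp n W relabel Q s1"
    if fr: "frame {15, 18, 19, 20, 21, 22, 23, 24, 25} {1, 2, 9} s s1"
      and s1: "rg s1 15 = Suc k" "rg s1 21 = l" "rg s1 22 = r" "rg s1 23 = f" "rg s1 24 = t" "rg s1 25 = w"
      "ar s1 1 = (ar s 1)(v * n + xs ! x := d)" "ar s1 2 = (ar s 2)(v * n + xs ! x := u)"
      "ar s1 9 = (ar s 9)(k := xs ! x)" "tm s1 \<le> tm s + 120" for s1
    unfolding relabel_def wp_Seq
  proof (rule wp_fill[OF s1(4-6) R(3,4)])
    fix s2 assume fr2: "frame {23} {6} s1 s2" and s2: "tm s2 \<le> tm s1 + 10 + 20 * (t - f)"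
      "ar s2 6 = (\<lambda>p. if f \<le> p \<and> p < t then w else ar s1 6 p)"
    have r2: "rg s2 25 = w" "rg s2 21 = l" "rg s2 22 = r" "ar s2 7 = ar s 7" "ar s2 8 = ar s 8" "ar s1 6 = ar s 6"
      "rg s2 15 = Suc k" "ar s2 1 = ar s1 1" "ar s2 2 = ar s1 2" "ar s2 9 = ar s1 9"
      using frameD[OF fr2] frameD[OF fr] s1 by auto
    have lab2: "ar s2 6 = (\<lambda>p. if f \<le> p \<and> p < t then w else ar s 6 p)" unfolding s2(2) r2(6) ..
    have Q': "Q s3" if s3: "rg s3 = rg s2" "ar s3 = (ar s2)(7 := (ar s 7)(w := l), 8 := (ar s 8)(w := r))"
      "tp s3 = tp s2" "tm s3 \<le> tm s2 + 20" for s3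
    proof (rule Q)
      show "frame {15, 18, 19, 20, 21, 22, 23, 24, 25} {1, 2, 6, 7, 8, 9} s s3"
        using fr fr2 s3 by (auto simp: frame_def)
      show "skip_intervals n (U - {x}) (ar s3 6) (ar s3 7) (ar s3 8)"
        using R(1) by (simp add: lab2 s3)
      show "tm s3 + 200 * skip_potential n (ar s 6) (ar s 7) (ar s 8)
          \<le> tm s + 150 + 200 * skip_potential n (ar s3 6) (ar s3 7) (ar s3 8)"
        using R(2) s2(1) s1(10) s3(4) by (simp add: lab2 s3(2))
    qed (use r2 s1 s3 in auto)
    have "w < n * n" using R(5) by (intro Suc_less_square) simp
    then show "wp n W (Put 7 (Var 25) (Var 21)) (wp n W (Put 8 (Var 25) (Var 22)) Q) s2"
      by (simp add: wp_Put r2 Q')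
  qed
  have Wr: "Suc r < W" "Suc x < W" "Suc k < W" "r - x < W" "Suc x - l < W" "Suc 0 < W"
    using R(4-8) xn s n4 by (auto intro!: small_less_W)
  have idx: "Suc x < n * n" "a < n * n" "b < n * n"
    using xn R by (auto intro!: Suc_less_square)
  have cases: "if r - x < Suc x - l then f = Suc x \<and> t = Suc r \<and> w = a else f = l \<and> t = Suc x \<and> w = b"
    using ft by (auto split: if_splits)
  have xy: "v * n + xs ! x < n * n" using mat_index_less[OF \<open>v < n\<close> y] .
  then have xyW: "v * n + xs ! x < W" using W by linarith
  have less: "k < n * n" "x < n * n" using \<open>k < n\<close> xn by (simp_all add: Suc_less_square)
  show ?thesis
    unfolding visit_def using cases
    by (cases "r - x < Suc x - l")
       (simp_all add: wp_simps incr_def s o xy xyW less Wr idx a_def[symmetric] b_def[symmetric]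
         l_def[symmetric] r_def[symmetric] rest)
qed

end

section \<open>The loops of a single search\<close>

text \<open>\<open>D\<close> and \<open>P\<close> are the two output arrays outside the row of the current source \<open>v\<close>.\<close>

definition search_state :: "nat \<Rightarrow> nat set set \<Rightarrow> nat list \<Rightarrow> nat \<Rightarrow> nat \<Rightarrow> nat list \<Rightarrow>
    (nat \<Rightarrow> nat) \<Rightarrow> (nat \<Rightarrow> nat) \<Rightarrow> state \<Rightarrow> bool" where
  "search_state n E xs v h q D P s \<longleftrightarrow>
     rg s 0 = n \<and> rg s 14 = v * n \<and> rg s 15 = length q \<and> rg s 17 = h \<and>
     adj_array n E (ar s 0) \<and> order_array n xs (ar s 3) \<and> run_array n E xs (ar s 5) \<and>
     (\<forall>i<length q. ar s 9 i = q ! i) \<and>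
     bfs_queue n E v h q (\<lambda>y. ar s 1 (v * n + y)) (\<lambda>y. ar s 2 (v * n + y)) \<and>
     skip_intervals n {p. p < n \<and> xs ! p \<notin> set q} (ar s 6) (ar s 7) (ar s 8) \<and>
     (\<forall>u y. u \<noteq> v \<longrightarrow> y < n \<longrightarrow> ar s 1 (u * n + y) = D (u * n + y) \<and> ar s 2 (u * n + y) = P (u * n + y))"

lemma search_stateD:
  assumes "search_state n E xs v h q D P s"
  shows "rg s 0 = n" "rg s 14 = v * n" "rg s 15 = length q" "rg s 17 = h"
    "adj_array n E (ar s 0)" "order_array n xs (ar s 3)" "run_array n E xs (ar s 5)"
    "\<And>i. i < length q \<Longrightarrow> ar s 9 i = q ! i"
    "bfs_queue n E v h q (\<lambda>y. ar s 1 (v * n + y)) (\<lambda>y. ar s 2 (v * n + y))"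
    "skip_intervals n {p. p < n \<and> xs ! p \<notin> set q} (ar s 6) (ar s 7) (ar s 8)"
    "\<And>u y. u \<noteq> v \<Longrightarrow> y < n \<Longrightarrow> ar s 1 (u * n + y) = D (u * n + y)"
    "\<And>u y. u \<noteq> v \<Longrightarrow> y < n \<Longrightarrow> ar s 2 (u * n + y) = P (u * n + y)"
  using assms unfolding search_state_def by blast+

lemma search_state_cong:
  assumes "search_state n E xs v h q D P s" "ar s' = ar s" "\<And>r. r \<in> {0, 14, 15, 17} \<Longrightarrow> rg s' r = rg s r"
  shows "search_state n E xs v h q D P s'"
  using assms by (simp add: search_state_def)

text \<open>Time that is paid for by relabelling and by entering vertices into the queue.\<close>

definition paid :: "nat \<Rightarrow> state \<Rightarrow> nat" where
  "paid n s = 200 * (skip_potential n (ar s 6) (ar s 7) (ar s 8) + rg s 15)"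

lemma paid_tm [simp]: "paid n (s\<lparr>tm := t\<rparr>) = paid n s" "r \<noteq> 15 \<Longrightarrow> paid n (s\<lparr>rg := (rg s)(r := x), tm := t\<rparr>) = paid n s"
  by (simp_all add: paid_def)

context wide_words
begin

text \<open>Each visit lengthens the queue, which adds 200 to \<open>paid\<close> besides the
  potential. This covers the 150 of \<open>visit\<close> together with the loop test and the next
  lookup; only the final test is left to the caller.\<close>

lemma wp_visit_loop:
  assumes st: "search_state n E xs v h q D P s" and h: "h < length q" and v: "v < n"
    and s: "rg s 9 = q ! h" "rg s 16 = Suc (ar s 1 (v * n + q ! h))" "rg s 10 = p" "p < n" "rg s 11 = e"
      "rg s 7 = ar s 8 (ar s 6 p)"
    and e: "run_end n E xs (q ! h) p e" and p: "{q ! h, xs ! p} \<in> E"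
    and xs: "set xs = {..<n}" "distinct xs"
    and Q: "\<And>s' q'. frame {7, 15, 18, 19, 20, 21, 22, 23, 24, 25} {1, 2, 6, 7, 8, 9} s s' \<Longrightarrow>
      search_state n E xs v h (q @ q') D P s' \<Longrightarrow> rg s' 16 = Suc (ar s' 1 (v * n + q ! h)) \<Longrightarrow>
      (\<And>i. p \<le> i \<Longrightarrow> i < e \<Longrightarrow> xs ! i \<in> set (q @ q')) \<Longrightarrow>
      tm s' + paid n s \<le> tm s + 10 + paid n s' \<Longrightarrow> Q s'"
  shows "wp n W visit_loop Q s"
proof -
  have lx: "length xs = n" using search_stateD(6)[OF st] by (auto simp: order_array_def)
  define I where "I = (\<lambda>s'. \<exists>q'. frame {7, 15, 18, 19, 20, 21, 22, 23, 24, 25} {1, 2, 6, 7, 8, 9} s s' \<and>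
      search_state n E xs v h (q @ q') D P s' \<and> rg s' 16 = Suc (ar s' 1 (v * n + q ! h)) \<and>
      rg s' 7 = ar s' 8 (ar s' 6 p) \<and> tm s' + paid n s \<le> tm s + paid n s')"
  show ?thesis
    unfolding visit_loop_def
  proof (rule wp_While[where I = I and \<mu> = "\<lambda>s'. n - rg s' 15"])
    show "I s" unfolding I_def using st s by (intro exI[of _ "[]"]) simp
  next
    fix s' assume "I s'"
    then obtain q' where fr: "frame {7, 15, 18, 19, 20, 21, 22, 23, 24, 25} {1, 2, 6, 7, 8, 9} s s'"
      and st': "search_state n E xs v h (q @ q') D P s'" and s16: "rg s' 16 = Suc (ar s' 1 (v * n + q ! h))"
      and s7: "rg s' 7 = ar s' 8 (ar s' 6 p)" and time: "tm s' + paid n s \<le> tm s + paid n s'"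
      unfolding I_def by blast
    note S = search_stateD[OF st']
    let ?U = "{p. p < n \<and> xs ! p \<notin> set (q @ q')}"
    have r: "rg s' 9 = q ! h" "rg s' 10 = p" "rg s' 11 = e" using frameD[OF fr] s by auto
    define x where "x = rg s' 7"
    note X = skip_intervalsD[OF S(10), of p, folded s7, folded x_def]
    have x: "p \<le> x" "x \<le> n" using X(3,4) s by simp_all
    show "while_step n W I (\<lambda>s'. n - rg s' 15) (Var 7) (Var 11) (visit ;; Assign 7 (Get 8 (Get 6 (Var 10)))) Q s'"
    proof (cases "x < e")
      case False
      \<comment> \<open>No position from \<open>p\<close> up to \<open>x\<close> is unvisited, and
        \<open>x\<close> lies beyond the run.\<close>
      have "xs ! i \<in> set (q @ q')" if "p \<le> i" "i < e" for i
        using X(7)[of i] that False s(4) run_endD(2)[OF e] by simp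
      then have "Q (after 6 s')"
        by (intro Q[where q' = q'] search_state_cong[OF st']) (use fr s16 time in simp_all)
      then show ?thesis using False r by (simp add: x_def)
    next
      case True
      have xn: "x < n" using True run_endD(2)[OF e] by simp
      \<comment> \<open>An interval ends at an unvisited position or at the sentinel
        \<open>n\<close>, and the latter is excluded by \<open>x < n\<close>.\<close>
      then have xU: "x \<in> ?U" using X(5) s(4) by simp
      have edge: "{(q @ q') ! h, xs ! x} \<in> E"
        using run_endD(3)[OF e x(1) True] p h by (simp add: nth_append)
      have y: "xs ! x < n" "xs ! x \<notin> set (q @ q')" using xU xs lx nth_mem[of x xs] by blast+
      have ql: "length (q @ q') < n" using bfs_queue_length_less[OF S(9) y] .
      have qh: "(q @ q') ! h = q ! h" using h by (simp add: nth_append)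
      have "q ! h \<in> set q" using h by simp
      then have "q ! h \<noteq> xs ! x" using y(2) by (metis UnCI set_append)
      have qhn: "q ! h < n" using bfs_queue_basic(2)[OF S(9)] \<open>q ! h \<in> set q\<close> by auto
      have "wp n W visit (wp n W (Assign 7 (Get 8 (Get 6 (Var 10)))) (\<lambda>s''. I s'' \<and> n - rg s'' 15 < n - rg s' 15))
          (after 6 s')"
      proof (rule wp_visit[where x = x and u = "q ! h" and v = v and k = "length (q @ q')" and
            d = "Suc (ar s' 1 (v * n + q ! h))" and xs = xs and U = ?U])
        fix s2 assume fr2: "frame {15, 18, 19, 20, 21, 22, 23, 24, 25} {1, 2, 6, 7, 8, 9} (after 6 s') s2"
          and s2: "rg s2 15 = Suc (length (q @ q'))"
            "ar s2 1 = (ar (after 6 s') 1)(v * n + xs ! x := Suc (ar s' 1 (v * n + q ! h)))"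
            "ar s2 2 = (ar (after 6 s') 2)(v * n + xs ! x := q ! h)"
            "ar s2 9 = (ar (after 6 s') 9)(length (q @ q') := xs ! x)"
          and sk2: "skip_intervals n (?U - {x}) (ar s2 6) (ar s2 7) (ar s2 8)"
          and t2: "tm s2 + 200 * skip_potential n (ar (after 6 s') 6) (ar (after 6 s') 7) (ar (after 6 s') 8)
            \<le> tm (after 6 s') + 150 + 200 * skip_potential n (ar s2 6) (ar s2 7) (ar s2 8)"
        have r2: "rg s2 0 = n" "rg s2 14 = v * n" "rg s2 17 = h" "rg s2 10 = p" "rg s2 16 = rg s' 16"
          "ar s2 0 = ar s' 0" "ar s2 3 = ar s' 3" "ar s2 5 = ar s' 5"
          using frameD[OF fr2] r S by auto
        have Ueq: "?U - {x} = {p. p < n \<and> xs ! p \<notin> set (q @ (q' @ [xs ! x]))}"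
          using xn lx xs(2) by (auto simp: nth_eq_iff_index_eq)
        have rows: "(\<lambda>y. ar s2 1 (v * n + y)) = (\<lambda>y. ar s' 1 (v * n + y))(xs ! x := Suc (ar s' 1 (v * n + q ! h)))"
          "(\<lambda>y. ar s2 2 (v * n + y)) = (\<lambda>y. ar s' 2 (v * n + y))(xs ! x := q ! h)"
          by (auto simp: s2 simp del: One_nat_def)
        have bq: "bfs_queue n E v h (q @ (q' @ [xs ! x])) (\<lambda>y. ar s2 1 (v * n + y)) (\<lambda>y. ar s2 2 (v * n + y))"
          unfolding rows using bfs_queue_visit[OF S(9) _ y edge] h by (simp add: qh)
        have st2: "search_state n E xs v h (q @ (q' @ [xs ! x])) D P s2"
          unfolding search_state_def
        proof (intro conjI allI impI)
          show "skip_intervals n {p. p < n \<and> xs ! p \<notin> set (q @ q' @ [xs ! x])} (ar s2 6) (ar s2 7) (ar s2 8)"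
            using sk2 unfolding Ueq .
          fix i assume "i < length (q @ q' @ [xs ! x])"
          then show "ar s2 9 i = (q @ q' @ [xs ! x]) ! i"
            using S(8)[of i] by (auto simp: s2 less_Suc_eq nth_append)
        next
          fix u z assume uz: "u \<noteq> v" "z < n"
          then have "u * n + z \<noteq> v * n + xs ! x" using mat_index_eq[OF uz(2) y(1)] by simp
          then show "ar s2 1 (u * n + z) = D (u * n + z)" "ar s2 2 (u * n + z) = P (u * n + z)"
            using S(11,12)[OF uz] by (simp_all add: s2 del: One_nat_def)
        qed (use bq r2 S s2 in simp_all)
        let ?s = "s2\<lparr>rg := (rg s2)(7 := ar s2 8 (ar s2 6 p)), tm := tm s2 + 12\<rparr>"
        have lab: "ar s2 6 p < n * n"
          using skip_intervalsD(1)[OF sk2, of p] s(4) by (intro Suc_less_square) simp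
        have "I ?s"
          unfolding I_def
        proof (intro exI[of _ "q' @ [xs ! x]"] conjI)
          show "frame {7, 15, 18, 19, 20, 21, 22, 23, 24, 25} {1, 2, 6, 7, 8, 9} s ?s"
            using fr fr2 by (auto simp: frame_def)
          show "search_state n E xs v h (q @ q' @ [xs ! x]) D P ?s"
            by (rule search_state_cong[OF st2]) auto
          show "tm ?s + paid n s \<le> tm s + paid n ?s"
            using time t2 s2(1) S(3) by (simp add: paid_def)
          have "ar s2 1 (v * n + q ! h) = ar s' 1 (v * n + q ! h)"
            using \<open>q ! h \<noteq> xs ! x\<close> mat_index_eq[OF qhn y(1), of v v] by (simp add: s2 del: One_nat_def)
          then show "rg ?s 16 = Suc (ar ?s 1 (v * n + q ! h))" using r2 s16 by simp
        qed simp
        then show "wp n W (Assign 7 (Get 8 (Get 6 (Var 10)))) (\<lambda>s''. I s'' \<and> n - rg s'' 15 < n - rg s' 15) s2"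
          using lab r2 s(4) ql by (simp add: wp_Assign Suc_less_square s2(1) S(3) add.commute)
      qed (use S r v ql s16 x_def xs xU in \<open>auto simp: qh\<close>)
      then show ?thesis using True r by (simp add: wp_Seq x_def)
    qed
  qed
qed

text \<open>Adjacency is constant on a run, so its first vertex decides for all of it, and a run of
  non-neighbors is skipped in constant time.\<close>

lemma wp_scan_run:
  assumes st: "search_state n E xs v h q D P s" and h: "h < length q" and v: "v < n"
    and s: "rg s 9 = q ! h" "rg s 16 = Suc (ar s 1 (v * n + q ! h))" "rg s 8 = q ! h * n" "rg s 10 = p" "p < n"
    and xs: "set xs = {..<n}" "distinct xs"
    and Q: "\<And>s' q' e. frame {7, 10, 11, 15, 18, 19, 20, 21, 22, 23, 24, 25, 31} {1, 2, 6, 7, 8, 9} s s' \<Longrightarrow>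
      search_state n E xs v h (q @ q') D P s' \<Longrightarrow> rg s' 16 = Suc (ar s' 1 (v * n + q ! h)) \<Longrightarrow>
      rg s' 10 = e \<Longrightarrow> run_end n E xs (q ! h) p e \<Longrightarrow>
      (\<And>i. p \<le> i \<Longrightarrow> i < e \<Longrightarrow> {q ! h, xs ! i} \<in> E \<Longrightarrow> xs ! i \<in> set (q @ q')) \<Longrightarrow>
      tm s' + paid n s \<le> tm s + 80 + paid n s' \<Longrightarrow> Q s'"
  shows "wp n W scan_run Q s"
proof -
  note S = search_stateD[OF st]
  have lx: "length xs = n" using S(6) by (auto simp: order_array_def)
  have "q ! h \<in> set q" using h by simp
  then have un: "q ! h < n" using bfs_queue_basic(2)[OF S(9)] by auto
  define e where "e = ar s 5 (q ! h * n + p)"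
  have e: "run_end n E xs (q ! h) p e" using S(7) un s(5) by (simp add: run_array_def e_def)
  have xp: "xs ! p < n" using xs lx s(5) nth_mem[of p xs] by blast
  have A: "ar s 0 (q ! h * n + xs ! p) = of_bool ({q ! h, xs ! p} \<in> E)"
    using S(5) un xp by (simp add: adj_array_def)
  have o: "ar s 3 p = xs ! p" using order_array_nth[OF S(6) s(5)] .
  have idx: "q ! h * n + p < n * n" "q ! h * n + xs ! p < n * n"
    using mat_index_less[OF un s(5)] mat_index_less[OF un xp] by auto
  then have idxW: "q ! h * n + p < W" "q ! h * n + xs ! p < W" using W by linarith+
  have small': "p < n * n" "ar s 6 p < n * n"
    using skip_intervalsD(1)[OF S(10), of p] s(5) by (simp_all add: Suc_less_square)
  have W0: "0 < W" using idxW by simp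
  show ?thesis
  proof (cases "{q ! h, xs ! p} \<in> E")
    case False
    have no: "xs ! i \<in> set (q @ [])" if "p \<le> i" "i < e" "{q ! h, xs ! i} \<in> E" for i
      using run_endD(3)[OF e that(1,2)] that(3) False by blast
    have Q': "Q s'" if "frame {7, 10, 11, 15, 18, 19, 20, 21, 22, 23, 24, 25, 31} {1, 2, 6, 7, 8, 9} s s'"
      "ar s' = ar s" "rg s' 10 = e" "rg s' 16 = rg s 16" "rg s' 0 = rg s 0" "rg s' 14 = rg s 14" "rg s' 15 = rg s 15"
      "rg s' 17 = rg s 17" "tm s' \<le> tm s + 80" for s'
    proof (rule Q[where q' = "[]" and e = e, OF that(1)])
      show "search_state n E xs v h (q @ []) D P s'"
        using search_state_cong[OF st that(2)] that(5-8) by auto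
    qed (use that s e no in \<open>simp_all add: paid_def\<close>)
    show ?thesis
      unfolding scan_run_def
      by (simp add: wp_simps skip_def S(1) s idx idxW small' A o e_def[symmetric] False Q' W0)
  next
    case True
    have loop: "wp n W visit_loop (wp n W (Assign 10 (Var 11)) Q) s1"
      if fr: "frame {7, 11} {} s s1" and s1: "ar s1 = ar s" "rg s1 11 = e" "rg s1 7 = ar s 8 (ar s 6 p)"
        "tm s1 \<le> tm s + 50" for s1
    proof (rule wp_visit_loop[where q = q and h = h and p = p and e = e])
      have r: "rg s1 0 = n" "rg s1 14 = v * n" "rg s1 15 = rg s 15" "rg s1 17 = rg s 17" "rg s1 9 = q ! h" "rg s1 10 = p"
        "rg s1 16 = rg s 16"
        using frameD[OF fr] S s by auto
      show "search_state n E xs v h q D P s1"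
        by (rule search_state_cong[OF st s1(1)]) (use frameD[OF fr] in auto)
      show "rg s1 9 = q ! h" "rg s1 16 = Suc (ar s1 1 (v * n + q ! h))" "rg s1 10 = p" "rg s1 11 = e"
        "rg s1 7 = ar s1 8 (ar s1 6 p)"
        using r s s1 by simp_all
      fix s2 q' assume fr2: "frame {7, 15, 18, 19, 20, 21, 22, 23, 24, 25} {1, 2, 6, 7, 8, 9} s1 s2"
        and st2: "search_state n E xs v h (q @ q') D P s2" and s2: "rg s2 16 = Suc (ar s2 1 (v * n + q ! h))"
        and all: "\<And>i. p \<le> i \<Longrightarrow> i < e \<Longrightarrow> xs ! i \<in> set (q @ q')"
        and t2: "tm s2 + paid n s1 \<le> tm s1 + 10 + paid n s2"
      have 11: "rg s2 11 = e" using frameD[OF fr2] s1 by simp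
      have "Q (s2\<lparr>rg := (rg s2)(10 := e), tm := tm s2 + 4\<rparr>)"
      proof (rule Q[where q' = q' and e = e, OF _ _ _ _ e])
        show "frame {7, 10, 11, 15, 18, 19, 20, 21, 22, 23, 24, 25, 31} {1, 2, 6, 7, 8, 9} s (s2\<lparr>rg := (rg s2)(10 := e), tm := tm s2 + 4\<rparr>)"
          using fr fr2 by (auto simp: frame_def)
        show "search_state n E xs v h (q @ q') D P (s2\<lparr>rg := (rg s2)(10 := e), tm := tm s2 + 4\<rparr>)"
          by (rule search_state_cong[OF st2]) auto
        have "paid n s1 = paid n s" using s1 r by (simp add: paid_def)
        then show "tm (s2\<lparr>rg := (rg s2)(10 := e), tm := tm s2 + 4\<rparr>) + paid n s
          \<le> tm s + 80 + paid n (s2\<lparr>rg := (rg s2)(10 := e), tm := tm s2 + 4\<rparr>)"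
          using t2 s1(4) by (simp add: paid_def)
      qed (use s2 all in auto)
      then show "wp n W (Assign 10 (Var 11)) Q s2" by (simp add: wp_Assign 11 add.commute)
    qed (use h v s e True xs in auto)
    show ?thesis
      unfolding scan_run_def
      by (simp add: wp_simps S(1) s idx idxW small' A o e_def[symmetric] True W0 loop)
  qed
qed

lemma finite_boundaries: "finite (boundaries E xs u)"
  by (rule finite_subset[of _ "{..<length xs}"]) (auto simp: boundaries_def)

text \<open>A run that ends before \<open>n\<close> passes the boundary \<open>e - 1\<close>; the
  last run is counted by the extra term instead.\<close>

lemma card_boundaries_step:
  assumes e: "run_end n E xs u p e" and len: "length xs = n"
  shows "card {i \<in> boundaries E xs u. i < p} + 1 \<le> card {i \<in> boundaries E xs u. i < e} + of_bool (e = n)"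
proof -
  have fin: "finite (boundaries E xs u)" by (rule finite_boundaries)
  have pe: "p < e" "e \<le> n" using run_endD[OF e] by auto
  show ?thesis
  proof (cases "e = n")
    case True
    then show ?thesis using fin pe by (auto intro!: card_mono)
  next
    case False
    then have "e - 1 \<in> boundaries E xs u" using run_endD(4)[OF e] pe by simp
    then have "insert (e - 1) {i \<in> boundaries E xs u. i < p} \<subseteq> {i \<in> boundaries E xs u. i < e}"
      using pe by auto
    then have "card (insert (e - 1) {i \<in> boundaries E xs u. i < p}) \<le> card {i \<in> boundaries E xs u. i < e}"
      using fin by (intro card_mono) auto
    moreover have "p \<le> e - 1" using pe by simp
    ultimately show ?thesis using fin by (simp add: not_less)
  qed
qed

lemma wp_process_vertex:
  assumes st: "search_state n E xs v h q D P s" and h: "h < length q" and v: "v < n"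
    and xs: "set xs = {..<n}" "distinct xs"
    and Q: "\<And>s' q'. frame {7, 8, 9, 10, 11, 15, 16, 17, 18, 19, 20, 21, 22, 23, 24, 25, 31} {1, 2, 6, 7, 8, 9} s s' \<Longrightarrow>
      search_state n E xs v (Suc h) (q @ q') D P s' \<Longrightarrow>
      tm s' + paid n s \<le> tm s + 200 + 100 * card (boundaries E xs (q ! h)) + paid n s' \<Longrightarrow> Q s'"
  shows "wp n W process_vertex Q s"
proof -
  let ?R = "{7, 8, 9, 10, 11, 15, 16, 18, 19, 20, 21, 22, 23, 24, 25, 31} :: nat set"
  let ?K = "{1, 2, 6, 7, 8, 9} :: nat set"
  let ?u = "q ! h"
  note S = search_stateD[OF st]
  have lx: "length xs = n" using S(6) by (auto simp: order_array_def)
  have "q ! h \<in> set q" using h by simp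
  then have un: "?u < n" using bfs_queue_basic(2)[OF S(9)] by auto
  have hn: "h < n" using h bfs_queue_length[OF S(9)] by simp
  \<comment> \<open>Bounds the number of runs scanned when position \<open>p\<close> is
    reached.\<close>
  define c where "c = (\<lambda>p. card {i \<in> boundaries E xs ?u. i < p} + of_bool (p = n))"
  define I where "I = (\<lambda>s'. \<exists>q'. frame ?R ?K s s' \<and> search_state n E xs v h (q @ q') D P s' \<and>
      rg s' 9 = ?u \<and> rg s' 16 = Suc (ar s' 1 (v * n + ?u)) \<and> rg s' 8 = ?u * n \<and> rg s' 10 \<le> n \<and>
      (\<forall>i<rg s' 10. {?u, xs ! i} \<in> E \<longrightarrow> xs ! i \<in> set (q @ q')) \<and>
      tm s' + paid n s \<le> tm s + 50 + 90 * c (rg s' 10) + paid n s')"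
  have loop: "wp n W (While (Var 10) (Var 0) scan_run) (wp n W (incr 17) Q) s1" if "I s1" for s1
  proof (rule wp_While[where I = I and \<mu> = "\<lambda>s'. n - rg s' 10"])
    fix s' assume "I s'"
    then obtain q' where fr: "frame ?R ?K s s'" and st': "search_state n E xs v h (q @ q') D P s'"
      and s': "rg s' 9 = ?u" "rg s' 16 = Suc (ar s' 1 (v * n + ?u))" "rg s' 8 = ?u * n"
      and pn: "rg s' 10 \<le> n" and all: "\<And>i. i < rg s' 10 \<Longrightarrow> {?u, xs ! i} \<in> E \<Longrightarrow> xs ! i \<in> set (q @ q')"
      and time: "tm s' + paid n s \<le> tm s + 50 + 90 * c (rg s' 10) + paid n s'"
      unfolding I_def by blast
    define p where "p = rg s' 10"
    note S' = search_stateD[OF st']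
    have qh: "(q @ q') ! h = ?u" "h < length (q @ q')" using h by (simp_all add: nth_append)
    show "while_step n W I (\<lambda>s'. n - rg s' 10) (Var 10) (Var 0) scan_run (wp n W (incr 17) Q) s'"
    proof (cases "p < n")
      case False
      then have "p = n" using pn p_def by simp
      have "card {i \<in> boundaries E xs ?u. i < n} \<le> card (boundaries E xs ?u)"
        using finite_boundaries by (rule card_mono) auto
      then have cn: "c n \<le> card (boundaries E xs ?u) + 1" by (simp add: c_def)
      have adv: "bfs_queue n E v (Suc h) (q @ q') (\<lambda>y. ar s' 1 (v * n + y)) (\<lambda>y. ar s' 2 (v * n + y))"
      proof (rule bfs_queue_advance[OF S'(9) qh(2)])
        fix w assume w: "w < n" "{(q @ q') ! h, w} \<in> E"
        then obtain i where "i < n" "w = xs ! i" using xs lx by (metis in_set_conv_nth lessThan_iff)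
        then show "w \<in> set (q @ q')" using all[of i] w \<open>p = n\<close> p_def qh by simp
      qed
      have Q': "Q s2" if s2: "frame {17} {} s' s2" "ar s2 = ar s'" "rg s2 17 = Suc h" "tm s2 \<le> tm s' + 20" for s2
      proof (rule Q[where q' = q'])
        show "frame {7, 8, 9, 10, 11, 15, 16, 17, 18, 19, 20, 21, 22, 23, 24, 25, 31} ?K s s2"
          using fr s2(1) by (auto simp: frame_def)
        have r2: "rg s2 0 = n" "rg s2 14 = v * n" "rg s2 15 = length (q @ q')"
          using frameD[OF s2(1)] S' by auto
        show "search_state n E xs v (Suc h) (q @ q') D P s2"
          using st' adv r2 s2 unfolding search_state_def by simp
        show "tm s2 + paid n s \<le> tm s + 200 + 100 * card (boundaries E xs ?u) + paid n s2"
          using time s2(4) cn \<open>p = n\<close> p_def r2 S'(3) by (simp add: paid_def s2(2))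
      qed
      have "Suc h < W" "Suc 0 < W" using hn n4 by (auto intro!: small_less_W)
      then show ?thesis using False S'
        by (simp add: p_def wp_Assign incr_def Q' del: One_nat_def)
    next
      case True
      have "wp n W scan_run (\<lambda>s''. I s'' \<and> n - rg s'' 10 < n - rg s' 10) (after 6 s')"
      proof (rule wp_scan_run[OF search_state_cong[OF st'] qh(2) v, where p = p])
        fix s2 q2 e assume fr2: "frame {7, 10, 11, 15, 18, 19, 20, 21, 22, 23, 24, 25, 31} ?K (after 6 s') s2"
          and st2: "search_state n E xs v h ((q @ q') @ q2) D P s2"
          and s2: "rg s2 16 = Suc (ar s2 1 (v * n + (q @ q') ! h))" "rg s2 10 = e"
          and e: "run_end n E xs ((q @ q') ! h) p e"
          and all2: "\<And>i. p \<le> i \<Longrightarrow> i < e \<Longrightarrow> {(q @ q') ! h, xs ! i} \<in> E \<Longrightarrow> xs ! i \<in> set ((q @ q') @ q2)"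
          and t2: "tm s2 + paid n (after 6 s') \<le> tm (after 6 s') + 80 + paid n s2"
        note e' = e[unfolded qh(1)]
        have pe: "p < e" "e \<le> n" using run_endD[OF e'] by auto
        have "c p + 1 \<le> c e" using card_boundaries_step[OF e' lx] True by (simp add: c_def)
        then have "90 * c p + 90 \<le> 90 * c e" by linarith
        then have "tm s2 + paid n s \<le> tm s + 50 + 90 * c e + paid n s2"
          using time t2 by (simp add: p_def)
        moreover have "frame ?R ?K s s2" using fr fr2 by (auto simp: frame_def)
        moreover have "xs ! i \<in> set (q @ (q' @ q2))" if "i < e" "{?u, xs ! i} \<in> E" for i
          using all[of i] all2[of i] that qh(1) by (cases "i < p") (auto simp: p_def)
        moreover have "rg s2 9 = ?u" "rg s2 8 = ?u * n" using frameD[OF fr2] s' by simp_all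
        ultimately have "I s2"
          unfolding I_def using st2 s2 qh(1) pe by (intro exI[of _ "q' @ q2"]) simp
        then show "I s2 \<and> n - rg s2 10 < n - rg s' 10" using pe s2(2) True by (simp add: p_def)
      qed (use s' qh True xs in \<open>auto simp: p_def\<close>)
      then show ?thesis using True S'(1) by (simp add: p_def)
    qed
  qed (rule that)
  have init: "I s1" if "frame ?R {} s s1" "ar s1 = ar s" "rg s1 9 = ?u" "rg s1 8 = ?u * n"
      "rg s1 16 = Suc (ar s 1 (v * n + ?u))" "rg s1 10 = 0" "rg s1 15 = rg s 15" "tm s1 \<le> tm s + 50" for s1
    unfolding I_def
  proof (intro exI[of _ "[]"] conjI)
    show "frame ?R ?K s s1" using that(1) by (auto simp: frame_def)
    show "search_state n E xs v h (q @ []) D P s1"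
      unfolding append_Nil2
      by (rule search_state_cong[OF st that(2)]) (use frameD(1)[OF that(1)] that(7) in auto)
  qed (use that in \<open>simp_all add: paid_def\<close>)
  \<comment> \<open>Depths are bounded by positions in the queue; the invariant records this so that
    the depth plus one is known to fit into a word.\<close>
  have d: "ar s 1 (v * n + ?u) \<le> h"
    using S(9) h unfolding bfs_queue_def by blast
  then have dW: "Suc (ar s 1 (v * n + ?u)) < W" "Suc 0 < W" "0 < W" using hn n4 by (auto intro!: small_less_W)
  have idx: "v * n + ?u < n * n" "?u * n < n * n" using mat_index_less[OF v un] un n4 by simp_all
  then have idxW: "v * n + ?u < W" "?u * n < W" using W by linarith+
  show ?thesis
    unfolding process_vertex_def
    using S(8)[OF h] dW
    by (simp add: wp_Seq wp_Assign S(1-4) Suc_less_square hn idx idxW less_imp_le loop init del: One_nat_def)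
qed

section \<open>Complete searches from all sources\<close>

definition finished_row :: "nat set set \<Rightarrow> nat \<Rightarrow> state \<Rightarrow> bool" where
  "finished_row E v s \<longleftrightarrow>
     (\<exists>q. bfs_queue n E v (length q) q (\<lambda>y. ar s 1 (v * n + y)) (\<lambda>y. ar s 2 (v * n + y)))"

text \<open>Initialization, entering and dequeuing vertices give the linear part, all relabellings
  of one search the logarithmic part, and the scanned runs the sum.\<close>

definition search_bound :: "nat set set \<Rightarrow> nat list \<Rightarrow> nat" where
  "search_bound E xs = 1000 + 1000 * n + 200 * ((n + 1) * floorlog 2 (n + 1)) + 100 * (\<Sum>u<n. card (boundaries E xs u))"

lemma wp_bfs_from:
  assumes s: "rg s 0 = n" "rg s 13 = j" "j < n"
    and adj: "adj_array n E (ar s 0)" and ord: "order_array n xs (ar s 3)" and run: "run_array n E xs (ar s 5)"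
    and xs: "set xs = {..<n}" "distinct xs"
    and Q: "\<And>s'. frame ({4} \<union> {7..25} \<union> {31}) {1, 2, 6, 7, 8, 9} s s' \<Longrightarrow> rg s' 13 = Suc j \<Longrightarrow>
      finished_row E (xs ! j) s' \<Longrightarrow>
      (\<And>u y. u \<noteq> xs ! j \<Longrightarrow> y < n \<Longrightarrow> ar s' 1 (u * n + y) = ar s 1 (u * n + y) \<and> ar s' 2 (u * n + y) = ar s 2 (u * n + y)) \<Longrightarrow>
      tm s' \<le> tm s + search_bound E xs \<Longrightarrow> Q s'"
  shows "wp n W bfs_from Q s"
proof -
  define v where "v = xs ! j"
  let ?R = "{4} \<union> {7..12} \<union> {14..25} \<union> {31} :: nat set"
  let ?K = "{1, 2, 6, 7, 8, 9} :: nat set"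
  let ?V = "wp n W (Assign 17 (Num 0)) (wp n W (While (Var 17) (Var 15) process_vertex) (wp n W (incr 13) Q))"
  let ?A = "wp n W (Assign 15 (Num 0)) (wp n W (Assign 16 (Num 0)) (wp n W (Assign 9 (Var 0))
    (wp n W (Assign 7 (Var 13)) (wp n W visit ?V))))"
  let ?c = "\<lambda>u. card (boundaries E xs u)"
  have lx: "length xs = n" using ord by (auto simp: order_array_def)
  have v: "v < n" using xs lx s(3) nth_mem[of j xs] by (auto simp: v_def)
  have o: "ar s 3 j = v" using order_array_nth[OF ord s(3)] by (simp add: v_def)
  define I where "I = (\<lambda>s'. \<exists>q h. frame ?R ?K s s' \<and> search_state n E xs v h q (ar s 1) (ar s 2) s' \<and>
      tm s' \<le> tm s + 500 + 110 * n + paid n s' + (\<Sum>i<h. 210 + 100 * ?c (q ! i)))"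
  have loop: "wp n W (While (Var 17) (Var 15) process_vertex) (wp n W (incr 13) Q) s1" if "I s1" for s1
  proof (rule wp_While[where I = I and \<mu> = "\<lambda>s'. n - rg s' 17"])
    fix s' assume "I s'"
    then obtain q h where fr: "frame ?R ?K s s'" and st: "search_state n E xs v h q (ar s 1) (ar s 2) s'"
      and time: "tm s' \<le> tm s + 500 + 110 * n + paid n s' + (\<Sum>i<h. 210 + 100 * ?c (q ! i))"
      unfolding I_def by blast
    note S = search_stateD[OF st]
    have qn: "length q \<le> n" by (rule bfs_queue_length[OF S(9)])
    have hq: "h \<le> length q" by (rule bfs_queue_basic(4)[OF S(9)])
    have r13: "rg s' 13 = j" using frameD[OF fr] s by simp
    show "while_step n W I (\<lambda>s'. n - rg s' 17) (Var 17) (Var 15) process_vertex (wp n W (incr 13) Q) s'"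
    proof (cases "h < length q")
      case False
      then have "h = length q" using hq by simp
      have "(\<Sum>i<h. 210 + 100 * ?c (q ! i)) = 210 * h + 100 * (\<Sum>i<h. ?c (q ! i))"
        by (simp add: sum.distrib sum_distrib_left)
      \<comment> \<open>The queue has no repetitions, so every vertex is charged for its runs at
        most once.\<close>
      also have "(\<Sum>i<h. ?c (q ! i)) = sum ?c (set q)"
      proof -
        have "bij_betw ((!) q) {..<h} (set q)"
          using bij_betw_nth[OF bfs_queue_basic(1)[OF S(9)] refl refl] \<open>h = length q\<close> by simp
        then show ?thesis by (rule sum.reindex_bij_betw)
      qed
      also have "sum ?c (set q) \<le> (\<Sum>u<n. ?c u)"
        using bfs_queue_basic(2)[OF S(9)] by (intro sum_mono2) auto
      finally have sum: "(\<Sum>i<h. 210 + 100 * ?c (q ! i)) \<le> 210 * n + 100 * (\<Sum>u<n. ?c u)"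
        using \<open>h = length q\<close> qn by simp
      have "paid n s' \<le> 200 * ((n + 1) * floorlog 2 (n + 1)) + 200 * n"
        using skip_potential_le[OF S(10)] qn S(3) by (simp add: paid_def)
      then have total: "tm s' + 20 \<le> tm s + search_bound E xs"
        using time sum unfolding search_bound_def by linarith
      have Q': "Q s2" if s2: "frame {13} {} s' s2" "ar s2 = ar s'" "rg s2 13 = Suc j" "tm s2 \<le> tm s' + 20" for s2
      proof (rule Q)
        show "frame ({4} \<union> {7..25} \<union> {31}) ?K s s2"
          using fr s2(1) unfolding frame_def by auto
        show "finished_row E (xs ! j) s2"
          using S(9) \<open>h = length q\<close> unfolding finished_row_def v_def s2(2) by blast
        show "tm s2 \<le> tm s + search_bound E xs" using total s2(4) by linarith
        fix u y assume uy: "u \<noteq> xs ! j" "y < n"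
        show "ar s2 1 (u * n + y) = ar s 1 (u * n + y) \<and> ar s2 2 (u * n + y) = ar s 2 (u * n + y)"
          unfolding s2(2) using S(11,12)[of u y] uy by (simp add: v_def)
      qed (rule s2(3))
      have "Suc j < W" "Suc 0 < W" using s(3) n4 by (auto intro!: small_less_W)
      then show ?thesis using False S r13
        by (simp add: wp_Assign incr_def Q' del: One_nat_def)
    next
      case True
      have "wp n W process_vertex (\<lambda>s''. I s'' \<and> n - rg s'' 17 < n - rg s' 17) (after 6 s')"
      proof (rule wp_process_vertex[OF search_state_cong[OF st] True v xs])
        fix s2 q' assume fr2: "frame {7, 8, 9, 10, 11, 15, 16, 17, 18, 19, 20, 21, 22, 23, 24, 25, 31} ?K (after 6 s') s2"
          and st2: "search_state n E xs v (Suc h) (q @ q') (ar s 1) (ar s 2) s2"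
          and t2: "tm s2 + paid n (after 6 s') \<le> tm (after 6 s') + 200 + 100 * ?c (q ! h) + paid n s2"
        have "(\<Sum>i<h. 210 + 100 * ?c ((q @ q') ! i)) = (\<Sum>i<h. 210 + 100 * ?c (q ! i))"
          using True by (intro sum.cong) (auto simp: nth_append)
        then have "(\<Sum>i<Suc h. 210 + 100 * ?c ((q @ q') ! i)) = (\<Sum>i<h. 210 + 100 * ?c (q ! i)) + (210 + 100 * ?c (q ! h))"
          using True by (simp add: nth_append)
        then have "tm s2 \<le> tm s + 500 + 110 * n + paid n s2 + (\<Sum>i<Suc h. 210 + 100 * ?c ((q @ q') ! i))"
          using time t2 by simp
        moreover have "frame ?R ?K s s2" using fr fr2 unfolding frame_def by auto
        ultimately have "I s2" unfolding I_def using st2 by blast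
        then show "I s2 \<and> n - rg s2 17 < n - rg s' 17"
          using S(4) search_stateD(4)[OF st2] True qn by simp
      qed auto
      then show ?thesis using True S(3,4) by simp
    qed
  qed (rule that)
  have vn: "v * n < n * n" using v n4 by simp
  then have vnW: "v * n < W" using W by linarith
  have W0: "0 < W" "Suc 0 < W" using vnW n4 by (auto intro!: small_less_W)
  have visited: "wp n W visit ?V s3"
    if fr: "frame {4, 7, 9, 14, 15, 16} {1, 2, 6, 7, 8} s s3"
      and s3: "rg s3 14 = v * n" "rg s3 15 = 0" "rg s3 16 = 0" "rg s3 9 = n" "rg s3 7 = j"
      and sk: "skip_intervals n {..<n} (ar s3 6) (ar s3 7) (ar s3 8)"
      and row: "\<And>y. y < n \<Longrightarrow> ar s3 1 (v * n + y) = n \<and> ar s3 2 (v * n + y) = n"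
      and rows: "\<And>u y. u \<noteq> v \<Longrightarrow> y < n \<Longrightarrow> ar s3 1 (u * n + y) = ar s 1 (u * n + y) \<and> ar s3 2 (u * n + y) = ar s 2 (u * n + y)"
      and t3: "tm s3 \<le> tm s + 200 + 110 * n" for s3
  proof (rule wp_visit[where x = j and u = n and v = v and k = 0 and d = 0 and xs = xs and U = "{..<n}"])
    fix s4 assume fr4: "frame {15, 18, 19, 20, 21, 22, 23, 24, 25} ?K s3 s4" and s4: "rg s4 15 = Suc 0"
      "ar s4 1 = (ar s3 1)(v * n + xs ! j := 0)" "ar s4 2 = (ar s3 2)(v * n + xs ! j := n)" "ar s4 9 = (ar s3 9)(0 := xs ! j)"
      and sk4: "skip_intervals n ({..<n} - {j}) (ar s4 6) (ar s4 7) (ar s4 8)"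
      and t4: "tm s4 + 200 * skip_potential n (ar s3 6) (ar s3 7) (ar s3 8) \<le> tm s3 + 150 + 200 * skip_potential n (ar s4 6) (ar s4 7) (ar s4 8)"
    note s4' = s4[folded v_def]
    have r4: "rg s4 0 = n" "rg s4 14 = v * n" "ar s4 0 = ar s 0" "ar s4 3 = ar s 3" "ar s4 5 = ar s 5"
      using frameD[OF fr4] frameD[OF fr] s s3 by auto
    have Ueq: "{..<n} - {j} = {p. p < n \<and> xs ! p \<notin> set [v]}"
      using s(3) lx xs(2) by (auto simp: nth_eq_iff_index_eq v_def)
    let ?s = "s4\<lparr>rg := (rg s4)(17 := 0), tm := tm s4 + 3\<rparr>"
    have "bfs_queue n E v 0 [v] (\<lambda>y. ar s4 1 (v * n + y)) (\<lambda>y. ar s4 2 (v * n + y))"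
      using v row by (intro bfs_queue_init) (simp_all add: s4' del: One_nat_def)
    moreover have "ar s4 1 (u * n + y) = ar s 1 (u * n + y) \<and> ar s4 2 (u * n + y) = ar s 2 (u * n + y)"
      if "u \<noteq> v" "y < n" for u y
      using rows[OF that] mat_index_eq[OF that(2) v] that(1) by (simp add: s4' del: One_nat_def)
    ultimately have "search_state n E xs v 0 [v] (ar s 1) (ar s 2) ?s"
      using r4 s4' sk4[unfolded Ueq] adj ord run unfolding search_state_def by simp
    moreover have "frame ?R ?K s ?s" using fr fr4 unfolding frame_def by auto
    moreover have "tm ?s \<le> tm s + 500 + 110 * n + paid n ?s"
      using t3 t4 by (simp add: paid_def)
    ultimately have "I ?s" unfolding I_def by (intro exI[of _ "[v]"] exI[of _ 0]) simp
    from loop[OF this] show "?V s4"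
      using W0 by (simp add: wp_Assign numeral_3_eq_3)
  qed (use s s3 sk v ord xs frameD[OF fr] in auto)
  have init: "wp n W init_row (wp n W init_intervals ?A) s1"
    if fr1: "frame {14} {} s s1" and s1: "rg s1 14 = v * n" "tm s1 \<le> tm s + 20" for s1
  proof (rule wp_init_row[OF _ s1(1) v])
    show "rg s1 0 = n" using frameD[OF fr1] s by simp
    fix s2 assume fr2: "frame {4} {1, 2} s1 s2" and t2: "tm s2 \<le> tm s1 + 10 + 50 * n"
      and row: "\<And>p. p < n \<Longrightarrow> ar s2 1 (v * n + p) = n \<and> ar s2 2 (v * n + p) = n"
      and rows: "\<And>u p. u \<noteq> v \<Longrightarrow> p < n \<Longrightarrow> ar s2 1 (u * n + p) = ar s1 1 (u * n + p) \<and> ar s2 2 (u * n + p) = ar s1 2 (u * n + p)"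
    show "wp n W init_intervals ?A s2"
    proof (rule wp_init_intervals)
      show "rg s2 0 = n" using frameD[OF fr2] frameD[OF fr1] s by simp
      fix s3 assume fr3: "frame {4} {6, 7, 8} s2 s3" and t3: "tm s3 \<le> tm s2 + 100 + 50 * n"
        and sk: "skip_intervals n {..<n} (ar s3 6) (ar s3 7) (ar s3 8)"
      have ars: "ar s3 1 = ar s2 1" "ar s3 2 = ar s2 2" "ar s1 1 = ar s 1" "ar s1 2 = ar s 2"
        using frameD(2)[OF fr3] frameD(2)[OF fr1] by auto
      have r3: "rg s3 0 = n" "rg s3 13 = j" "rg s3 14 = v * n"
        using frameD(1)[OF fr3] frameD(1)[OF fr2] frameD(1)[OF fr1] s s1 by auto
      let ?s = "s3\<lparr>rg := (rg s3)(15 := 0, 16 := 0, 9 := n, 7 := j), tm := tm s3 + 14\<rparr>"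
      have "wp n W visit ?V ?s"
      proof (rule visited)
        show "frame {4, 7, 9, 14, 15, 16} {1, 2, 6, 7, 8} s ?s"
          using fr1 fr2 fr3 unfolding frame_def by auto
        show "ar ?s 1 (v * n + y) = n \<and> ar ?s 2 (v * n + y) = n" if "y < n" for y
          using row[OF that] ars(1,2) by (simp del: One_nat_def)
        show "ar ?s 1 (u * n + y) = ar s 1 (u * n + y) \<and> ar ?s 2 (u * n + y) = ar s 2 (u * n + y)" if "u \<noteq> v" "y < n" for u y
          using rows[OF that] ars by (simp del: One_nat_def)
        show "tm ?s \<le> tm s + 200 + 110 * n" using t2 t3 s1(2) by simp
      qed (use r3 sk in simp_all)
      then show "?A s3"
        using W0 r3 by (simp add: wp_Assign add.commute)
    qed
  qed
  have seq: "wp n W (c1 ;; c2) Q = wp n W c1 (wp n W c2 Q)" for c1 c2 Q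
    by (rule ext) (rule wp_Seq)
  show ?thesis
    unfolding bfs_from_def seq
    using W0 by (simp add: wp_Assign[of n W 14] s o Suc_less_square less_imp_le vn vnW init)
qed

text \<open>The draws may be arbitrary: they influence the time, through the boundaries in
  \<open>search_bound\<close>, but not the correctness.\<close>

lemma wp_apsp:
  assumes s: "rg s 0 = n" and rs: "tp s = rs" "length rs = n" "set rs \<subseteq> {..<n}"
    and adj: "adj_array n E (ar s 0)"
    and Q: "\<And>s'. tp s' = [] \<Longrightarrow> (\<And>v. v < n \<Longrightarrow> finished_row E v s') \<Longrightarrow>
      tm s' \<le> tm s + 100 + 400 * (n * n) + n * (10 + search_bound E (foldl (split_by E) [0..<n] rs)) \<Longrightarrow> Q s'"
  shows "wp n W apsp Q s"
  unfolding apsp_def wp_Seq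
proof (rule wp_sort_phase[OF s rs adj])
  define xs where "xs = foldl (split_by E) [0..<n] rs"
  have mset: "mset xs = mset [0..<n]" by (simp add: xs_def mset_foldl_split_by)
  have "set xs = {..<n}" using mset_eq_setD[OF mset] by (auto simp: atLeast0LessThan)
  moreover have "distinct xs" using mset_eq_imp_distinct_iff[OF mset] by simp
  moreover have "length xs = n" using mset_eq_length[OF mset] by simp
  ultimately have xs: "set xs = {..<n}" "distinct xs" "length xs = n" .
  fix s1 assume fr1: "frame {2, 3, 4, 5, 6, 7, 8} {3, 4} (s\<lparr>tp := []\<rparr>) s1" and t1: "tm s1 \<le> tm s + 30 + 200 * n * n"
    and "order_array n (foldl (split_by E) [0..<n] rs) (ar s1 3)"
  then have ord1: "order_array n xs (ar s1 3)" by (simp add: xs_def)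
  have r1: "rg s1 0 = n" "ar s1 0 = ar s 0" "tp s1 = []" using frameD[OF fr1] s by auto
  show "wp n W run_phase (wp n W (Assign 13 (Num 0)) (wp n W (While (Var 13) (Var 0) bfs_from) Q)) s1"
  proof (rule wp_run_phase[OF r1(1) _ ord1])
    show "adj_array n E (ar s1 0)" using adj r1 by simp
    show "set xs \<subseteq> {..<n}" using xs by simp
    fix s2 assume fr2: "frame {7, 8, 9, 10, 11, 12, 31} {5} s1 s2" and t2: "tm s2 \<le> tm s1 + 20 + 200 * (n * n)"
      and run2: "run_array n E xs (ar s2 5)"
    have r2: "rg s2 0 = n" "ar s2 0 = ar s 0" "ar s2 3 = ar s1 3" "tp s2 = []" using frameD[OF fr2] r1 by auto
    let ?B = "10 + search_bound E xs"
    define I where "I = (\<lambda>s'. frame ({4} \<union> {7..25} \<union> {31}) {1, 2, 6, 7, 8, 9} s2 s' \<and> rg s' 13 \<le> n \<and>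
      (\<forall>j<rg s' 13. finished_row E (xs ! j) s') \<and> tm s' \<le> tm s + 60 + 400 * (n * n) + rg s' 13 * ?B)"
    have loop: "wp n W (While (Var 13) (Var 0) bfs_from) Q s3" if "I s3" for s3
    proof (rule wp_While[where I = I and \<mu> = "\<lambda>s'. n - rg s' 13"])
      fix s' assume I: "I s'"
      define j where "j = rg s' 13"
      note I' = I[unfolded I_def, folded j_def]
      have fr: "frame ({4} \<union> {7..25} \<union> {31}) {1, 2, 6, 7, 8, 9} s2 s'" using I' by blast
      have r: "rg s' 0 = n" "ar s' 0 = ar s2 0" "ar s' 3 = ar s2 3" "ar s' 5 = ar s2 5" "tp s' = []"
        using frameD[OF fr] r2 by auto
      show "while_step n W I (\<lambda>s'. n - rg s' 13) (Var 13) (Var 0) bfs_from Q s'"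
      proof (cases "j < n")
        case False
        then have "j = n" using I' by simp
        have row: "finished_row E v (after 6 s')" if "v < n" for v
        proof -
          have "v \<in> set xs" using that xs(1) by blast
          then obtain i where "i < n" "v = xs ! i" unfolding in_set_conv_nth xs(3) by blast
          then have "finished_row E v s'" using I' \<open>j = n\<close> by blast
          then show ?thesis by (simp add: finished_row_def)
        qed
        have "Q (after 6 s')"
        proof (rule Q)
          have "tm s' \<le> tm s + 60 + 400 * (n * n) + n * ?B" using I' \<open>j = n\<close> by blast
          then show "tm (after 6 s') \<le> tm s + 100 + 400 * (n * n) + n * (10 + search_bound E (foldl (split_by E) [0..<n] rs))"
            unfolding xs_def[symmetric] by simp
        qed (use r row in simp_all)
        then show ?thesis using False r by (simp add: j_def)
      next
        case True
        have "wp n W bfs_from (\<lambda>s''. I s'' \<and> n - rg s'' 13 < n - rg s' 13) (after 6 s')"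
        proof (rule wp_bfs_from[OF _ _ True _ _ _ xs(1,2)])
          fix s3 assume fr3: "frame ({4} \<union> {7..25} \<union> {31}) {1, 2, 6, 7, 8, 9} (after 6 s') s3"
            and s3: "rg s3 13 = Suc j" "finished_row E (xs ! j) s3"
            and rows: "\<And>u y. u \<noteq> xs ! j \<Longrightarrow> y < n \<Longrightarrow> ar s3 1 (u * n + y) = ar (after 6 s') 1 (u * n + y) \<and>
              ar s3 2 (u * n + y) = ar (after 6 s') 2 (u * n + y)"
            and t3: "tm s3 \<le> tm (after 6 s') + search_bound E xs"
          have "finished_row E (xs ! i) s3" if "i < Suc j" for i
          proof (cases "i = j")
            case False
            \<comment> \<open>The order has no repetitions, so the current search writes to another
              row and leaves the finished ones alone.\<close>
            then have "xs ! i \<noteq> xs ! j" "finished_row E (xs ! i) s'"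
              using that True xs I' by (auto simp: nth_eq_iff_index_eq)
            then show ?thesis
              using rows[of "xs ! i"] unfolding finished_row_def
              by (auto elim!: ex_forward bfs_queue_cong)
          qed (use s3 in simp)
          moreover have "frame ({4} \<union> {7..25} \<union> {31}) {1, 2, 6, 7, 8, 9} s2 s3"
            using fr fr3 by (auto simp: frame_def)
          ultimately show "I s3 \<and> n - rg s3 13 < n - rg s' 13"
            using s3(1) t3 I' True by (simp add: I_def j_def[symmetric])
        qed (use r r2 adj ord1 run2 in \<open>auto simp: j_def\<close>)
        then show ?thesis using True r by (simp add: j_def)
      qed
    qed (rule that)
    have "I (s2\<lparr>rg := (rg s2)(13 := 0), tm := tm s2 + 3\<rparr>)"
      using t1 t2 by (simp add: I_def mult.assoc)
    from loop[OF this] show "wp n W (Assign 13 (Num 0)) (wp n W (While (Var 13) (Var 0) bfs_from) Q) s2"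
      using n4 W by (simp add: wp_Assign numeral_3_eq_3 small_less_W)
  qed
qed

end

section \<open>Running time and success probability\<close>

text \<open>Compiled code expects \<open>n * n\<close> in register 1 but cannot assign that
  register, hence one raw instruction in front. The compiled code starts at address 1.\<close>

definition apsp_program :: "instr list" where
  "apsp_program = Arith Mul 1 0 0 # ccom apsp 1"

text \<open>The value \<open>n\<close> is not a vertex, and as a parent it occurs exactly at the
  source and at unreached vertices; so the vertices and edges read off the parents are those of the
  certified tree.\<close>

lemma apsp_outputI:
  assumes row: "\<And>s. s < n \<Longrightarrow> \<exists>q. bfs_queue n E s (length q) q (out_dist n \<sigma> s) (out_parent n \<sigma> s)"
  shows "apsp_output n E \<sigma>"
  unfolding apsp_output_def
proof (intro allI impI conjI)
  fix s assume s: "s < n"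
  obtain q where q: "bfs_queue n E s (length q) q (out_dist n \<sigma> s) (out_parent n \<sigma> s)"
    using row[OF s] by blast
  note B = bfs_queue_basic[OF q]
  have unreached: "out_dist n \<sigma> s v = n \<and> out_parent n \<sigma> s v = n" if "v < n" "v \<notin> set q" for v
    using q that unfolding bfs_queue_def by blast
  have cert: "bfs_cert {..<n} E s (set q) (out_dist n \<sigma> s) (out_parent n \<sigma> s)"
    by (rule bfs_queue_cert[OF q])
  have parent: "out_parent n \<sigma> s v \<noteq> n" if "v \<in> set q - {s}" for v
  proof -
    have "out_parent n \<sigma> s v \<in> set q" using cert that unfolding bfs_cert_def by blast
    then show ?thesis using B(2) by auto
  qed
  have iff: "v < n \<and> out_parent n \<sigma> s v \<noteq> n \<longleftrightarrow> v \<in> set q - {s}" for v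
    using parent[of v] unreached[of v] B(2,6) by auto
  show "case graph_dist {..<n} E s v of enat d \<Rightarrow> out_dist n \<sigma> s v = d | \<infinity> \<Rightarrow> out_dist n \<sigma> s v = n"
    if "v < n" for v
    using unreached[OF that] by (simp add: graph_dist_bfs_cert[OF cert])
  show "out_parent n \<sigma> s s = n" by (rule B(6))
  have "out_tree_verts n \<sigma> s = set q"
    using iff B(3) by (auto simp: out_tree_verts_def)
  moreover have "out_tree_edges n \<sigma> s = {{v, out_parent n \<sigma> s v} | v. v \<in> set q - {s}}"
    unfolding out_tree_edges_def iff ..
  ultimately show "shortest_path_tree {..<n} E s (out_tree_verts n \<sigma> s) (out_tree_edges n \<sigma> s)"
    using shortest_path_tree_bfs_cert[OF cert] by simp
qed

lemma apsp_program_reaches: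
  assumes n: "n \<ge> 4" and W: "10 * (n * n) < 2 ^ w" and rs: "length rs = n" "set rs \<subseteq> {..<n}"
  shows "\<exists>t \<sigma>'. t \<le> 101 + 400 * (n * n) + n * (10 + wide_words.search_bound n E (foldl (split_by E) [0..<n] rs)) \<and>
    halted apsp_program \<sigma>' \<and> apsp_output n E \<sigma>' \<and> reach n w apsp_program (apsp_input n E) rs t \<sigma>' []"
proof -
  interpret wide_words n "2 ^ w" using n W by unfold_locales
  let ?P = apsp_program
  define \<sigma>0 where "\<sigma>0 = apsp_input n E"
  define \<sigma>1 where "\<sigma>1 = set_reg 1 (n * n) \<sigma>0"
  \<comment> \<open>The arrays are views of the actual memory: blocks 0, 1 and 2 of
    \<open>n * n\<close> cells are the adjacency matrix and the two output matrices of the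
    specification.\<close>
  define s where "s = \<lparr>rg = (\<lambda>r. if r = 0 then n else if r = 1 then n * n else 0),
    ar = (\<lambda>j i. mem \<sigma>0 (j * (n * n) + i)), tp = rs, tm = 0\<rparr>"
  have nW: "n < 2 ^ w" "n * n < 2 ^ w" "1 < (2 ^ w :: nat)" using n by (auto intro!: small)
  have r1: "reach n w ?P \<sigma>0 rs 1 \<sigma>1 rs"
    using nW by (intro reach_step) (auto simp: apsp_program_def \<sigma>0_def \<sigma>1_def apsp_input_def)
  have sim: "sim n (2 ^ w) s \<sigma>1"
    using nW by (auto simp: sim_def s_def \<sigma>1_def \<sigma>0_def set_reg_def apsp_input_def)
  have adj: "adj_array n E (ar s 0)"
    by (auto simp: adj_array_def s_def \<sigma>0_def apsp_input_def mat_index_less)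
  have "wp n (2 ^ w) apsp (\<lambda>s'. tp s' = [] \<and> (\<forall>v<n. finished_row E v s') \<and>
      tm s' \<le> 100 + 400 * (n * n) + n * (10 + search_bound E (foldl (split_by E) [0..<n] rs))) s"
    by (rule wp_apsp[OF _ _ rs adj]) (auto simp: s_def)
  then obtain s' where s': "big n (2 ^ w) apsp s s'" "tp s' = []" "\<And>v. v < n \<Longrightarrow> finished_row E v s'"
    "tm s' \<le> 100 + 400 * (n * n) + n * (10 + search_bound E (foldl (split_by E) [0..<n] rs))"
    unfolding wp_def by blast
  have code: "code_at ?P (pc \<sigma>1) (ccom apsp (pc \<sigma>1))"
    by (simp add: code_at_def apsp_program_def \<sigma>1_def \<sigma>0_def set_reg_def apsp_input_def)
  obtain t \<sigma>' where t: "t + tm s \<le> tm s'" "reach n w ?P \<sigma>1 (tp s) t \<sigma>' (tp s')"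
    "pc \<sigma>' = pc \<sigma>1 + length (ccom apsp (pc \<sigma>1))" "sim n (2 ^ w) s' \<sigma>'"
    using ccom_correct[OF W nW(1) refl s'(1) sim code] by blast
  have "reach n w ?P \<sigma>0 rs (1 + t) \<sigma>' []"
    using reach_trans[OF r1, of t \<sigma>' "[]"] t(2) s'(2) by (simp add: s_def)
  moreover have "halted ?P \<sigma>'"
    using t(3) by (simp add: halted_def apsp_program_def \<sigma>1_def \<sigma>0_def set_reg_def apsp_input_def)
  moreover have "apsp_output n E \<sigma>'"
  proof (rule apsp_outputI)
    fix v assume v: "v < n"
    obtain q where q: "bfs_queue n E v (length q) q (\<lambda>y. ar s' 1 (v * n + y)) (\<lambda>y. ar s' 2 (v * n + y))"
      using s'(3)[OF v] unfolding finished_row_def by blast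
    have cell: "mem \<sigma>' (j * (n * n) + (v * n + y)) = ar s' j (v * n + y)" if "y < n" "j < 10" for j y
      using t(4) mat_index_less[OF v that(1)] that(2) unfolding sim_def by blast
    have "bfs_queue n E v (length q) q (out_dist n \<sigma>' v) (out_parent n \<sigma>' v)"
      by (rule bfs_queue_cong[OF q])
         (use cell[of _ 1] cell[of _ 2] in \<open>simp add: out_dist_def out_parent_def add.assoc mult.assoc\<close>)
    then show "\<exists>q. bfs_queue n E v (length q) q (out_dist n \<sigma>' v) (out_parent n \<sigma>' v)" by blast
  qed
  moreover have "1 + t \<le> 101 + 400 * (n * n) + n * (10 + search_bound E (foldl (split_by E) [0..<n] rs))"
    using t(1) s'(4) by simp
  ultimately show ?thesis unfolding \<sigma>0_def by blast
qed

text \<open>\<open>n < 2 ^ floorlog 2 n\<close> and \<open>16 \<le> n * n\<close>, so four times the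
  bit length of \<open>n\<close> suffices to address ten arrays of \<open>n * n\<close>
  cells.\<close>

lemma word_length:
  assumes "n \<ge> (4::nat)"
  shows "10 * (n * n) < 2 ^ (4 * floorlog 2 n)"
proof -
  have "n < 2 ^ floorlog 2 n" using floorlog_bounds[of n 2] assms by simp
  then have "n ^ 4 \<le> (2 ^ floorlog 2 n) ^ 4" by (intro power_mono) auto
  also have "\<dots> = 2 ^ (4 * floorlog 2 n)" by (simp add: power_mult[symmetric] mult.commute)
  finally have "n ^ 4 \<le> 2 ^ (4 * floorlog 2 n)" .
  moreover have "16 * (n * n) \<le> (n * n) * (n * n)"
    using mult_mono[OF assms assms] by (intro mult_right_mono) auto
  then have "10 * (n * n) < n ^ 4" using assms by (simp add: power4_eq_xxxx mult.assoc)
  ultimately show ?thesis by simp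
qed

text \<open>The step count of \<open>apsp_program_reaches\<close> with \<open>search_bound\<close>
  inserted; \<open>floorlog\<close> is replaced by a logarithm plus one, and the number of
  boundaries by the bound of \<open>sum_boundaries_le\<close>.\<close>

definition time_bound :: "real \<Rightarrow> nat \<Rightarrow> real" where
  "time_bound c n = 101 + 400 * (real n)\<^sup>2 + real n * (1010 + 1000 * real n +
     200 * ((real n + 1) * (log 2 (real n + 1) + 1)) +
     100 * (c * real n + 16 * c * real n * (ln (real n))\<^sup>2 + 8 * real n * ln (real n)))"

lemma time_bound_bigo:
  assumes "c > 0"
  shows "(\<lambda>n. real (nat \<lceil>time_bound c n\<rceil>)) \<in> O(\<lambda>n. (real n)\<^sup>2 * (ln (real n))\<^sup>2)"
proof -
  \<comment> \<open>The added 1 absorbs the ceiling.\<close>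
  have "(\<lambda>n. time_bound c n + 1) \<in> O(\<lambda>n. (real n)\<^sup>2 * (ln (real n))\<^sup>2)"
    unfolding time_bound_def using assms by real_asymp
  moreover have "(\<lambda>n. real (nat \<lceil>time_bound c n\<rceil>)) \<in> O(\<lambda>n. time_bound c n + 1)"
  proof (rule bigoI[where c = 1], rule eventually_mono[OF eventually_ge_at_top[of 1]])
    fix n :: nat assume "1 \<le> n"
    then have "0 \<le> time_bound c n"
      using assms unfolding time_bound_def by (intro add_nonneg_nonneg mult_nonneg_nonneg) auto
    then show "norm (real (nat \<lceil>time_bound c n\<rceil>)) \<le> 1 * norm (time_bound c n + 1)" by simp
  qed
  ultimately show ?thesis using landau_o.big_trans by blast
qed

lemma steps_le_time_bound:
  assumes n: "n \<ge> 4" and c: "c > 0" and lin: "linear_nbhd_complexity c {..<n} E" and good: "good_draws n E rs"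
  shows "real (101 + 400 * (n * n) + n * (10 + wide_words.search_bound n E (foldl (split_by E) [0..<n] rs)))
    \<le> time_bound c n"
proof -
  interpret wide_words n "Suc (10 * (n * n))" using n by unfold_locales simp_all
  let ?xs = "foldl (split_by E) [0..<n] rs"
  let ?X = "(real n + 1) * (log 2 (real n + 1) + 1)"
  let ?Y = "c * real n + 16 * c * real n * (ln (real n))\<^sup>2 + 8 * real n * ln (real n)"
  have "real (floorlog 2 (n + 1)) \<le> log 2 (real n + 1) + 1"
    by (simp add: floorlog_def add.commute)
  then have log: "(real n + 1) * real (floorlog 2 (n + 1)) \<le> ?X"
    by (intro mult_left_mono) auto
  have sum: "real (\<Sum>u<n. card (boundaries E ?xs u))
      \<le> ?Y"
    using sum_boundaries_le[OF lin c _ good] n by simp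
  have "10 + real (search_bound E ?xs) = 1010 + 1000 * real n + 200 * ((real n + 1) * real (floorlog 2 (n + 1))) +
      100 * real (\<Sum>u<n. card (boundaries E ?xs u))"
    unfolding search_bound_def by (simp add: algebra_simps)
  also have "\<dots> \<le> 1010 + 1000 * real n + 200 * (?X) +
     100 * (?Y)"
    using log sum by (intro add_mono mult_left_mono order_refl) auto
  finally have "10 + real (search_bound E ?xs) \<le> 1010 + 1000 * real n +
     200 * (?X) +
     100 * (?Y)" .
  then have "real n * (10 + real (search_bound E ?xs)) \<le> real n * (1010 + 1000 * real n +
     200 * (?X) +
     100 * (?Y))"
    by (intro mult_left_mono) auto
  then show ?thesis by (simp add: time_bound_def power2_eq_square)
qed

text \<open>Every good tape leads to a correct output in time, and good tapes make up at least a
  fraction \<open>1 - 1 / n\<close> of all \<open>n ^ n\<close> tapes.\<close>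

lemma apsp_success_prob_ge:
  assumes n: "n \<ge> 4" and c: "c > 0" and lin: "linear_nbhd_complexity c {..<n} E"
  shows "apsp_success_prob apsp_program 4 (nat \<lceil>time_bound c n\<rceil>) n E \<ge> 1 - 1 / real n"
proof -
  let ?w = "4 * floorlog 2 n" and ?T = "nat \<lceil>time_bound c n\<rceil>"
  let ?X = "{\<sigma>. halted apsp_program \<sigma> \<and> apsp_output n E \<sigma>}"
  let ?S = "{rs. length rs = n \<and> set rs \<subseteq> {..<n} \<and>
    (\<exists>t\<le>?T. \<exists>\<sigma>'\<in>?X. reach n ?w apsp_program (apsp_input n E) rs t \<sigma>' [])}"
  have "{rs. good_draws n E rs} \<subseteq> ?S"
  proof
    fix rs assume "rs \<in> {rs. good_draws n E rs}"
    then have good: "good_draws n E rs" by simp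
    then have rs: "length rs = n" "set rs \<subseteq> {..<n}" by (auto simp: good_draws_def)
    obtain t \<sigma>' where t: "t \<le> 101 + 400 * (n * n) + n * (10 + wide_words.search_bound n E (foldl (split_by E) [0..<n] rs))"
      and \<sigma>': "\<sigma>' \<in> ?X" "reach n ?w apsp_program (apsp_input n E) rs t \<sigma>' []"
      using apsp_program_reaches[OF n word_length[OF n] rs] by blast
    have "real t \<le> time_bound c n"
      using t steps_le_time_bound[OF n c lin good] by linarith
    then have "t \<le> ?T" by linarith
    then show "rs \<in> ?S" using rs \<sigma>' by blast
  qed
  then have "card {rs. good_draws n E rs} \<le> card ?S"
    by (intro card_mono finite_subset[OF _ finite_lists_length_eq[of "{..<n}" n]]) auto
  then have "real n ^ n * (1 - 1 / real n) \<le> real (card ?S)"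
    using card_good_draws[of n E] n by linarith
  also have "\<dots> \<le> real n ^ n * measure_pmf.prob (run ?w apsp_program ?T (apsp_input n E)) ?X"
    using n by (intro prob_run_ge_tapes) auto
  finally show ?thesis using n by (simp add: apsp_success_prob_def)
qed

theorem theorem22:
  shows "\<exists>(P :: instr list) (k :: nat). k \<ge> 1 \<and>
    (\<forall>c :: real. c > 0 \<longrightarrow>
      (\<exists>(T :: nat \<Rightarrow> nat) (p :: nat \<Rightarrow> real).
         (\<lambda>n. real (T n)) \<in> O(\<lambda>n. (real n)\<^sup>2 * (ln (real n))\<^sup>2) \<and>
         p \<longlonglongrightarrow> 1 \<and>
         (\<forall>n E. simple_graph {..<n} E \<and> linear_nbhd_complexity c {..<n} E \<longrightarrow>
            apsp_success_prob P k (T n) n E \<ge> p n)))"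
proof (intro exI[of _ apsp_program] exI[of _ 4] conjI allI impI)
  fix c :: real assume c: "c > 0"
  \<comment> \<open>For \<open>n < 4\<close> nothing is claimed; this does not affect the
    limit.\<close>
  let ?T = "\<lambda>n. nat \<lceil>time_bound c n\<rceil>" and ?p = "\<lambda>n. if n \<ge> 4 then 1 - 1 / real n else 0"
  have "(\<lambda>n. 1 - 1 / real n) \<longlonglongrightarrow> 1" by real_asymp
  moreover have "eventually (\<lambda>n. 1 - 1 / real n = ?p n) sequentially"
    using eventually_ge_at_top[of 4] by eventually_elim simp
  ultimately have "?p \<longlonglongrightarrow> 1" by (rule Lim_transform_eventually)
  moreover have "apsp_success_prob apsp_program 4 (?T n) n E \<ge> ?p n"
    if "linear_nbhd_complexity c {..<n} E" for n E
    using apsp_success_prob_ge[OF _ c that] by (simp add: apsp_success_prob_def)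
  ultimately show "\<exists>(T :: nat \<Rightarrow> nat) (p :: nat \<Rightarrow> real).
         (\<lambda>n. real (T n)) \<in> O(\<lambda>n. (real n)\<^sup>2 * (ln (real n))\<^sup>2) \<and> p \<longlonglongrightarrow> 1 \<and>
         (\<forall>n E. simple_graph {..<n} E \<and> linear_nbhd_complexity c {..<n} E \<longrightarrow>
            apsp_success_prob apsp_program 4 (T n) n E \<ge> p n)"
    using time_bound_bigo[OF c] by (intro exI[of _ ?T] exI[of _ ?p]) blast
qed simp

end
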